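(* Let $d\in\{2,3\}$, let $\Omega\subset\mathbb{R}^d$ be a bounded simply connected open set with Lipschitz boundary and unit outward normal $\nu$, and let $k>0$ be such that $k^2$ is not a Dirichlet eigenvalue of $-\Delta$ in $\Omega$. Let $D\subset\Omega$ be the source region described in the context, $\rho\in L^\infty(D)$, $f\in H^{1/2}(\partial\Omega)$, and let $u^s\in H^1(\Omega)$ solve $\Delta u^s+k^2u^s=\rho\chi_D$ in $\Omega$, $u^s|_{\partial\Omega}=f$. For noise level $0<\delta<1$ let $(u^s_\delta,\partial_\nu u^s_\delta)\in H^{1/2}(\partial\Omega)\times H^{-1/2}(\partial\Omega)$ be perturbed Cauchy data satisfying $$\|\partial_\nu(u^s_\delta-u^s)\|_{H^{-1/2}(\partial\Omega)}\le C_1\delta,\qquad\|u^s_\delta-u^s\|_{H^{1/2}(\partial\Omega)}\le C_2\delta,$$ with positive constants $C_1,C_2$ independent of $\delta$. Then for any $z\in\mathbb{R}^d$, $$|W(z)-W^\delta(z)|=\mathcal{O}(\delta)\quad\text{as }\delta\to0,$$ where $W$ and $W^\delta$ are the imaging functionals built from the exact and the perturbed Cauchy data, respectively: $$W(z)=\Big|\int_{\mathbb{S}^{d-1}}R[e^{\mathrm{i}k\,\cdot\,\hat y}]\,\overline{e^{\mathrm{i}kz\cdot\hat y}}\,ds(\hat y)\Big|,\qquad W^\delta(z)=\Big|\int_{\mathbb{S}^{d-1}}R^\delta[e^{\mathrm{i}k\,\cdot\,\hat y}]\,\overline{e^{\mathrm{i}kz\cdot\hat y}}\,ds(\hat y)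\Big|.$$
   Context: Source region: $D=\bigcup_{j=1}^J(x_j+\epsilon B_j)$ with $x_j\in\Omega$, $|x_i-x_j|\ge c_0>0$ for $i\neq j$, $0<\epsilon\ll1$, each $B_j$ a bounded domain with Lipschitz boundary centered at the origin with $|B_j|=\mathcal{O}(1)$, the components pairwise disjoint, and $\mathrm{dist}(D,\partial\Omega)>0$. $\chi_D$ is the indicator function of $D$. For $v\in H^1(\Omega)$ with $\Delta v+k^2v=0$ in $\Omega$, $$R[v]=\int_{\partial\Omega}v\,\partial_\nu u^s-u^s\,\partial_\nu v\,ds,\qquad R^\delta[v]=\int_{\partial\Omega}v\,\partial_\nu u^s_\delta-u^s_\delta\,\partial_\nu v\,ds,$$ where the integrals are bilinear dual pairings between $H^{1/2}(\partial\Omega)$ and $H^{-1/2}(\partial\Omega)$. $R[e^{\mathrm{i}k\,\cdot\,\hat y}]$ and $R^\delta[e^{\mathrm{i}k\,\cdot\,\hat y}]$ denote these functionals applied to the plane wave $x\mapsto e^{\mathrm{i}kx\cdot\hat y}$, $\hat y\in\mathbb{S}^{d-1}$ (unit circle/sphere), regarded as functions of $\hat y$. The constant in $\mathcal{O}(\delta)$ is independent of $\delta$. *)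

theory Defs
  imports "HOL-Analysis.Analysis" "HOL-Library.Landau_Symbols"
begin

section \<open>Surface measure\<close>

text \<open>
  Surface integrals are integrals with respect to the \<open>(d-1)\<close>-dimensional Hausdorff measure,
  normalised so that it agrees with the classical surface area. The covering sets are required to
  be bounded because \<^const>\<open>diameter\<close> has no meaningful value on unbounded sets.
\<close>

definition hausdorff_pre :: "nat \<Rightarrow> real \<Rightarrow> 'a::metric_space set \<Rightarrow> ennreal" where
  "hausdorff_pre m e A =
     (INF C \<in> {C :: nat \<Rightarrow> 'a set. A \<subseteq> (\<Union>i. C i) \<and> (\<forall>i. bounded (C i) \<and> diameter (C i) \<le> e)}.
        \<Sum>i. ennreal (unit_ball_vol (real m) * (diameter (C i) / 2) ^ m))"

definition hausdorff_outer :: "nat \<Rightarrow> 'a::metric_space set \<Rightarrow> ennreal" where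
  "hausdorff_outer m A = (SUP e \<in> {0<..}. hausdorff_pre m e A)"

definition hausdorff_measure :: "nat \<Rightarrow> 'a::metric_space measure" where
  "hausdorff_measure m = measure_of UNIV (sets borel) (hausdorff_outer m)"

definition surface_measure :: "(real^'d) set \<Rightarrow> (real^'d) measure" where
  "surface_measure S = restrict_space (hausdorff_measure (CARD('d) - 1)) S"

section \<open>Lipschitz boundaries\<close>

text \<open>
  Near each boundary point \<open>S\<close> is the strict epigraph, in some direction \<open>e\<close>, of a Lipschitz
  function on the hyperplane orthogonal to \<open>e\<close>.
\<close>

definition lipschitz_boundary :: "(real^'d) set \<Rightarrow> bool" where
  "lipschitz_boundary S \<longleftrightarrow>
     (\<forall>x \<in> frontier S. \<exists>r>0. \<exists>e L. \<exists>\<gamma> :: real^'d \<Rightarrow> real.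
        norm e = 1 \<and> lipschitz_on L {y. y \<bullet> e = 0} \<gamma> \<and>
        S \<inter> ball x r = {y \<in> ball x r. \<gamma> (y - (y \<bullet> e) *\<^sub>R e) < y \<bullet> e})"

section \<open>Lebesgue spaces\<close>

definition L2_space :: "'a measure \<Rightarrow> ('a \<Rightarrow> 'b::real_normed_vector) set" where
  "L2_space M = {u \<in> borel_measurable M. integrable M (\<lambda>x. (norm (u x))\<^sup>2)}"

definition L2_norm :: "'a measure \<Rightarrow> ('a \<Rightarrow> 'b::real_normed_vector) \<Rightarrow> real" where
  "L2_norm M u = sqrt (integral\<^sup>L M (\<lambda>x. (norm (u x))\<^sup>2))"

definition Linf_space :: "'a measure \<Rightarrow> ('a \<Rightarrow> 'b::real_normed_vector) set" where
  "Linf_space M = {u \<in> borel_measurable M. \<exists>K. AE x in M. norm (u x) \<le> K}"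

section \<open>Test functions and weak derivatives\<close>

definition pderivative :: "'d \<Rightarrow> (real^'d \<Rightarrow> complex) \<Rightarrow> real^'d \<Rightarrow> complex" where
  "pderivative i f x = frechet_derivative f (at x) (axis i 1)"

primrec Ck :: "nat \<Rightarrow> (real^'d \<Rightarrow> complex) \<Rightarrow> bool" where
  "Ck 0 f \<longleftrightarrow> continuous_on UNIV f"
| "Ck (Suc m) f \<longleftrightarrow> f differentiable_on UNIV \<and> (\<forall>i. Ck m (pderivative i f))"

definition smooth :: "(real^'d \<Rightarrow> complex) \<Rightarrow> bool" where
  "smooth f \<longleftrightarrow> (\<forall>m. Ck m f)"

definition test_functions :: "(real^'d) set \<Rightarrow> (real^'d \<Rightarrow> complex) set" where
  "test_functions \<Omega> =
     {\<phi>. smooth \<phi> \<and> compact (closure {x. \<phi> x \<noteq> 0}) \<and> closure {x. \<phi> x \<noteq> 0} \<subseteq> \<Omega>}"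

definition has_weak_gradient ::
    "(real^'d) set \<Rightarrow> (real^'d \<Rightarrow> complex) \<Rightarrow> (real^'d \<Rightarrow> complex^'d) \<Rightarrow> bool" where
  "has_weak_gradient \<Omega> u G \<longleftrightarrow>
     (\<forall>\<phi> \<in> test_functions \<Omega>. \<forall>i.
        integral\<^sup>L (lebesgue_on \<Omega>) (\<lambda>x. u x * pderivative i \<phi> x) =
        - integral\<^sup>L (lebesgue_on \<Omega>) (\<lambda>x. G x $ i * \<phi> x))"

definition has_weak_laplacian ::
    "(real^'d) set \<Rightarrow> (real^'d \<Rightarrow> complex) \<Rightarrow> (real^'d \<Rightarrow> complex) \<Rightarrow> bool" where
  "has_weak_laplacian \<Omega> u h \<longleftrightarrow>
     (\<forall>\<phi> \<in> test_functions \<Omega>.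
        integral\<^sup>L (lebesgue_on \<Omega>) (\<lambda>x. u x * (\<Sum>i\<in>UNIV. pderivative i (pderivative i \<phi>) x)) =
        integral\<^sup>L (lebesgue_on \<Omega>) (\<lambda>x. h x * \<phi> x))"

text \<open>\<open>\<Delta>u + k\<^sup>2u = F\<close> in \<open>\<Omega>\<close>, in the sense of distributions.\<close>

definition solves_helmholtz ::
    "(real^'d) set \<Rightarrow> real \<Rightarrow> (real^'d \<Rightarrow> complex) \<Rightarrow> (real^'d \<Rightarrow> complex) \<Rightarrow> bool" where
  "solves_helmholtz \<Omega> k F u \<longleftrightarrow>
     has_weak_laplacian \<Omega> u (\<lambda>x. F x - complex_of_real (k\<^sup>2) * u x)"

section \<open>The space \<open>H\<^sup>1(\<Omega>)\<close>\<close>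

definition H1 :: "(real^'d) set \<Rightarrow> (real^'d \<Rightarrow> complex) set" where
  "H1 \<Omega> = {u \<in> L2_space (lebesgue_on \<Omega>).
             \<exists>G \<in> L2_space (lebesgue_on \<Omega>). has_weak_gradient \<Omega> u G}"

definition weak_gradient ::
    "(real^'d) set \<Rightarrow> (real^'d \<Rightarrow> complex) \<Rightarrow> real^'d \<Rightarrow> complex^'d" where
  "weak_gradient \<Omega> u = (SOME G. G \<in> L2_space (lebesgue_on \<Omega>) \<and> has_weak_gradient \<Omega> u G)"

definition H1_norm :: "(real^'d) set \<Rightarrow> (real^'d \<Rightarrow> complex) \<Rightarrow> real" where
  "H1_norm \<Omega> u =
     sqrt ((L2_norm (lebesgue_on \<Omega>) u)\<^sup>2 + (L2_norm (lebesgue_on \<Omega>) (weak_gradient \<Omega> u))\<^sup>2)"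

section \<open>Traces and the spaces \<open>H\<^sup>1\<^sup>/\<^sup>2(\<partial>\<Omega>)\<close>, \<open>H\<^sup>-\<^sup>1\<^sup>/\<^sup>2(\<partial>\<Omega>)\<close>\<close>

text \<open>
  The trace operator is the continuous extension to \<open>H\<^sup>1(\<Omega>)\<close> of the restriction to \<open>\<partial>\<Omega>\<close> of
  functions that are smooth up to the boundary, with values in \<open>L\<^sup>2(\<partial>\<Omega>)\<close>. Boundary functions are
  represented by functions on the whole space; only their values on \<open>\<partial>\<Omega>\<close>, up to surface null
  sets, matter.
\<close>

definition has_boundary_trace ::
    "(real^'d) set \<Rightarrow> (real^'d \<Rightarrow> complex) \<Rightarrow> (real^'d \<Rightarrow> complex) \<Rightarrow> bool" where
  "has_boundary_trace \<Omega> u g \<longleftrightarrow>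
     u \<in> H1 \<Omega> \<and> g \<in> L2_space (surface_measure (frontier \<Omega>)) \<and>
     (\<exists>\<phi> :: nat \<Rightarrow> real^'d \<Rightarrow> complex. (\<forall>n. smooth (\<phi> n)) \<and>
        (\<lambda>n. H1_norm \<Omega> (\<lambda>x. \<phi> n x - u x)) \<longlonglongrightarrow> 0 \<and>
        (\<lambda>n. L2_norm (surface_measure (frontier \<Omega>)) (\<lambda>x. \<phi> n x - g x)) \<longlonglongrightarrow> 0)"

definition boundary_trace ::
    "(real^'d) set \<Rightarrow> (real^'d \<Rightarrow> complex) \<Rightarrow> real^'d \<Rightarrow> complex" where
  "boundary_trace \<Omega> u = (SOME g. has_boundary_trace \<Omega> u g)"

text \<open>\<open>H\<^sup>1\<^sup>/\<^sup>2(\<partial>\<Omega>)\<close> is the trace space of \<open>H\<^sup>1(\<Omega>)\<close>, with the quotient norm.\<close>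

definition Hhalf :: "(real^'d) set \<Rightarrow> (real^'d \<Rightarrow> complex) set" where
  "Hhalf \<Omega> = {g. \<exists>u. has_boundary_trace \<Omega> u g}"

definition Hhalf_norm :: "(real^'d) set \<Rightarrow> (real^'d \<Rightarrow> complex) \<Rightarrow> real" where
  "Hhalf_norm \<Omega> g = Inf {H1_norm \<Omega> u | u. has_boundary_trace \<Omega> u g}"

text \<open>
  \<open>H\<^sup>-\<^sup>1\<^sup>/\<^sup>2(\<partial>\<Omega>)\<close> is the dual of \<open>H\<^sup>1\<^sup>/\<^sup>2(\<partial>\<Omega>)\<close>, as a space of (complex) linear functionals, so that
  application \<open>\<psi> g\<close> is the bilinear dual pairing \<open>\<integral>\<^sub>\<partial>\<^sub>\<Omega> g \<psi> ds\<close>. Values of \<open>\<psi>\<close> outside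
  \<open>H\<^sup>1\<^sup>/\<^sup>2(\<partial>\<Omega>)\<close> are irrelevant.
\<close>

type_synonym 'd boundary_functional = "(real^'d \<Rightarrow> complex) \<Rightarrow> complex"

definition Hmhalf :: "(real^'d) set \<Rightarrow> 'd boundary_functional set" where
  "Hmhalf \<Omega> = {\<psi>.
     (\<forall>g \<in> Hhalf \<Omega>. \<forall>h \<in> Hhalf \<Omega>. \<forall>a b. \<psi> (\<lambda>x. a * g x + b * h x) = a * \<psi> g + b * \<psi> h) \<and>
     (\<exists>K. \<forall>g \<in> Hhalf \<Omega>. cmod (\<psi> g) \<le> K * Hhalf_norm \<Omega> g)}"

definition Hmhalf_norm :: "(real^'d) set \<Rightarrow> 'd boundary_functional \<Rightarrow> real" where
  "Hmhalf_norm \<Omega> \<psi> = Sup {cmod (\<psi> g) | g. g \<in> Hhalf \<Omega> \<and> Hhalf_norm \<Omega> g \<le> 1}"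

text \<open>
  The normal derivative (outward normal) of \<open>u \<in> H\<^sup>1(\<Omega>)\<close> with \<open>\<Delta>u \<in> L\<^sup>2(\<Omega>)\<close>, defined by Green's
  formula \<open>\<integral>\<^sub>\<partial>\<^sub>\<Omega> w \<partial>\<^sub>\<nu>u ds = \<integral>\<^sub>\<Omega> \<nabla>u \<cdot> \<nabla>w + w \<Delta>u dx\<close> for all \<open>w \<in> H\<^sup>1(\<Omega>)\<close>.
\<close>

definition has_normal_derivative ::
    "(real^'d) set \<Rightarrow> (real^'d \<Rightarrow> complex) \<Rightarrow> 'd boundary_functional \<Rightarrow> bool" where
  "has_normal_derivative \<Omega> u \<psi> \<longleftrightarrow>
     u \<in> H1 \<Omega> \<and> \<psi> \<in> Hmhalf \<Omega> \<and>
     (\<exists>h \<in> L2_space (lebesgue_on \<Omega>). has_weak_laplacian \<Omega> u h \<and>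
        (\<forall>w g. has_boundary_trace \<Omega> w g \<longrightarrow>
           \<psi> g = integral\<^sup>L (lebesgue_on \<Omega>)
                   (\<lambda>x. (\<Sum>i\<in>UNIV. weak_gradient \<Omega> u x $ i * weak_gradient \<Omega> w x $ i) + h x * w x)))"

definition normal_derivative ::
    "(real^'d) set \<Rightarrow> (real^'d \<Rightarrow> complex) \<Rightarrow> 'd boundary_functional" where
  "normal_derivative \<Omega> u = (SOME \<psi>. has_normal_derivative \<Omega> u \<psi>)"

definition dirichlet_eigenvalue :: "(real^'d) set \<Rightarrow> real \<Rightarrow> bool" where
  "dirichlet_eigenvalue \<Omega> \<mu> \<longleftrightarrow>
     (\<exists>u \<in> H1 \<Omega>. has_boundary_trace \<Omega> u (\<lambda>_. 0) \<and>
        \<not> (AE x in lebesgue_on \<Omega>. u x = 0) \<and>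
        has_weak_laplacian \<Omega> u (\<lambda>x. - (complex_of_real \<mu> * u x)))"

section \<open>The source region\<close>

definition source_region ::
    "real \<Rightarrow> nat \<Rightarrow> (nat \<Rightarrow> real^'d) \<Rightarrow> (nat \<Rightarrow> (real^'d) set) \<Rightarrow> (real^'d) set" where
  "source_region \<epsilon> J c B = (\<Union>j\<in>{1..J}. (\<lambda>y. c j + \<epsilon> *\<^sub>R y) ` B j)"

text \<open>
  \<open>c0\<close> bounds the distances of the centres \<open>c j\<close> from below and \<open>K\<close> is the constant in
  \<open>|B\<^sub>j| = O(1)\<close>. ``Centred at the origin'' means that the centroid of \<open>B\<^sub>j\<close> is the origin.
\<close>

definition admissible_sources ::
    "(real^'d) set \<Rightarrow> real \<Rightarrow> real \<Rightarrow> real \<Rightarrow> nat \<Rightarrow> (nat \<Rightarrow> real^'d) \<Rightarrow>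
     (nat \<Rightarrow> (real^'d) set) \<Rightarrow> bool" where
  "admissible_sources \<Omega> c0 K \<epsilon> J c B \<longleftrightarrow>
     1 \<le> J \<and> 0 < \<epsilon> \<and> \<epsilon> < 1 \<and> 0 < c0 \<and>
     (\<forall>j\<in>{1..J}. c j \<in> \<Omega>) \<and>
     (\<forall>i\<in>{1..J}. \<forall>j\<in>{1..J}. i \<noteq> j \<longrightarrow> c0 \<le> norm (c i - c j)) \<and>
     (\<forall>j\<in>{1..J}. open (B j) \<and> connected (B j) \<and> B j \<noteq> {} \<and> bounded (B j) \<and>
        lipschitz_boundary (B j) \<and>
        integral\<^sup>L (lebesgue_on (B j)) (\<lambda>y. y) = 0 \<and> measure lebesgue (B j) \<le> K) \<and>
     disjoint_family_on (\<lambda>j. (\<lambda>y. c j + \<epsilon> *\<^sub>R y) ` B j) {1..J} \<and>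
     source_region \<epsilon> J c B \<subseteq> \<Omega> \<and>
     0 < setdist (source_region \<epsilon> J c B) (frontier \<Omega>)"

section \<open>The imaging functional\<close>

text \<open>
  For Cauchy data \<open>(f, \<psi>)\<close>, this is \<open>R[v] = \<integral>\<^sub>\<partial>\<^sub>\<Omega> v \<psi> - f \<partial>\<^sub>\<nu>v ds\<close>, meant for \<open>v \<in> H\<^sup>1(\<Omega>)\<close> with
  \<open>\<Delta>v + k\<^sup>2v = 0\<close> in \<open>\<Omega>\<close>.
\<close>

definition R_functional ::
    "(real^'d) set \<Rightarrow> (real^'d \<Rightarrow> complex) \<Rightarrow> 'd boundary_functional \<Rightarrow>
     (real^'d \<Rightarrow> complex) \<Rightarrow> complex" where
  "R_functional \<Omega> f \<psi> v = \<psi> (boundary_trace \<Omega> v) - normal_derivative \<Omega> v f"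

definition plane_wave :: "real \<Rightarrow> real^'d \<Rightarrow> real^'d \<Rightarrow> complex" where
  "plane_wave k y x = exp (\<i> * complex_of_real (k * (x \<bullet> y)))"

definition imaging ::
    "(real^'d) set \<Rightarrow> real \<Rightarrow> (real^'d \<Rightarrow> complex) \<Rightarrow> 'd boundary_functional \<Rightarrow> real^'d \<Rightarrow> real" where
  "imaging \<Omega> k f \<psi> z =
     cmod (integral\<^sup>L (surface_measure (sphere 0 1))
       (\<lambda>y. R_functional \<Omega> f \<psi> (plane_wave k y) * cnj (plane_wave k y z)))"

end

theory Submission
  imports Defs "HOL-Real_Asymp.Real_Asymp"
begin

text \<open>
  The quantity \<open>R[v]\<close> is linear in the Cauchy data, so \<open>W(z) - W\<^sup>\<delta>(z)\<close> is at most the integral over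
  the unit sphere of \<open>|R[v] - R\<^sup>\<delta>[v]|\<close>, where \<open>v\<close> runs through the plane waves. For each of them

    \<open>R[v] - R\<^sup>\<delta>[v] = \<langle>\<partial>\<^sub>\<nu>u\<^sup>s - \<partial>\<^sub>\<nu>u\<^sup>s\<^sub>\<delta>, v\<rangle> - \<langle>\<partial>\<^sub>\<nu>v, u\<^sup>s - u\<^sup>s\<^sub>\<delta>\<rangle>\<close>,

  and duality bounds this by \<open>C\<^sub>1\<delta>\<close> times the trace norm of \<open>v\<close> plus \<open>C\<^sub>2\<delta>\<close> times the norm of
  \<open>\<partial>\<^sub>\<nu>v\<close>. Plane waves with unit direction are bounded in \<open>C\<^sup>2\<close> uniformly in that direction, and the
  sphere has finite area; hence the bound \<open>O(\<delta>)\<close>.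

  This argument is short only if the objects in it exist. Traces and normal derivatives are chosen
  by a choice operator, and an integral of a function that is not integrable is zero by
  convention. It has to be shown that a plane wave has a trace and a normal derivative, that the
  choices do not matter, and that \<open>R[v]\<close> and \<open>R\<^sup>\<delta>[v]\<close> are each integrable in the direction of \<open>v\<close>.
  The three facts that carry this are as follows.

  First, boundaries of bounded Lipschitz domains and spheres have finite surface measure. A set
  whose product with an interval embeds into a bounded part of \<open>\<real>\<^sup>d\<close> by a map that does not contract
  distances much can contain only \<open>O(\<epsilon>\<^sup>1\<^sup>-\<^sup>d)\<close> points of mutual distance \<open>\<epsilon>\<close>, by comparison of
  volumes (\<open>hausdorff_outer_finite_if_collar\<close>).

  Second, for every bounded open set \<open>\<Omega>\<close> with boundary of finite surface measure,
  \<open>|\<integral>\<^sub>\<Omega> \<partial>\<^sub>if| \<le> K \<integral>\<^sub>\<partial>\<^sub>\<Omega> |f|\<close> (\<open>norm_integral_pderivative_le\<close>). This inequality takes the place of the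
  divergence theorem. The difference quotient of \<open>f\<close> along a step of length \<open>s\<close> integrates to the
  integral of \<open>f/s\<close> over the difference of \<open>\<Omega>\<close> and its translate. That difference lies in the
  tube swept out by translating \<open>\<partial>\<Omega>\<close> along the segment, and the volume of a tube is at most
  \<open>K s\<close> times the surface measure of its base (\<open>tube_cover\<close>).

  Third, weak derivatives are unique up to null sets, by testing against bump functions
  (\<open>AE_zero_if_orthogonal_to_test_functions\<close>). Hence weak gradients are linear and agree with the
  classical ones for smooth functions.

  For smooth \<open>v\<close> the functional \<open>w \<mapsto> \<integral>\<^sub>\<Omega> \<nabla>v \<cdot> \<nabla>w + w \<Delta>v\<close> vanishes on every \<open>w \<in> H\<^sup>1\<close> with trace zero,
  since for smooth \<open>w\<close> its integrand is a divergence and the second fact bounds it by the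
  \<open>L\<^sup>2\<close> norm of \<open>w\<close> on \<open>\<partial>\<Omega>\<close> (\<open>green_pairing_zero_trace\<close>). So it descends to traces and is the normal
  derivative of \<open>v\<close> (\<open>normal_derivative_smooth\<close>). Its bound in terms of the \<open>C\<^sup>2\<close> size of \<open>v\<close> gives
  both the estimate above and the Lipschitz continuity of \<open>R\<close> in the direction of the plane wave,
  which yields integrability (\<open>R_functional_plane_wave_continuous\<close>).
\<close>

section \<open>Sets of finite surface measure\<close>

lemma space_hausdorff_measure [simp]: "space (hausdorff_measure m) = UNIV"
  by (simp add: hausdorff_measure_def space_measure_of_conv)

lemma sets_hausdorff_measure [simp, measurable_cong]: "sets (hausdorff_measure m) = sets borel"
  by (simp add: hausdorff_measure_def sets_measure_of_conv sets.sigma_sets_eq[of borel, simplified])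

text \<open>
  The constructor of measures from set functions returns the null measure when the set function is
  not a measure on the generated \<open>\<sigma>\<close>-algebra. Upper bounds for the outer measure therefore
  carry over to the measure in either case; lower bounds do not.
\<close>

lemma emeasure_hausdorff_measure:
  fixes A :: "'a::metric_space set"
  shows "emeasure (hausdorff_measure m) A =
     (if A \<in> sets borel \<and> measure_space UNIV (sets borel) (hausdorff_outer m :: 'a::metric_space set \<Rightarrow> ennreal)
      then hausdorff_outer m A else 0)"
  by (simp add: hausdorff_measure_def emeasure_measure_of_conv sets.sigma_sets_eq[of borel, simplified])

lemma emeasure_hausdorff_measure_le: "emeasure (hausdorff_measure m) A \<le> hausdorff_outer m A"
  by (simp add: emeasure_hausdorff_measure)

lemma hausdorff_pre_le_finite_cover:
  fixes A :: "'a::euclidean_space set"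
  assumes "finite P" "A \<subseteq> (\<Union>p\<in>P. cball p r)" "0 \<le> r" "2 * r \<le> e" "1 \<le> m"
  shows "hausdorff_pre m e A \<le> ennreal (card P * (unit_ball_vol (real m) * r ^ m))"
proof -
  obtain h where h: "bij_betw h {0..<card P} P"
    using ex_bij_betw_nat_finite[OF assms(1)] by blast
  define C where "C = (\<lambda>i. if i < card P then cball (h i) r else {})"
  have d: "diameter (C i) \<le> 2 * r" for i
    using assms(3) by (simp add: C_def)
  have "A \<subseteq> (\<Union>i. C i)"
  proof
    fix x assume "x \<in> A"
    then obtain p where p: "p \<in> P" "x \<in> cball p r" using assms(2) by blast
    then obtain i where "i < card P" "p = h i"
      using h by (metis atLeastLessThan_iff bij_betw_imp_surj_on imageE)
    then have "x \<in> C i" using p by (simp add: C_def)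
    then show "x \<in> (\<Union>i. C i)" by blast
  qed
  moreover have "bounded (C i)" for i by (simp add: C_def)
  ultimately have mem: "C \<in> {C. A \<subseteq> (\<Union>i. C i) \<and> (\<forall>i. bounded (C i) \<and> diameter (C i) \<le> e)}"
    using d assms(4) by (auto intro: order_trans)
  have "hausdorff_pre m e A \<le> (\<Sum>i. ennreal (unit_ball_vol (real m) * (diameter (C i) / 2) ^ m))"
    unfolding hausdorff_pre_def by (rule INF_lower[OF mem])
  also have "\<dots> = (\<Sum>i<card P. ennreal (unit_ball_vol (real m) * (diameter (C i) / 2) ^ m))"
    by (rule suminf_finite) (use assms(5) in \<open>auto simp: C_def\<close>)
  also have "\<dots> \<le> (\<Sum>i<card P. ennreal (unit_ball_vol (real m) * r ^ m))"
  proof (rule sum_mono, rule ennreal_leI, rule mult_left_mono, rule power_mono)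
    show "diameter (C i) / 2 \<le> r" for i using d[of i] by simp
    show "0 \<le> diameter (C i) / 2" for i
      using diameter_ge_0[of "C i"] by (auto simp: C_def)
  qed simp
  also have "\<dots> = ennreal (card P * (unit_ball_vol (real m) * r ^ m))"
    using assms(3) by (simp add: ennreal_mult ennreal_of_nat_eq_real_of_nat)
  finally show ?thesis .
qed

text \<open>
  Volume comparison. The images of \<open>(p, j\<epsilon>)\<close> for \<open>p \<in> P\<close> and \<open>j \<le> 1/\<epsilon>\<close> are \<open>c\<epsilon>\<close>-separated, so
  the balls of radius \<open>c\<epsilon>/2\<close> around them are disjoint. There are at least \<open>card P / \<epsilon>\<close> of them
  inside a fixed ball, which leaves \<open>O(\<epsilon>\<^sup>1\<^sup>-\<^sup>d)\<close> for \<open>card P\<close>. The map \<open>\<Phi>\<close> thickens the set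
  \<open>S\<close> by one dimension, which is what makes the exponent \<open>d - 1\<close> appear without coordinates on
  \<open>S\<close>.
\<close>

lemma card_separated_collar:
  fixes S P :: "(real^'d) set" and \<Phi> :: "real^'d \<Rightarrow> real \<Rightarrow> real^'d"
  assumes c: "0 < c"
    and bd: "\<And>p a. p \<in> S \<Longrightarrow> 0 \<le> a \<Longrightarrow> a \<le> 1 \<Longrightarrow> norm (\<Phi> p a) \<le> R"
    and sep: "\<And>p p' a a'. p \<in> S \<Longrightarrow> p' \<in> S \<Longrightarrow> 0 \<le> a \<Longrightarrow> a \<le> 1 \<Longrightarrow> 0 \<le> a' \<Longrightarrow> a' \<le> 1 \<Longrightarrow>
            c * dist p p' \<le> dist (\<Phi> p a) (\<Phi> p' a')"
    and sep': "\<And>p a a'. p \<in> S \<Longrightarrow> 0 \<le> a \<Longrightarrow> a \<le> 1 \<Longrightarrow> 0 \<le> a' \<Longrightarrow> a' \<le> 1 \<Longrightarrow>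
            c * \<bar>a - a'\<bar> \<le> dist (\<Phi> p a) (\<Phi> p a')"
    and e: "0 < \<epsilon>" "\<epsilon> \<le> 1"
    and P: "finite P" "P \<subseteq> S" "\<And>p p'. p \<in> P \<Longrightarrow> p' \<in> P \<Longrightarrow> p \<noteq> p' \<Longrightarrow> \<epsilon> \<le> dist p p'"
  shows "card P * (unit_ball_vol (real CARD('d)) * (c / 2) ^ CARD('d) * \<epsilon> ^ (CARD('d) - 1))
           \<le> measure lborel (cball (0::real^'d) (R + c))"
proof -
  define J where "J = nat \<lfloor>1 / \<epsilon>\<rfloor>"
  have J: "1 / \<epsilon> \<le> real (Suc J)" "real J * \<epsilon> \<le> 1"
  proof -
    have r: "real J = of_int \<lfloor>1 / \<epsilon>\<rfloor>" using e by (simp add: J_def)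
    show "1 / \<epsilon> \<le> real (Suc J)" using r by simp linarith
    have "real J \<le> 1 / \<epsilon>" using r by simp
    then show "real J * \<epsilon> \<le> 1" using e by (simp add: field_simps)
  qed
  define I where "I = P \<times> {..J}"
  define b where "b = (\<lambda>(p, j). ball (\<Phi> p (real j * \<epsilon>)) (c * \<epsilon> / 2))"
  have fI: "finite I" using P(1) by (simp add: I_def)
  have jle: "0 \<le> real j * \<epsilon>" "real j * \<epsilon> \<le> 1" if "j \<le> J" for j
  proof -
    show "0 \<le> real j * \<epsilon>" using e by simp
    have "real j * \<epsilon> \<le> real J * \<epsilon>" using that e by simp
    then show "real j * \<epsilon> \<le> 1" using J(2) by simp
  qed
  have dis: "disjoint_family_on b I"
    unfolding disjoint_family_on_def
  proof (intro ballI impI)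
    fix u v assume uv: "u \<in> I" "v \<in> I" "u \<noteq> v"
    obtain p j where u: "u = (p, j)" by (cases u)
    obtain q l where v: "v = (q, l)" by (cases v)
    have m: "p \<in> P" "q \<in> P" "j \<le> J" "l \<le> J" using uv u v by (auto simp: I_def)
    have "c * \<epsilon> \<le> dist (\<Phi> p (real j * \<epsilon>)) (\<Phi> q (real l * \<epsilon>))"
    proof (cases "p = q")
      case False
      have "c * \<epsilon> \<le> c * dist p q" using P(3)[OF m(1,2) False] c by simp
      also have "\<dots> \<le> dist (\<Phi> p (real j * \<epsilon>)) (\<Phi> q (real l * \<epsilon>))"
        using sep jle m P(2) by blast
      finally show ?thesis .
    next
      case True
      then have "j \<noteq> l" using uv u v by auto
      then have "1 \<le> \<bar>real j - real l\<bar>" by linarith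
      then have "\<epsilon> \<le> \<bar>real j - real l\<bar> * \<epsilon>" using e by simp
      also have "\<dots> = \<bar>real j * \<epsilon> - real l * \<epsilon>\<bar>"
        using e by (simp add: abs_mult flip: left_diff_distrib)
      finally have "c * \<epsilon> \<le> c * \<bar>real j * \<epsilon> - real l * \<epsilon>\<bar>" using c by simp
      also have "\<dots> \<le> dist (\<Phi> p (real j * \<epsilon>)) (\<Phi> q (real l * \<epsilon>))"
        using sep' jle m P(2) True by blast
      finally show ?thesis .
    qed
    then show "b u \<inter> b v = {}"
      unfolding u v b_def by (auto intro!: disjoint_ballI simp: algebra_simps)
  qed
  have sub: "(\<Union>u\<in>I. b u) \<subseteq> cball 0 (R + c)"
  proof clarify
    fix x p j assume "(p, j) \<in> I" "x \<in> b (p, j)"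
    then have 1: "norm (\<Phi> p (real j * \<epsilon>)) \<le> R" "dist (\<Phi> p (real j * \<epsilon>)) x < c * \<epsilon> / 2"
      using bd jle P(2) by (auto simp: I_def b_def)
    have "c * \<epsilon> / 2 \<le> c" using c e mult_left_mono[of \<epsilon> 1 c] by simp
    moreover have "norm x \<le> norm (\<Phi> p (real j * \<epsilon>)) + dist (\<Phi> p (real j * \<epsilon>)) x"
      by norm
    ultimately show "x \<in> cball 0 (R + c)" using 1 by simp
  qed
  have "(\<Sum>u\<in>I. measure lborel (b u)) = measure lborel (\<Union>u\<in>I. b u)"
    by (rule measure_finite_Union[symmetric, OF fI _ dis])
       (auto simp: b_def emeasure_lborel_ball_finite[THEN less_imp_neq, simplified] split: prod.split)
  also have "\<dots> \<le> measure lborel (cball (0::real^'d) (R + c))"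
    by (rule measure_mono_fmeasurable[OF sub]) (auto simp: b_def fI countable_finite fmeasurable_def emeasure_lborel_cball_finite[unfolded infinity_ennreal_def]
          split: prod.split intro!: sets.countable_UN')
  finally have 1: "(\<Sum>u\<in>I. measure lborel (b u)) \<le> measure lborel (cball (0::real^'d) (R + c))" .
  have mb: "measure lborel (b u) = unit_ball_vol (real CARD('d)) * (c * \<epsilon> / 2) ^ CARD('d)" for u
    using c e by (auto simp: b_def content_ball split: prod.split)
  have "real (card P) * (unit_ball_vol (real CARD('d)) * (c / 2) ^ CARD('d) * \<epsilon> ^ (CARD('d) - 1))
     = real (card P) * (1 / \<epsilon>) * (unit_ball_vol (real CARD('d)) * (c * \<epsilon> / 2) ^ CARD('d))"
  proof -
    have "\<epsilon> ^ CARD('d) = \<epsilon> * \<epsilon> ^ (CARD('d) - 1)"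
      by (simp add: power_eq_if)
    then show ?thesis using e by (simp add: power_divide power_mult_distrib)
  qed
  also have "\<dots> \<le> real (card P) * real (Suc J) * (unit_ball_vol (real CARD('d)) * (c * \<epsilon> / 2) ^ CARD('d))"
    by (intro mult_right_mono mult_left_mono J(1)) (use c e in auto)
  also have "\<dots> = (\<Sum>u\<in>I. measure lborel (b u))"
    by (simp add: mb I_def card_cartesian_product algebra_simps)
  finally show ?thesis using 1 by simp
qed

text \<open>
  A maximal \<open>\<epsilon>\<close>-separated subset of \<open>S\<close> is an \<open>\<epsilon>\<close>-net, and by the volume comparison it has
  \<open>O(\<epsilon>\<^sup>1\<^sup>-\<^sup>d)\<close> points; the balls around it are admissible coverings of bounded total weight.
\<close>

lemma hausdorff_outer_finite_if_collar:
  fixes S :: "(real^'d) set" and \<Phi> :: "real^'d \<Rightarrow> real \<Rightarrow> real^'d"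
  assumes dim: "2 \<le> CARD('d)" and c: "0 < c"
    and bd: "\<And>p a. p \<in> S \<Longrightarrow> 0 \<le> a \<Longrightarrow> a \<le> 1 \<Longrightarrow> norm (\<Phi> p a) \<le> R"
    and sep: "\<And>p p' a a'. p \<in> S \<Longrightarrow> p' \<in> S \<Longrightarrow> 0 \<le> a \<Longrightarrow> a \<le> 1 \<Longrightarrow> 0 \<le> a' \<Longrightarrow> a' \<le> 1 \<Longrightarrow>
            c * dist p p' \<le> dist (\<Phi> p a) (\<Phi> p' a')"
    and sep': "\<And>p a a'. p \<in> S \<Longrightarrow> 0 \<le> a \<Longrightarrow> a \<le> 1 \<Longrightarrow> 0 \<le> a' \<Longrightarrow> a' \<le> 1 \<Longrightarrow>
            c * \<bar>a - a'\<bar> \<le> dist (\<Phi> p a) (\<Phi> p a')"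
  shows "hausdorff_outer (CARD('d) - 1) S < \<infinity>"
proof -
  define m where "m = CARD('d) - 1"
  define V where "V = measure lborel (cball (0::real^'d) (R + c))"
  define q where "q = unit_ball_vol (real CARD('d)) * (c / 2) ^ CARD('d)"
  have q: "0 < q" using c by (simp add: q_def)
  have m: "1 \<le> m" using dim by (simp add: m_def)
  have bound: "hausdorff_pre m e S \<le> ennreal (unit_ball_vol (real m) * (V / q))" if e: "0 < e" for e
  proof -
    define \<epsilon> where "\<epsilon> = min e 1 / 2"
    have eps: "0 < \<epsilon>" "\<epsilon> \<le> 1" "2 * \<epsilon> \<le> e" using e by (auto simp: \<epsilon>_def)
    define Q where "Q = (\<lambda>P. finite P \<and> P \<subseteq> S \<and> (\<forall>p\<in>P. \<forall>p'\<in>P. p \<noteq> p' \<longrightarrow> \<epsilon> \<le> dist p p'))"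
    have cQ: "real (card P) * (q * \<epsilon> ^ m) \<le> V" if "Q P" for P
      using card_separated_collar[OF c bd sep sep' eps(1,2), where P = P] that
      unfolding Q_def V_def q_def m_def by (simp add: mult.assoc)
    have "card P < Suc (nat \<lceil>V / (q * \<epsilon> ^ m)\<rceil>)" if "Q P" for P
    proof -
      have "real (card P) \<le> V / (q * \<epsilon> ^ m)" using cQ[OF that] q eps by (simp add: pos_le_divide_eq)
      then show ?thesis by linarith
    qed
    then obtain P where P: "Q P" "\<And>P'. Q P' \<Longrightarrow> card P' \<le> card P"
      using ex_has_greatest_nat[of Q "{}" card "Suc (nat \<lceil>V / (q * \<epsilon> ^ m)\<rceil>)"]
      by (metis Q_def empty_iff empty_subsetI finite.emptyI)
    have cov: "S \<subseteq> (\<Union>p\<in>P. cball p \<epsilon>)"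
    proof (rule ccontr)
      assume "\<not> ?thesis"
      then obtain x where x: "x \<in> S" "x \<notin> (\<Union>p\<in>P. cball p \<epsilon>)" by blast
      then have x2: "\<And>p. p \<in> P \<Longrightarrow> \<epsilon> < dist p x" by (simp add: not_le)
      have "Q (insert x P)" using P(1) x(1) x2 unfolding Q_def
        by (auto simp: dist_commute intro: less_imp_le)
      moreover have "x \<notin> P" using x2[of x] eps by auto
      ultimately show False using P(2)[of "insert x P"] P(1) by (auto simp: Q_def)
    qed
    have "hausdorff_pre m e S \<le> ennreal (card P * (unit_ball_vol (real m) * \<epsilon> ^ m))"
      by (rule hausdorff_pre_le_finite_cover) (use P(1) cov eps m in \<open>auto simp: Q_def\<close>)
    also have "\<dots> \<le> ennreal (unit_ball_vol (real m) * (V / q))"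
    proof (rule ennreal_leI)
      have "real (card P) * \<epsilon> ^ m \<le> V / q" using cQ[OF P(1)] q by (simp add: pos_le_divide_eq mult_ac)
      then have "unit_ball_vol (real m) * (real (card P) * \<epsilon> ^ m) \<le> unit_ball_vol (real m) * (V / q)"
        by (intro mult_left_mono) auto
      then show "real (card P) * (unit_ball_vol (real m) * \<epsilon> ^ m) \<le> unit_ball_vol (real m) * (V / q)"
        by (simp add: mult_ac)
    qed
    finally show ?thesis .
  qed
  have "hausdorff_outer m S \<le> ennreal (unit_ball_vol (real m) * (V / q))"
    unfolding hausdorff_outer_def by (rule SUP_least) (use bound in auto)
  then show ?thesis unfolding m_def using le_less_trans by fastforce
qed

text \<open>
  The collar of the unit sphere is the spherical shell of radii between \<open>1\<close> and \<open>2\<close>; scaling two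
  unit vectors by factors at least \<open>1\<close> does not bring them closer.
\<close>

lemma emeasure_sphere_finite:
  assumes "2 \<le> CARD('d)"
  shows "emeasure (hausdorff_measure (CARD('d) - 1)) (sphere (0::real^'d) 1) < \<infinity>"
proof -
  have "hausdorff_outer (CARD('d) - 1) (sphere (0::real^'d) 1) < \<infinity>"
  proof (rule hausdorff_outer_finite_if_collar[where c = 1 and R = 2 and \<Phi> = "\<lambda>p a. (1 + a) *\<^sub>R p", OF assms])
    fix p p' :: "real^'d" and a a' :: real
    assume *: "p \<in> sphere 0 1" "0 \<le> a" "0 \<le> a'"
    have "dist ((1 + a) *\<^sub>R p) ((1 + a') *\<^sub>R p) = norm ((a - a') *\<^sub>R p)"
      by (simp add: dist_norm algebra_simps)
    then show "1 * \<bar>a - a'\<bar> \<le> dist ((1 + a) *\<^sub>R p) ((1 + a') *\<^sub>R p)"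
      using * by simp
    assume p': "p' \<in> sphere 0 1"
    have nd: "(norm (x - y))\<^sup>2 = (norm x)\<^sup>2 + (norm y)\<^sup>2 - 2 * (x \<bullet> y)" for x y :: "real^'d"
      by (simp add: power2_norm_eq_inner inner_diff_left inner_diff_right inner_commute)
    have "norm p = 1" "norm p' = 1" using * p' by simp_all
    then have ab: "(norm ((1 + a) *\<^sub>R p - (1 + a') *\<^sub>R p'))\<^sup>2 = (1 + a)\<^sup>2 + (1 + a')\<^sup>2 - 2 * ((1 + a) * (1 + a') * (p \<bullet> p'))"
      "(norm (p - p'))\<^sup>2 = 2 - 2 * (p \<bullet> p')"
      by (simp_all add: nd mult.assoc)
    have "(norm ((1 + a) *\<^sub>R p - (1 + a') *\<^sub>R p'))\<^sup>2
        = (a - a')\<^sup>2 + (1 + a) * (1 + a') * (norm (p - p'))\<^sup>2"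
      unfolding ab by (simp add: power2_eq_square algebra_simps)
    moreover have "1 * 1 \<le> (1 + a) * (1 + a')" using * by (intro mult_mono) auto
    then have "1 * (norm (p - p'))\<^sup>2 \<le> (1 + a) * (1 + a') * (norm (p - p'))\<^sup>2"
      by (intro mult_right_mono) auto
    ultimately have "(norm (p - p'))\<^sup>2 \<le> (norm ((1 + a) *\<^sub>R p - (1 + a') *\<^sub>R p'))\<^sup>2"
      using zero_le_power2[of "a - a'"] by linarith
    then show "1 * dist p p' \<le> dist ((1 + a) *\<^sub>R p) ((1 + a') *\<^sub>R p')"
      unfolding dist_norm mult_1_left by (rule power2_le_imp_le) simp
  qed auto
  then show ?thesis by (rule le_less_trans[OF emeasure_hausdorff_measure_le])
qed

text \<open>
  The collar of a graph is obtained by shifting it vertically. Two shifted points are at least as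
  far apart as their projections to the base, and on the graph that distance is comparable to the
  distance of the original points.
\<close>

lemma lipschitz_graph_finite:
  fixes e :: "real^'d" and \<gamma> :: "real^'d \<Rightarrow> real"
  assumes dim: "2 \<le> CARD('d)" and e: "norm e = 1" and L: "lipschitz_on L {y. y \<bullet> e = 0} \<gamma>"
    and S: "S \<subseteq> ball x r" "\<And>y. y \<in> S \<Longrightarrow> \<gamma> (y - (y \<bullet> e) *\<^sub>R e) = y \<bullet> e"
  shows "hausdorff_outer (CARD('d) - 1) S < \<infinity>"
proof (rule hausdorff_outer_finite_if_collar[where c = "1 / (1 + L)" and R = "norm x + r + 1"
      and \<Phi> = "\<lambda>p a. p + a *\<^sub>R e", OF dim])
  have L0: "0 \<le> L" using L by (rule lipschitz_on_nonneg)
  then show "0 < 1 / (1 + L)" by simp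
  have ee: "e \<bullet> e = 1" using e by (simp add: dot_square_norm)
  fix p p' and a a' :: real
  assume *: "p \<in> S" "0 \<le> a" "a \<le> 1"
  have "norm (p + a *\<^sub>R e) \<le> norm x + norm (p - x) + norm (a *\<^sub>R e)"
    using norm_triangle_ineq[of "x + (p - x)" "a *\<^sub>R e"] norm_triangle_ineq[of x "p - x"] by simp
  moreover have "norm (p - x) < r" using S(1) * by (auto simp: dist_norm norm_minus_commute)
  ultimately show "norm (p + a *\<^sub>R e) \<le> norm x + r + 1" using e * by simp
  have "1 / (1 + L) * \<bar>a - a'\<bar> \<le> 1 * \<bar>a - a'\<bar>"
    using L0 by (intro mult_right_mono) auto
  then show "1 / (1 + L) * \<bar>a - a'\<bar> \<le> dist (p + a *\<^sub>R e) (p + a' *\<^sub>R e)"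
    using e by (simp add: dist_norm flip: scaleR_diff_left)
  assume p': "p' \<in> S"
  define u where "u = (\<lambda>y. y - (y \<bullet> e) *\<^sub>R e)"
  have ue: "u y \<in> {y. y \<bullet> e = 0}" for y by (simp add: u_def inner_simps ee)
  have p_eq: "p = u p + \<gamma> (u p) *\<^sub>R e" "p' = u p' + \<gamma> (u p') *\<^sub>R e"
    using S(2) * p' by (simp_all add: u_def)
  have "dist p p' = norm ((u p - u p') + (\<gamma> (u p) - \<gamma> (u p')) *\<^sub>R e)"
    unfolding dist_norm by (subst p_eq(1), subst p_eq(2)) (simp add: algebra_simps)
  also have "\<dots> \<le> norm (u p - u p') + norm ((\<gamma> (u p) - \<gamma> (u p')) *\<^sub>R e)"
    by (rule norm_triangle_ineq)
  also have "\<dots> \<le> norm (u p - u p') + L * norm (u p - u p')"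
    using lipschitz_onD[OF L ue ue, of p p'] e by (simp add: dist_norm)
  finally have 1: "dist p p' \<le> (1 + L) * norm (u p - u p')" by (simp add: algebra_simps)
  \<comment> \<open>the orthogonal projection along e removes the vertical shift and does not increase norms\<close>
  define w where "w = p + a *\<^sub>R e - (p' + a' *\<^sub>R e)"
  have "u p - u p' = w - (w \<bullet> e) *\<^sub>R e"
    by (simp add: u_def w_def inner_simps ee algebra_simps)
  moreover have "(norm (w - (w \<bullet> e) *\<^sub>R e))\<^sup>2 = (norm w)\<^sup>2 - (w \<bullet> e)\<^sup>2"
    by (simp add: power2_norm_eq_inner inner_diff_left inner_diff_right inner_commute ee)
       (simp add: power2_eq_square)
  ultimately have "(norm (u p - u p'))\<^sup>2 \<le> (norm w)\<^sup>2" by simp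
  then have "norm (u p - u p') \<le> norm w" by (rule power2_le_imp_le) simp
  then have "(1 + L) * norm (u p - u p') \<le> (1 + L) * norm w" using L0 by (intro mult_left_mono) auto
  then have "dist p p' \<le> (1 + L) * norm w" using 1 by linarith
  then show "1 / (1 + L) * dist p p' \<le> dist (p + a *\<^sub>R e) (p' + a' *\<^sub>R e)"
    using L0 by (simp add: w_def dist_norm pos_divide_le_eq mult.commute)
qed

text \<open>
  Inside the ball of the definition a boundary point must lie on the graph itself: below the graph
  a whole neighbourhood misses \<open>\<Omega>\<close>, and above the graph the point belongs to the open set \<open>\<Omega>\<close>.
  Finitely many such balls cover the compact boundary.
\<close>

lemma emeasure_lipschitz_boundary_finite:
  fixes \<Omega> :: "(real^'d) set"
  assumes dim: "2 \<le> CARD('d)" and bd: "bounded \<Omega>" and lip: "lipschitz_boundary \<Omega>" and op: "open \<Omega>"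
  shows "emeasure (hausdorff_measure (CARD('d) - 1)) (frontier \<Omega>) < \<infinity>"
proof -
  let ?H = "hausdorff_measure (CARD('d) - 1) :: (real^'d) measure"
  have "\<exists>r>0. emeasure ?H (frontier \<Omega> \<inter> ball x r) < \<infinity>" if x: "x \<in> frontier \<Omega>" for x
  proof -
    obtain r e L \<gamma> where r: "0 < r" and e: "norm e = 1" and L: "lipschitz_on L {y. y \<bullet> e = 0} \<gamma>"
      and eq: "\<Omega> \<inter> ball x r = {y \<in> ball x r. \<gamma> (y - (y \<bullet> e) *\<^sub>R e) < y \<bullet> e}"
      using lip x unfolding lipschitz_boundary_def by blast
    have ee: "e \<bullet> e = 1" using e by (simp add: dot_square_norm)
    define g where "g = (\<lambda>y. \<gamma> (y - (y \<bullet> e) *\<^sub>R e) - y \<bullet> e)"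
    have "continuous_on UNIV (\<lambda>y. \<gamma> (y - (y \<bullet> e) *\<^sub>R e))"
      by (rule continuous_on_compose2[OF lipschitz_on_continuous_on[OF L]])
         (auto intro!: continuous_intros simp: inner_simps ee)
    then have cg: "continuous_on UNIV g" unfolding g_def by (intro continuous_intros)
    have "g y = 0" if y: "y \<in> frontier \<Omega> \<inter> ball x r" for y
    proof (rule ccontr)
      assume "g y \<noteq> 0"
      have yn: "y \<notin> \<Omega>" using y op by (auto simp: frontier_def interior_open)
      then have "\<not> g y < 0" using eq y by (auto simp: g_def)
      then have "0 < g y" using \<open>g y \<noteq> 0\<close> by simp
      moreover have "open {z. 0 < g z}"
        using cg by (intro open_Collect_less continuous_intros)
      ultimately have "open ({z. 0 < g z} \<inter> ball x r)" "y \<in> {z. 0 < g z} \<inter> ball x r"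
        using y by auto
      moreover have "y \<in> closure \<Omega>" using y by (simp add: frontier_def)
      ultimately have "\<Omega> \<inter> ({z. 0 < g z} \<inter> ball x r) \<noteq> {}"
        using open_Int_closure_eq_empty by (metis disjoint_iff inf_commute)
      then obtain z where "z \<in> \<Omega> \<inter> ball x r" "0 < g z" by blast
      then show False unfolding eq g_def by simp
    qed
    then have "hausdorff_outer (CARD('d) - 1) (frontier \<Omega> \<inter> ball x r) < \<infinity>"
      by (intro lipschitz_graph_finite[OF dim e L]) (auto simp: g_def)
    then show ?thesis using r le_less_trans[OF emeasure_hausdorff_measure_le] by blast
  qed
  then obtain r where r: "\<And>x. x \<in> frontier \<Omega> \<Longrightarrow> 0 < r x"
    "\<And>x. x \<in> frontier \<Omega> \<Longrightarrow> emeasure ?H (frontier \<Omega> \<inter> ball x (r x)) < \<infinity>" by metis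
  have "compact (frontier \<Omega>)" using bd by (rule compact_frontier_bounded)
  then obtain T where T: "T \<subseteq> frontier \<Omega>" "finite T" "frontier \<Omega> \<subseteq> (\<Union>x\<in>T. ball x (r x))"
    by (rule compactE_image[where C = "frontier \<Omega>" and f = "\<lambda>x. ball x (r x)"]) (use r in auto)
  have "frontier \<Omega> = (\<Union>x\<in>T. frontier \<Omega> \<inter> ball x (r x))" using T(3) by blast
  then have "emeasure ?H (frontier \<Omega>) = emeasure ?H (\<Union>x\<in>T. frontier \<Omega> \<inter> ball x (r x))" by simp
  also have "\<dots> \<le> (\<Sum>x\<in>T. emeasure ?H (frontier \<Omega> \<inter> ball x (r x)))"
    by (rule emeasure_subadditive_finite[OF T(2)]) auto
  also have "\<dots> < \<infinity>" using r(2) T by (auto simp: less_top)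
  finally show ?thesis .
qed

section \<open>The volume of tubes over a hypersurface\<close>

text \<open>
  The factor \<open>3 \<cdot> 2\<^sup>d \<cdot> |B\<^sub>d|\<close> comes from covering a tube by balls (\<open>tube_cover_small_set\<close>), the remaining
  quotient from converting powers of diameters into the weights used by the Hausdorff measure.
\<close>

definition tube_const :: "'d itself \<Rightarrow> real" where
  "tube_const _ = 3 * 2 ^ CARD('d) * unit_ball_vol (real CARD('d)) * 2 ^ (CARD('d) - 1)
     / unit_ball_vol (real (CARD('d) - 1))"

lemma tube_const_nonneg: "0 \<le> tube_const TYPE('d)"
  by (simp add: tube_const_def)

text \<open>
  A set of diameter at most \<open>r\<close> that is moved along a segment of length \<open>s \<ge> r\<close> stays within balls
  of radius \<open>2r\<close> centred at distance \<open>r\<close> from each other on the path of one point. There are at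
  most \<open>s/r + 1\<close> of them, and their total volume is of order \<open>s r\<^sup>d\<^sup>-\<^sup>1\<close>. The bound is stated for
  every \<open>r\<close> above the diameter because the diameter itself may be zero.
\<close>

lemma tube_cover_small_set:
  fixes C :: "(real^'d) set"
  assumes q: "norm q = 1" and r: "0 < r" "r \<le> s" and C: "bounded C" "diameter C \<le> r"
  shows "\<exists>V\<in>sets borel. (\<forall>b\<in>C. \<forall>t\<in>{0..s}. b + t *\<^sub>R q \<in> V) \<and>
           emeasure lborel V \<le> ennreal (3 * 2 ^ CARD('d) * unit_ball_vol (real CARD('d)) * s * r ^ (CARD('d) - 1))"
proof (cases "C = {}")
  case True
  then show ?thesis by (intro bexI[of _ "{}"]) auto
next
  case False
  then obtain p where p: "p \<in> C" by blast
  define N where "N = nat \<lfloor>s / r\<rfloor>"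
  define W where "W = (\<lambda>j. cball (p + (real j * r) *\<^sub>R q) (2 * r))"
  have N: "real N \<le> s / r" using r by (simp add: N_def)
  have "b + t *\<^sub>R q \<in> (\<Union>j\<le>N. W j)" if b: "b \<in> C" and t: "0 \<le> t" "t \<le> s" for b t
  proof -
    define j where "j = nat \<lfloor>t / r\<rfloor>"
    have "t / r \<le> s / r" using t r by (simp add: divide_right_mono)
    then have jN: "j \<le> N" unfolding j_def N_def by (intro nat_mono floor_mono)
    have "real j \<le> t / r" "t / r < real j + 1" using t r by (auto simp: j_def)
    then have jr: "real j * r \<le> t" "t \<le> real j * r + r" using r by (auto simp: field_simps)
    have "dist p b \<le> r" using diameter_bounded_bound[OF C(1) p b] C(2) by simp
    moreover have "dist (p + (real j * r) *\<^sub>R q) (b + t *\<^sub>R q) = norm ((p - b) + (real j * r - t) *\<^sub>R q)"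
      by (simp add: dist_norm algebra_simps)
    moreover have "norm ((p - b) + (real j * r - t) *\<^sub>R q) \<le> norm (p - b) + \<bar>real j * r - t\<bar>"
      using norm_triangle_ineq[of "p - b" "(real j * r - t) *\<^sub>R q"] q by simp
    ultimately have "b + t *\<^sub>R q \<in> W j" using jr by (auto simp: W_def dist_norm)
    then show ?thesis using jN by blast
  qed
  moreover have "emeasure lborel (\<Union>j\<le>N. W j) \<le>
      ennreal (3 * 2 ^ CARD('d) * unit_ball_vol (real CARD('d)) * s * r ^ (CARD('d) - 1))"
  proof -
    have "emeasure lborel (\<Union>j\<le>N. W j) \<le> (\<Sum>j\<le>N. emeasure lborel (W j))"
      by (rule emeasure_subadditive_finite) (auto simp: W_def)
    also have "\<dots> = (\<Sum>j\<le>N. ennreal (unit_ball_vol (real CARD('d)) * (2 * r) ^ CARD('d)))"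
      using r by (simp add: W_def emeasure_cball)
    also have "\<dots> = ennreal ((real N + 1) * (unit_ball_vol (real CARD('d)) * (2 * r) ^ CARD('d)))"
      using r by (simp add: ennreal_mult ennreal_of_nat_eq_real_of_nat ennreal_plus[symmetric] add.commute del: ennreal_plus)
    also have "\<dots> \<le> ennreal ((3 * s / r) * (unit_ball_vol (real CARD('d)) * (2 * r) ^ CARD('d)))"
    proof (intro ennreal_leI mult_right_mono)
      have "1 \<le> s / r" using r by simp
      then show "real N + 1 \<le> 3 * s / r" using N by linarith
    qed (use r in auto)
    also have "(3 * s / r) * (unit_ball_vol (real CARD('d)) * (2 * r) ^ CARD('d))
        = 3 * 2 ^ CARD('d) * unit_ball_vol (real CARD('d)) * s * r ^ (CARD('d) - 1)"
    proof -
      have "r ^ CARD('d) = r * r ^ (CARD('d) - 1)" by (simp add: power_eq_if)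
      then show ?thesis using r by (simp add: power_mult_distrib)
    qed
    finally show ?thesis .
  qed
  ultimately show ?thesis
    by (intro bexI[of _ "\<Union>j\<le>N. W j"]) (auto simp: W_def)
qed

text \<open>
  Sum the bounds for the members of a nearly optimal covering of \<open>A\<close> by sets of diameter at most
  \<open>s/2\<close>. The errors are \<open>\<eta>'\<close> for the covering and \<open>\<eta>' (1/2)\<^sup>i\<^sup>+\<^sup>1\<close> for enlarging the \<open>i\<close>-th
  diameter to a positive radius.
\<close>

lemma tube_cover:
  fixes A :: "(real^'d) set"
  assumes q: "norm q = 1" and s: "0 < s" and h: "hausdorff_outer (CARD('d) - 1) A \<le> ennreal h" "0 \<le> h"
    and \<eta>: "0 < \<eta>"
  shows "\<exists>V\<in>sets borel. (\<forall>b\<in>A. \<forall>t\<in>{0..s}. b + t *\<^sub>R q \<in> V) \<and>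
           emeasure lborel V \<le> ennreal (s * (tube_const TYPE('d) * h + \<eta>))"
proof -
  define m where "m = CARD('d) - 1"
  define K0 where "K0 = 3 * 2 ^ CARD('d) * unit_ball_vol (real CARD('d))"
  define K where "K = tube_const TYPE('d)"
  have K0: "0 < K0" by (simp add: K0_def)
  have K: "0 \<le> K" by (simp add: K_def tube_const_nonneg)
  have KK0: "K * (unit_ball_vol (real m) * (x / 2) ^ m) = K0 * x ^ m" for x
  proof -
    have "unit_ball_vol (real m) \<noteq> 0" using unit_ball_vol_pos[of "real m"] by linarith
    then show ?thesis unfolding K_def K0_def tube_const_def m_def[symmetric] by (simp add: power_divide)
  qed
  define \<eta>' where "\<eta>' = \<eta> / (K + 1)"
  have \<eta>': "0 < \<eta>'" using \<eta> K by (simp add: \<eta>'_def)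
  have "hausdorff_pre m (s / 2) A \<le> hausdorff_outer m A"
    unfolding hausdorff_outer_def using s by (intro SUP_upper) auto
  also have "\<dots> \<le> ennreal h" using h by (simp add: m_def)
  also have "\<dots> < ennreal (h + \<eta>')" using h(2) \<eta>' by (simp add: ennreal_less_iff)
  finally obtain C where C: "A \<subseteq> (\<Union>i. C i)" "\<And>i. bounded (C i)" "\<And>i. diameter (C i) \<le> s / 2"
    and sumC: "(\<Sum>i. ennreal (unit_ball_vol (real m) * (diameter (C i) / 2) ^ m)) < ennreal (h + \<eta>')"
    unfolding hausdorff_pre_def INF_less_iff by auto
  define d where "d = (\<lambda>i. diameter (C i))"
  have d0: "0 \<le> d i" for i unfolding d_def using C(2) by (rule diameter_ge_0)
  have "\<exists>r. 0 < r \<and> r \<le> s \<and> d i \<le> r \<and> K0 * r ^ m \<le> K0 * d i ^ m + \<eta>' * (1/2) ^ Suc i" for i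
  proof -
    have "((\<lambda>r. K0 * r ^ m) \<longlongrightarrow> K0 * d i ^ m) (at_right (d i))"
      by (intro tendsto_intros)
    moreover have "K0 * d i ^ m < K0 * d i ^ m + \<eta>' * (1/2) ^ Suc i" using \<eta>' by simp
    ultimately have "eventually (\<lambda>r. K0 * r ^ m < K0 * d i ^ m + \<eta>' * (1/2) ^ Suc i) (at_right (d i))"
      by (rule order_tendstoD(2))
    moreover have "eventually (\<lambda>r. r \<in> {d i<..<s}) (at_right (d i))"
      using C(3)[of i] s by (intro eventually_at_right_real) (simp add: d_def)
    ultimately have "eventually (\<lambda>r. K0 * r ^ m < K0 * d i ^ m + \<eta>' * (1/2) ^ Suc i \<and> r \<in> {d i<..<s}) (at_right (d i))"
      by (rule eventually_conj)
    then obtain r where "K0 * r ^ m < K0 * d i ^ m + \<eta>' * (1/2) ^ Suc i" "r \<in> {d i<..<s}"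
      using eventually_happens' trivial_limit_at_right_real by blast
    then show ?thesis using d0[of i] by (intro exI[of _ r]) auto
  qed
  then obtain r where r: "\<And>i. 0 < r i" "\<And>i. r i \<le> s" "\<And>i. d i \<le> r i"
    "\<And>i. K0 * r i ^ m \<le> K0 * d i ^ m + \<eta>' * (1/2) ^ Suc i" by metis
  have "\<exists>V\<in>sets borel. (\<forall>b\<in>C i. \<forall>t\<in>{0..s}. b + t *\<^sub>R q \<in> V) \<and>
           emeasure lborel V \<le> ennreal (K0 * s * r i ^ m)" for i
    using tube_cover_small_set[OF q r(1,2) C(2)] r(3) unfolding K0_def m_def d_def by blast
  then obtain V where V: "\<And>i. V i \<in> sets borel" "\<And>i b t. b \<in> C i \<Longrightarrow> t \<in> {0..s} \<Longrightarrow> b + t *\<^sub>R q \<in> V i"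
    "\<And>i. emeasure lborel (V i) \<le> ennreal (K0 * s * r i ^ m)" by metis
  have "emeasure lborel (\<Union>i. V i) \<le> (\<Sum>i. emeasure lborel (V i))"
    by (rule emeasure_subadditive_countably) (use V(1) in auto)
  also have "\<dots> \<le> (\<Sum>i. ennreal (s * K) * ennreal (unit_ball_vol (real m) * (d i / 2) ^ m)
                      + ennreal (s * \<eta>') * ennreal ((1/2) ^ Suc i))"
  proof (rule suminf_le)
    fix i
    have "K0 * s * r i ^ m \<le> s * (K0 * d i ^ m + \<eta>' * (1/2) ^ Suc i)"
      using mult_left_mono[OF r(4)[of i], of s] s by (simp add: mult_ac)
    also have "\<dots> = s * K * (unit_ball_vol (real m) * (d i / 2) ^ m) + s * \<eta>' * (1/2) ^ Suc i"
      using KK0[of "d i"] by (simp add: algebra_simps)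
    finally have "ennreal (K0 * s * r i ^ m) \<le>
        ennreal (s * K * (unit_ball_vol (real m) * (d i / 2) ^ m) + s * \<eta>' * (1/2) ^ Suc i)"
      by (rule ennreal_leI)
    also have "\<dots> = ennreal (s * K) * ennreal (unit_ball_vol (real m) * (d i / 2) ^ m)
                      + ennreal (s * \<eta>') * ennreal ((1/2) ^ Suc i)"
      using s K \<eta>' d0[of i]
      by (simp add: ennreal_mult[symmetric] ennreal_plus[symmetric] del: ennreal_plus power_Suc)
    finally show "emeasure lborel (V i) \<le> \<dots>" using V(3)[of i] by (rule order_trans[rotated])
  qed auto
  also have "\<dots> = ennreal (s * K) * (\<Sum>i. ennreal (unit_ball_vol (real m) * (d i / 2) ^ m))
        + ennreal (s * \<eta>') * (\<Sum>i. ennreal ((1/2) ^ Suc i))"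
    by (subst suminf_add[symmetric]) (auto simp: ennreal_suminf_cmult)
  also have "(\<Sum>i. ennreal ((1/2) ^ Suc i)) = ennreal 1"
    by (rule suminf_ennreal_eq[OF _ power_half_series]) simp
  also have "ennreal (s * K) * (\<Sum>i. ennreal (unit_ball_vol (real m) * (d i / 2) ^ m)) + ennreal (s * \<eta>') * ennreal 1
      \<le> ennreal (s * K) * ennreal (h + \<eta>') + ennreal (s * \<eta>') * ennreal 1"
    using sumC by (intro add_right_mono mult_left_mono) (auto simp: d_def)
  also have "\<dots> = ennreal (s * (K * h + \<eta>))"
  proof -
    have "s * K * (h + \<eta>') + s * \<eta>' = s * (K * h + (K + 1) * \<eta>')" by (simp add: algebra_simps)
    also have "(K + 1) * \<eta>' = \<eta>" using K by (simp add: \<eta>'_def)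
    finally have eq: "s * K * (h + \<eta>') + s * \<eta>' = s * (K * h + \<eta>)" .
    have "ennreal (s * K) * ennreal (h + \<eta>') + ennreal (s * \<eta>') * ennreal 1
        = ennreal (s * K * (h + \<eta>')) + ennreal (s * \<eta>')"
      using s K h(2) \<eta>' by (subst ennreal_mult[symmetric]) auto
    also have "\<dots> = ennreal (s * K * (h + \<eta>') + s * \<eta>')"
      using s K h(2) \<eta>' by (intro ennreal_plus[symmetric]) auto
    finally show ?thesis unfolding eq .
  qed
  finally have "emeasure lborel (\<Union>i. V i) \<le> ennreal (s * (tube_const TYPE('d) * h + \<eta>))"
    unfolding K_def .
  moreover have "\<forall>b\<in>A. \<forall>t\<in>{0..s}. b + t *\<^sub>R q \<in> (\<Union>i. V i)"
  proof (intro ballI)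
    fix b t assume "b \<in> A" and t: "t \<in> {0..s}"
    then obtain i where "b \<in> C i" using C(1) by auto
    then show "b + t *\<^sub>R q \<in> (\<Union>i. V i)" using V(2)[OF _ t] by auto
  qed
  ultimately show ?thesis using V(1) by (intro bexI[of _ "\<Union>i. V i"]) auto
qed

section \<open>Integrals of derivatives and boundary integrals\<close>

lemma emeasure_hausdorff_eq:
  fixes A :: "'a::metric_space set"
  assumes "measure_space UNIV (sets borel) (hausdorff_outer m :: 'a set \<Rightarrow> ennreal)" "A \<in> sets borel"
  shows "emeasure (hausdorff_measure m) A = hausdorff_outer m A"
  using assms by (simp add: emeasure_hausdorff_measure)

text \<open>
  Split the base \<open>F\<close> into the level sets \<open>A\<^sub>i\<close> on which \<open>|f|\<close> lies between \<open>i w\<close> and \<open>(i + 1) w\<close>.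
  For a small step \<open>s\<close>, uniform continuity gives \<open>|f| \<le> (i + 2) w\<close> on the tube over \<open>A\<^sub>i\<close>, whose
  volume is bounded by the surface measure of \<open>A\<^sub>i\<close>. The sum of \<open>i w\<close> times these measures is at most
  the surface integral of \<open>|f|\<close>, and the surplus is controlled by \<open>w\<close>.
\<close>

lemma tube_integral_bound:
  fixes F :: "(real^'d) set" and f :: "real^'d \<Rightarrow> complex"
  assumes ms: "measure_space UNIV (sets borel) (hausdorff_outer (CARD('d) - 1) :: (real^'d) set \<Rightarrow> ennreal)"
    and F: "compact F" "emeasure (hausdorff_measure (CARD('d) - 1)) F < \<infinity>"
    and f: "continuous_on UNIV f" and q: "norm q = 1" and \<omega>: "0 < \<omega>"
  shows "\<exists>\<delta>>0. \<forall>s\<in>{0<..<\<delta>}. \<exists>V\<in>sets borel. (\<forall>b\<in>F. \<forall>t\<in>{0..s}. b + t *\<^sub>R q \<in> V) \<and>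
           (\<integral>\<^sup>+x. ennreal (norm (f x)) * indicator V x \<partial>lborel)
             \<le> ennreal (s * (tube_const TYPE('d) * (LINT x|surface_measure F. norm (f x)) + \<omega>))"
proof -
  define H where "H = (hausdorff_measure (CARD('d) - 1) :: (real^'d) measure)"
  define K where "K = tube_const TYPE('d)"
  have K: "0 \<le> K" by (simp add: K_def tube_const_nonneg)
  have Fb [measurable]: "F \<in> sets borel" using F(1) by (rule borel_compact)
  have fm [measurable]: "f \<in> borel_measurable borel"
    using f by (rule borel_measurable_continuous_onI)
  have sH [simp]: "sets H = sets borel" "space H = UNIV" by (simp_all add: H_def)
  obtain M where M: "0 < M" "\<And>x. x \<in> F \<Longrightarrow> norm (f x) \<le> M"
  proof -
    have "compact (f ` F)" using f F(1) by (meson compact_continuous_image continuous_on_subset subset_UNIV)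
    then obtain M where "0 < M" "\<forall>z\<in>f ` F. norm z \<le> M" using compact_imp_bounded bounded_pos by metis
    then show ?thesis using that by auto
  qed
  define hF where "hF = measure H F"
  have hF: "0 \<le> hF" by (simp add: hF_def)
  \<comment> \<open>the level width is chosen such that the surplus 2 w K hF of all levels together is at most half
    of the allowed error\<close>
  define E where "E = 2 * K * hF + 1"
  define w where "w = \<omega> / (2 * E)"
  have E: "0 < E" using mult_nonneg_nonneg[OF K hF] unfolding E_def by linarith
  have w: "0 < w" using \<omega> E by (simp add: w_def)
  have w2: "2 * w * K * hF \<le> \<omega> / 2"
  proof -
    have "w * E = \<omega> / 2" using E by (simp add: w_def)
    then show ?thesis using w by (simp add: E_def algebra_simps)
  qed
  define N where "N = nat \<lfloor>M / w\<rfloor>"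
  define lev where "lev = (\<lambda>x. nat \<lfloor>norm (f x) / w\<rfloor>)"
  define A where "A = (\<lambda>i. {x \<in> F. lev x = i})"
  have lev: "real (lev x) * w \<le> norm (f x)" "norm (f x) < (real (lev x) + 1) * w" for x
  proof -
    have "real (lev x) \<le> norm (f x) / w" "norm (f x) / w < real (lev x) + 1"
      using w by (auto simp: lev_def)
    then show "real (lev x) * w \<le> norm (f x)" "norm (f x) < (real (lev x) + 1) * w"
      using w by (auto simp: field_simps)
  qed
  have levN: "lev x \<le> N" if "x \<in> F" for x
    unfolding lev_def N_def using M(2)[OF that] w by (intro nat_mono floor_mono divide_right_mono) auto
  have Ab [measurable]: "A i \<in> sets borel" for i
    unfolding A_def lev_def by measurable
  have Afin: "emeasure H (A i) < \<infinity>" for i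
    using emeasure_mono[of "A i" F H] F(2) by (auto simp: A_def H_def intro: le_less_trans)
  define h where "h = (\<lambda>i. measure H (A i))"
  have h: "hausdorff_outer (CARD('d) - 1) (A i) \<le> ennreal (h i)" for i
    using emeasure_hausdorff_eq[OF ms Ab[of i]] emeasure_eq_ennreal_measure[of H "A i"] Afin[of i]
    unfolding h_def H_def by (metis infinity_ennreal_def less_irrefl order_refl)
  have intA: "integrable H (\<lambda>x. indicator (A i) x *\<^sub>R c)" for i and c :: real
    using Afin[of i] by (intro integrable_scaleR_left) (auto simp: integrable_indicator_iff)
  have disA: "disjoint_family_on A {..N}" by (auto simp: disjoint_family_on_def A_def)
  have UA: "(\<Union>i\<le>N. A i) = F" using levN by (auto simp: A_def)
  have sumh: "(\<Sum>i\<le>N. h i) = hF"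
    unfolding h_def hF_def UA[symmetric]
    by (rule measure_finite_Union[symmetric, OF _ _ disA]) (use Afin in \<open>auto simp: less_top\<close>)
  have intf: "integrable H (\<lambda>x. indicator F x *\<^sub>R norm (f x))"
  proof (rule Bochner_Integration.integrable_bound)
    show "integrable H (\<lambda>x. indicator F x *\<^sub>R M)"
      using F(2) by (intro integrable_scaleR_left) (auto simp: integrable_indicator_iff H_def)
    show "(\<lambda>x. indicator F x *\<^sub>R norm (f x)) \<in> borel_measurable H"
      unfolding H_def by measurable
  qed (use M in \<open>auto simp: indicator_def\<close>)
  have sumI: "(\<Sum>i\<le>N. real i * w * h i) \<le> (LINT x|surface_measure F. norm (f x))"
  proof -
    have "(\<Sum>i\<le>N. real i * w * h i) = (\<Sum>i\<le>N. LINT x|H. indicator (A i) x *\<^sub>R (real i * w))"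
      using Afin by (intro sum.cong refl) (simp add: h_def)
    also have "\<dots> = (LINT x|H. (\<Sum>i\<le>N. indicator (A i) x *\<^sub>R (real i * w)))"
      by (rule Bochner_Integration.integral_sum[symmetric]) (rule intA)
    also have "\<dots> \<le> (LINT x|H. indicator F x *\<^sub>R norm (f x))"
    proof (rule integral_mono)
      show "integrable H (\<lambda>x. \<Sum>i\<le>N. indicator (A i) x *\<^sub>R (real i * w))"
        by (rule Bochner_Integration.integrable_sum) (rule intA)
      show "integrable H (\<lambda>x. indicator F x *\<^sub>R norm (f x))" by (rule intf)
      fix x
      show "(\<Sum>i\<le>N. indicator (A i) x *\<^sub>R (real i * w)) \<le> indicator F x *\<^sub>R norm (f x)"
      proof (cases "x \<in> F")
        case True
        have "(\<Sum>i\<le>N. indicator (A i) x *\<^sub>R (real i * w)) = (\<Sum>i\<le>N. if lev x = i then real i * w else 0)"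
          using True by (intro sum.cong) (auto simp: A_def)
        also have "\<dots> = real (lev x) * w" using levN[OF True] by simp
        finally show ?thesis using lev(1)[of x] True by simp
      next
        case False
        then have "(\<Sum>i\<le>N. indicator (A i) x *\<^sub>R (real i * w)) = 0"
          by (intro sum.neutral) (auto simp: A_def)
        then show ?thesis by simp
      qed
    qed
    also have "\<dots> = (LINT x|surface_measure F. norm (f x))"
      unfolding surface_measure_def H_def by (rule integral_restrict_space[symmetric]) simp
    finally show ?thesis .
  qed
  \<comment> \<open>the excess volume of each tube is multiplied by at most (N + 2) w, and there are N + 1 tubes\<close>
  define E' where "E' = (real N + 1) * ((real N + 2) * w)"
  have E': "0 < E'" using w by (simp add: E'_def)
  define \<eta> where "\<eta> = \<omega> / (2 * E')"
  have \<eta>: "0 < \<eta>" using \<omega> E' by (simp add: \<eta>_def)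
  have E\<eta>: "E' * \<eta> = \<omega> / 2" using E' by (simp add: \<eta>_def)
  obtain R where R: "\<And>x. x \<in> F \<Longrightarrow> norm x \<le> R"
    using F(1) compact_imp_bounded bounded_iff by metis
  have "uniformly_continuous_on (cball 0 (R + 1)) f"
    using f by (intro compact_uniformly_continuous) (auto intro: continuous_on_subset)
  then obtain \<delta>0 where \<delta>0: "0 < \<delta>0" "\<And>x y. x \<in> cball 0 (R+1) \<Longrightarrow> y \<in> cball 0 (R+1) \<Longrightarrow> dist y x < \<delta>0 \<Longrightarrow> dist (f y) (f x) < w"
    unfolding uniformly_continuous_on_def using w by metis
  define \<delta> where "\<delta> = min \<delta>0 1"
  show ?thesis
  proof (intro exI[of _ \<delta>] conjI ballI)
    show "0 < \<delta>" using \<delta>0 by (simp add: \<delta>_def)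
    fix s assume s: "s \<in> {0<..<\<delta>}"
    have "\<exists>V\<in>sets borel. (\<forall>b\<in>A i. \<forall>t\<in>{0..s}. b + t *\<^sub>R q \<in> V) \<and>
           emeasure lborel V \<le> ennreal (s * (K * h i + \<eta>))" for i
      unfolding K_def using s by (intro tube_cover q h \<eta>) (auto simp: h_def)
    then obtain V where V: "\<And>i. V i \<in> sets borel" "\<And>i b t. b \<in> A i \<Longrightarrow> t \<in> {0..s} \<Longrightarrow> b + t *\<^sub>R q \<in> V i"
      "\<And>i. emeasure lborel (V i) \<le> ennreal (s * (K * h i + \<eta>))" by metis
    \<comment> \<open>the covering of a tube may reach far outside of it, where f is not controlled\<close>
    define V' where "V' = (\<lambda>i. V i \<inter> {x. norm (f x) \<le> (real i + 2) * w})"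
    have [measurable]: "V' i \<in> sets borel" for i
      unfolding V'_def using V(1)[of i] by measurable
    have cov: "b + t *\<^sub>R q \<in> (\<Union>i\<le>N. V' i)" if b: "b \<in> F" and t: "t \<in> {0..s}" for b t
    proof -
      have n: "norm (t *\<^sub>R q) \<le> s" "s < \<delta>" using q t s by auto
      have "norm (b + t *\<^sub>R q) \<le> R + 1"
        using norm_triangle_ineq[of b "t *\<^sub>R q"] R[OF b] n by (simp add: \<delta>_def)
      moreover have "norm b \<le> R + 1" using R[OF b] by simp
      moreover have "dist (b + t *\<^sub>R q) b < \<delta>0" using n by (simp add: dist_norm \<delta>_def)
      ultimately have "dist (f (b + t *\<^sub>R q)) (f b) < w" using \<delta>0(2) by simp
      then have "norm (f (b + t *\<^sub>R q)) < norm (f b) + w"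
        using norm_triangle_ineq2[of "f (b + t *\<^sub>R q)" "f b"] by (simp add: dist_norm)
      also have "\<dots> \<le> (real (lev b) + 2) * w" using lev(2)[of b] by (simp add: algebra_simps)
      finally have "b + t *\<^sub>R q \<in> V' (lev b)"
        unfolding V'_def using V(2)[of b "lev b" t] b t by (auto simp: A_def)
      then show ?thesis using levN[OF b] by blast
    qed
    have "(\<integral>\<^sup>+x. ennreal (norm (f x)) * indicator (\<Union>i\<le>N. V' i) x \<partial>lborel)
        \<le> (\<integral>\<^sup>+x. (\<Sum>i\<le>N. ennreal ((real i + 2) * w) * indicator (V i) x) \<partial>lborel)"
    proof (rule nn_integral_mono)
      fix x
      show "ennreal (norm (f x)) * indicator (\<Union>i\<le>N. V' i) x
          \<le> (\<Sum>i\<le>N. ennreal ((real i + 2) * w) * indicator (V i) x)"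
      proof (cases "x \<in> (\<Union>i\<le>N. V' i)")
        case True
        then obtain i where i: "i \<le> N" "x \<in> V' i" by blast
        then have "ennreal (norm (f x)) \<le> ennreal ((real i + 2) * w) * indicator (V i) x"
          by (auto simp: V'_def intro!: ennreal_leI)
        also have "\<dots> \<le> (\<Sum>i\<le>N. ennreal ((real i + 2) * w) * indicator (V i) x)"
          using i(1) by (intro member_le_sum) auto
        finally show ?thesis using True by simp
      qed simp
    qed
    also have "\<dots> = (\<Sum>i\<le>N. ennreal ((real i + 2) * w) * emeasure lborel (V i))"
      using V(1) by (subst nn_integral_sum) (auto simp: nn_integral_cmult_indicator)
    also have "\<dots> \<le> (\<Sum>i\<le>N. ennreal ((real i + 2) * w) * ennreal (s * (K * h i + \<eta>)))"
      using V(3) by (intro sum_mono mult_left_mono) auto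
    also have "\<dots> = ennreal (\<Sum>i\<le>N. (real i + 2) * w * (s * (K * h i + \<eta>)))"
      using w s K \<eta> by (subst sum_ennreal[symmetric]) (auto simp: ennreal_mult h_def)
    also have "\<dots> \<le> ennreal (s * (K * (LINT x|surface_measure F. norm (f x)) + \<omega>))"
    proof (rule ennreal_leI)
      have "(\<Sum>i\<le>N. (real i + 2) * w * (s * (K * h i + \<eta>)))
          = s * (K * (\<Sum>i\<le>N. real i * w * h i) + 2 * w * K * (\<Sum>i\<le>N. h i) + (\<Sum>i\<le>N. (real i + 2) * w * \<eta>))"
        by (simp add: sum_distrib_left sum.distrib[symmetric] algebra_simps)
      also have "(\<Sum>i\<le>N. (real i + 2) * w * \<eta>) \<le> (\<Sum>i\<le>N. (real N + 2) * w * \<eta>)"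
        using w \<eta> by (intro sum_mono mult_right_mono) auto
      also have "\<dots> = E' * \<eta>" by (simp add: E'_def algebra_simps)
      also have "\<dots> = \<omega> / 2" by (rule E\<eta>)
      finally have "(\<Sum>i\<le>N. (real i + 2) * w * (s * (K * h i + \<eta>)))
          \<le> s * (K * (\<Sum>i\<le>N. real i * w * h i) + 2 * w * K * (\<Sum>i\<le>N. h i) + \<omega> / 2)" using s by simp
      also have "\<dots> \<le> s * (K * (LINT x|surface_measure F. norm (f x)) + \<omega>)"
        using s w2 mult_left_mono[OF sumI K] unfolding sumh by (intro mult_left_mono) auto
      finally show "(\<Sum>i\<le>N. (real i + 2) * w * (s * (K * h i + \<eta>))) \<le> \<dots>" .
    qed
    finally have "(\<integral>\<^sup>+x. ennreal (norm (f x)) * indicator (\<Union>i\<le>N. V' i) x \<partial>lborel)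
        \<le> ennreal (s * (tube_const TYPE('d) * (LINT x|surface_measure F. norm (f x)) + \<omega>))"
      by (simp add: K_def)
    then show "\<exists>V\<in>sets borel. (\<forall>b\<in>F. \<forall>t\<in>{0..s}. b + t *\<^sub>R q \<in> V) \<and>
           (\<integral>\<^sup>+x. ennreal (norm (f x)) * indicator V x \<partial>lborel)
             \<le> ennreal (s * (tube_const TYPE('d) * (LINT x|surface_measure F. norm (f x)) + \<omega>))"
      using cov by (intro bexI[of _ "\<Union>i\<le>N. V' i"]) auto
  qed
qed

lemma integral_lebesgue_on_open:
  fixes g :: "'a::euclidean_space \<Rightarrow> 'b::{banach, second_countable_topology}"
  assumes "open \<Omega>" "continuous_on UNIV g"
  shows "(LINT x|lebesgue_on \<Omega>. g x) = (LINT x|lborel. indicator \<Omega> x *\<^sub>R g x)"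
proof -
  have [measurable]: "g \<in> borel_measurable borel" "\<Omega> \<in> sets borel"
    using assms by (auto intro: borel_measurable_continuous_onI)
  have "(LINT x|lebesgue_on \<Omega>. g x) = (LINT x|lebesgue. indicator \<Omega> x *\<^sub>R g x)"
    using assms(1) by (intro integral_restrict_space) simp
  also have "\<dots> = (LINT x|lborel. indicator \<Omega> x *\<^sub>R g x)"
    by (rule integral_completion) measurable
  finally show ?thesis .
qed

lemma continuous_bounded_on:
  fixes g :: "'a::euclidean_space \<Rightarrow> 'b::real_normed_vector"
  assumes "bounded \<Omega>" "continuous_on UNIV g"
  shows "\<exists>B>0. \<forall>x\<in>\<Omega>. norm (g x) \<le> B"
proof -
  have "compact (g ` closure \<Omega>)"
    using assms by (intro compact_continuous_image) (auto intro: continuous_on_subset)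
  then obtain B where "0 < B" "\<forall>z\<in>g ` closure \<Omega>. norm z \<le> B"
    using compact_imp_bounded bounded_pos by metis
  then show ?thesis using closure_subset by blast
qed

lemma finite_measure_lebesgue_on_bounded:
  fixes \<Omega> :: "'a::euclidean_space set"
  assumes "bounded \<Omega>" "open \<Omega>"
  shows "finite_measure (lebesgue_on \<Omega>)"
  using assms by (intro finite_measure_lebesgue_on bounded_set_imp_lmeasurable) auto

lemma continuous_borel_measurable_lebesgue_on:
  fixes g :: "'a::euclidean_space \<Rightarrow> 'b::real_normed_vector"
  assumes "open \<Omega>" "continuous_on UNIV g"
  shows "g \<in> borel_measurable (lebesgue_on \<Omega>)"
  using assms by (intro continuous_imp_measurable_on_sets_lebesgue) (auto intro: continuous_on_subset)

lemma continuous_integrable_lebesgue_on: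
  fixes g :: "'a::euclidean_space \<Rightarrow> 'b::{banach, second_countable_topology}"
  assumes "bounded \<Omega>" "open \<Omega>" "continuous_on UNIV g"
  shows "integrable (lebesgue_on \<Omega>) g"
proof -
  obtain B where "\<forall>x\<in>\<Omega>. norm (g x) \<le> B" using continuous_bounded_on assms by metis
  then show ?thesis
    using continuous_borel_measurable_lebesgue_on assms(2,3)
    by (intro finite_measure.integrable_const_bound[OF finite_measure_lebesgue_on_bounded[OF assms(1,2)], where B = B])
       (auto intro!: AE_I2)
qed

lemma continuous_integrable_indicator:
  fixes g :: "'a::euclidean_space \<Rightarrow> 'b::{banach, second_countable_topology}"
  assumes "bounded S" "open S" "continuous_on UNIV g"
  shows "integrable lborel (\<lambda>x. indicator S x *\<^sub>R g x)"
proof -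
  have [measurable]: "g \<in> borel_measurable borel" "S \<in> sets borel"
    using assms by (auto intro: borel_measurable_continuous_onI)
  have fin: "emeasure lborel S < \<infinity>" using assms(1) by (rule emeasure_bounded_finite)
  obtain B where B: "\<forall>x\<in>S. norm (g x) \<le> B" using continuous_bounded_on assms by metis
  show ?thesis
  proof (rule Bochner_Integration.integrable_bound)
    show "integrable lborel (\<lambda>x. indicator S x *\<^sub>R B)"
      using fin by (intro integrable_scaleR_left) (auto simp: integrable_indicator_iff)
    show "(\<lambda>x. indicator S x *\<^sub>R g x) \<in> borel_measurable lborel" by measurable
    have "norm (indicator S x *\<^sub>R g x) \<le> norm (indicator S x *\<^sub>R B)" for x
      using B by (cases "x \<in> S") auto
    then show "AE x in lborel. norm (indicator S x *\<^sub>R g x) \<le> norm (indicator S x *\<^sub>R B)" by simp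
  qed
qed

lemma segment_meets_frontier:
  fixes x q :: "'a::euclidean_space"
  assumes "(x \<in> \<Omega>) \<noteq> (x - s *\<^sub>R q \<in> \<Omega>)" "0 \<le> s"
  shows "\<exists>b\<in>frontier \<Omega>. \<exists>t\<in>{0..s}. x = b + t *\<^sub>R q"
proof -
  define S where "S = closed_segment (x - s *\<^sub>R q) x"
  have "x \<in> S" "x - s *\<^sub>R q \<in> S" by (simp_all add: S_def)
  then have "S \<inter> \<Omega> \<noteq> {}" "S - \<Omega> \<noteq> {}" using assms(1) by auto
  then have "S \<inter> frontier \<Omega> \<noteq> {}"
    by (intro connected_Int_frontier) (auto simp: S_def)
  then obtain b u where b: "b \<in> frontier \<Omega>" "b = (1 - u) *\<^sub>R (x - s *\<^sub>R q) + u *\<^sub>R x" "0 \<le> u" "u \<le> 1"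
    by (auto simp: S_def closed_segment_def)
  have "x = b + ((1 - u) * s) *\<^sub>R q" using b(2) by (simp add: algebra_simps)
  moreover have "(1 - u) * s \<in> {0..s}"
    using b(3,4) assms(2) by (auto intro!: mult_left_le_one_le)
  ultimately show ?thesis using b(1) by blast
qed

lemma integral_translate:
  fixes f :: "'a::euclidean_space \<Rightarrow> 'b::{banach, second_countable_topology}"
  assumes [measurable]: "f \<in> borel_measurable borel"
  shows "(LINT x|lborel. f (x + c)) = (LINT x|lborel. f x)"
proof -
  have "(LINT x|lborel. f x) = (LINT x|distr lborel borel ((+) c). f x)"
    by (simp add: lborel_distr_plus)
  also have "\<dots> = (LINT x|lborel. f (c + x))" by (rule integral_distr) auto
  finally show ?thesis by (simp add: add.commute)
qed

text \<open>
  Shifting the variable turns the left-hand side into the integral of \<open>f\<close> over the translate of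
  \<open>\<Omega>\<close> minus the integral over \<open>\<Omega>\<close>. Only points that lie in exactly one of the two sets contribute,
  and for these the segment of translation crosses the boundary.
\<close>

lemma translation_difference_bound:
  fixes \<Omega> :: "'a::euclidean_space set" and f :: "'a \<Rightarrow> complex"
  assumes \<Omega>: "bounded \<Omega>" "open \<Omega>" and f: "continuous_on UNIV f" and s: "0 \<le> s"
    and V: "V \<in> sets borel" "\<And>b t. b \<in> frontier \<Omega> \<Longrightarrow> t \<in> {0..s} \<Longrightarrow> b + t *\<^sub>R q \<in> V"
  shows "ennreal (norm (LINT x|lebesgue_on \<Omega>. f (x + s *\<^sub>R q) - f x))
           \<le> (\<integral>\<^sup>+x. ennreal (norm (f x)) * indicator V x \<partial>lborel)"
proof -
  define c where "c = s *\<^sub>R q"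
  define S where "S = (+) c ` \<Omega>"
  have S: "bounded S" "open S" unfolding S_def using \<Omega> by (auto intro: bounded_translation open_translation)
  have mS: "x \<in> S \<longleftrightarrow> x - c \<in> \<Omega>" for x by (force simp: S_def image_iff)
  have [measurable]: "f \<in> borel_measurable borel" "S \<in> sets borel" "\<Omega> \<in> sets borel"
    using f S \<Omega> by (auto intro: borel_measurable_continuous_onI)
  have fc: "continuous_on UNIV (\<lambda>x. f (x + c))"
    by (rule continuous_on_compose2[OF f]) (auto intro!: continuous_intros)
  have i1: "integrable lborel (\<lambda>x. indicator S x *\<^sub>R f x)" and i2: "integrable lborel (\<lambda>x. indicator \<Omega> x *\<^sub>R f x)"
    using S \<Omega> f by (auto intro: continuous_integrable_indicator)
  have "(LINT x|lebesgue_on \<Omega>. f (x + c) - f x) = (LINT x|lebesgue_on \<Omega>. f (x + c)) - (LINT x|lebesgue_on \<Omega>. f x)"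
    using \<Omega> f fc by (intro Bochner_Integration.integral_diff continuous_integrable_lebesgue_on)
  also have "(LINT x|lebesgue_on \<Omega>. f (x + c)) = (LINT x|lborel. indicator \<Omega> x *\<^sub>R f (x + c))"
    by (rule integral_lebesgue_on_open[OF \<Omega>(2) fc])
  also have "\<dots> = (LINT x|lborel. indicator S (x + c) *\<^sub>R f (x + c))"
    by (simp add: indicator_def mS)
  also have "\<dots> = (LINT x|lborel. indicator S x *\<^sub>R f x)"
    by (rule integral_translate) measurable
  also have "(LINT x|lebesgue_on \<Omega>. f x) = (LINT x|lborel. indicator \<Omega> x *\<^sub>R f x)"
    by (rule integral_lebesgue_on_open[OF \<Omega>(2) f])
  also have "(LINT x|lborel. indicator S x *\<^sub>R f x) - (LINT x|lborel. indicator \<Omega> x *\<^sub>R f x)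
      = (LINT x|lborel. indicator S x *\<^sub>R f x - indicator \<Omega> x *\<^sub>R f x)"
    using i1 i2 by (rule Bochner_Integration.integral_diff[symmetric])
  finally have "ennreal (norm (LINT x|lebesgue_on \<Omega>. f (x + c) - f x))
      = ennreal (norm (LINT x|lborel. indicator S x *\<^sub>R f x - indicator \<Omega> x *\<^sub>R f x))" by simp
  also have "\<dots> \<le> (\<integral>\<^sup>+x. ennreal (norm (indicator S x *\<^sub>R f x - indicator \<Omega> x *\<^sub>R f x)) \<partial>lborel)"
    using i1 i2 by (intro integral_norm_bound_ennreal Bochner_Integration.integrable_diff)
  also have "\<dots> \<le> (\<integral>\<^sup>+x. ennreal (norm (f x)) * indicator V x \<partial>lborel)"
  proof (rule nn_integral_mono)
    fix x
    show "ennreal (norm (indicator S x *\<^sub>R f x - indicator \<Omega> x *\<^sub>R f x)) \<le> ennreal (norm (f x)) * indicator V x"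
    proof (cases "x \<in> \<Omega> \<longleftrightarrow> x - s *\<^sub>R q \<in> \<Omega>")
      case True
      then show ?thesis by (simp add: indicator_def mS c_def)
    next
      case False
      then obtain b t where "b \<in> frontier \<Omega>" "t \<in> {0..s}" "x = b + t *\<^sub>R q"
        using segment_meets_frontier[OF _ s, of x \<Omega> q] by blast
      then have "x \<in> V" using V(2) by blast
      then show ?thesis using False by (auto simp: indicator_def mS c_def)
    qed
  qed
  finally show ?thesis by (simp add: c_def)
qed

lemma has_vector_derivative_along_axis:
  fixes f :: "real^'d \<Rightarrow> complex"
  assumes "f differentiable_on UNIV"
  shows "((\<lambda>t. f (x + t *\<^sub>R axis i 1)) has_vector_derivative pderivative i f (x + t *\<^sub>R axis i 1)) (at t)"
proof -
  have "(f has_derivative frechet_derivative f (at (x + t *\<^sub>R axis i 1))) (at (x + t *\<^sub>R axis i 1))"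
    using assms by (simp add: differentiable_on_def flip: frechet_derivative_works)
  then have "((\<lambda>t. f (x + t *\<^sub>R axis i 1)) has_derivative
      (\<lambda>h. frechet_derivative f (at (x + t *\<^sub>R axis i 1)) (h *\<^sub>R axis i 1))) (at t)"
    by (rule has_derivative_compose[rotated]) (auto intro!: derivative_eq_intros)
  moreover have "linear (frechet_derivative f (at (x + t *\<^sub>R axis i 1)))"
    using assms by (intro linear_frechet_derivative) (simp add: differentiable_on_def)
  ultimately show ?thesis
    by (simp add: has_vector_derivative_def pderivative_def linear_scale)
qed

text \<open>
  A substitute for the divergence theorem on open sets whose boundary has finite surface measure:
  apply the tube estimate to the difference quotients of step \<open>s\<close>, whose integrals
  are at most \<open>K \<integral>\<^sub>\<partial>\<^sub>\<Omega> |f| + \<omega>\<close>, and let \<open>s\<close> tend to \<open>0\<close> by dominated convergence.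
\<close>

lemma norm_integral_pderivative_le:
  fixes \<Omega> :: "(real^'d) set" and f :: "real^'d \<Rightarrow> complex"
  assumes ms: "measure_space UNIV (sets borel) (hausdorff_outer (CARD('d) - 1) :: (real^'d) set \<Rightarrow> ennreal)"
    and \<Omega>: "bounded \<Omega>" "open \<Omega>" "emeasure (hausdorff_measure (CARD('d) - 1)) (frontier \<Omega>) < \<infinity>"
    and f: "f differentiable_on UNIV" "continuous_on UNIV (pderivative i f)"
  shows "norm (LINT x|lebesgue_on \<Omega>. pderivative i f x)
           \<le> tube_const TYPE('d) * (LINT x|surface_measure (frontier \<Omega>). norm (f x))"
proof (rule field_le_epsilon)
  fix \<omega> :: real assume \<omega>: "0 < \<omega>"
  define I where "I = tube_const TYPE('d) * (LINT x|surface_measure (frontier \<Omega>). norm (f x))"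
  define q where "q = (axis i 1 :: real^'d)"
  have q: "norm q = 1" by (simp add: q_def norm_axis_1)
  have fc: "continuous_on UNIV f" using f(1) by (rule differentiable_imp_continuous_on)
  have I0: "0 \<le> I" unfolding I_def by (intro mult_nonneg_nonneg tube_const_nonneg) simp
  have cp: "compact (frontier \<Omega>)" using \<Omega>(1) by (rule compact_frontier_bounded)
  obtain \<delta> where \<delta>: "0 < \<delta>" and tube_all: "\<forall>s\<in>{0<..<\<delta>}. \<exists>V\<in>sets borel. (\<forall>b\<in>frontier \<Omega>. \<forall>t\<in>{0..s}. b + t *\<^sub>R q \<in> V) \<and>
           (\<integral>\<^sup>+x. ennreal (norm (f x)) * indicator V x \<partial>lborel) \<le> ennreal (s * (I + \<omega>))"
    using tube_integral_bound[OF ms cp \<Omega>(3) fc q \<omega>, folded I_def] by (elim exE conjE)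
  note tube = bspec[OF tube_all]
  have quot: "norm (LINT x|lebesgue_on \<Omega>. f (x + s *\<^sub>R q) - f x) \<le> s * (I + \<omega>)" if s: "s \<in> {0<..<\<delta>}" for s
  proof -
    obtain V where V: "V \<in> sets borel" "\<forall>b\<in>frontier \<Omega>. \<forall>t\<in>{0..s}. b + t *\<^sub>R q \<in> V"
      "(\<integral>\<^sup>+x. ennreal (norm (f x)) * indicator V x \<partial>lborel) \<le> ennreal (s * (I + \<omega>))"
      using tube[OF s] by blast
    have "ennreal (norm (LINT x|lebesgue_on \<Omega>. f (x + s *\<^sub>R q) - f x)) \<le> ennreal (s * (I + \<omega>))"
      using translation_difference_bound[OF \<Omega>(1,2) fc _ V(1), of s q] V(2,3) s by (auto intro: order_trans)
    then show ?thesis using s I0 \<omega> by (subst (asm) ennreal_le_iff) auto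
  qed
  define s where "s = (\<lambda>n::nat. inverse (real (Suc n)))"
  have s0: "0 < s n" "s n \<le> 1" for n by (auto simp: s_def field_simps)
  have slim: "s \<longlonglongrightarrow> 0" unfolding s_def by (rule LIMSEQ_inverse_real_of_nat)
  define D where "D = (\<lambda>n x. (f (x + s n *\<^sub>R q) - f x) /\<^sub>R s n)"
  have vd: "((\<lambda>t. f (x + t *\<^sub>R q)) has_vector_derivative pderivative i f (x + t *\<^sub>R q)) (at t)" for x t
    unfolding q_def using f(1) by (rule has_vector_derivative_along_axis)
  obtain R where R: "\<And>x. x \<in> \<Omega> \<Longrightarrow> norm x \<le> R" using \<Omega>(1) bounded_iff by metis
  obtain B where B: "\<forall>x\<in>cball 0 (R + 1). norm (pderivative i f x) \<le> B"
    using continuous_bounded_on[OF bounded_cball f(2)] by blast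
  have Dbound: "norm (D n x) \<le> B" if x: "x \<in> \<Omega>" for n x
  proof -
    have "\<exists>t\<in>{0<..<s n}. norm (f (x + s n *\<^sub>R q) - f (x + 0 *\<^sub>R q)) \<le> norm ((s n - 0) *\<^sub>R pderivative i f (x + t *\<^sub>R q))"
      using vd by (intro mvt_general[OF s0(1)])
        (auto simp: has_vector_derivative_def intro!: continuous_on_compose2[OF fc] continuous_intros)
    then obtain t where t: "0 < t" "t < s n" "norm (f (x + s n *\<^sub>R q) - f x) \<le> s n * norm (pderivative i f (x + t *\<^sub>R q))"
      using s0[of n] by auto
    have "norm (x + t *\<^sub>R q) \<le> R + 1"
      using norm_triangle_ineq[of x "t *\<^sub>R q"] R[OF x] q t s0(2)[of n] by simp
    then have "norm (pderivative i f (x + t *\<^sub>R q)) \<le> B" using B by simp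
    then have "norm (f (x + s n *\<^sub>R q) - f x) \<le> s n * B"
      using t(3) s0[of n] by (meson less_imp_le mult_left_mono order_trans)
    then have "norm (f (x + s n *\<^sub>R q) - f x) / s n \<le> B"
      using s0(1)[of n] by (simp add: pos_divide_le_eq mult.commute)
    then show ?thesis unfolding D_def norm_scaleR using s0(1)[of n] by (simp add: divide_inverse mult.commute)
  qed
  have "(\<lambda>n. LINT x|lebesgue_on \<Omega>. D n x) \<longlonglongrightarrow> (LINT x|lebesgue_on \<Omega>. pderivative i f x)"
  proof (rule integral_dominated_convergence)
    show "pderivative i f \<in> borel_measurable (lebesgue_on \<Omega>)"
      using \<Omega>(2) f(2) by (rule continuous_borel_measurable_lebesgue_on)
    show "D n \<in> borel_measurable (lebesgue_on \<Omega>)" for n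
      unfolding D_def using \<Omega>(2)
      by (rule continuous_borel_measurable_lebesgue_on) (auto intro!: continuous_intros continuous_on_compose2[OF fc])
    show "integrable (lebesgue_on \<Omega>) (\<lambda>_. B)"
      using \<Omega> by (intro continuous_integrable_lebesgue_on) auto
    show "AE x in lebesgue_on \<Omega>. norm (D n x) \<le> B" for n
      using Dbound by (intro AE_I2) auto
    show "AE x in lebesgue_on \<Omega>. (\<lambda>n. D n x) \<longlonglongrightarrow> pderivative i f x"
    proof (intro AE_I2)
      fix x
      let ?g = "\<lambda>t. f (x + t *\<^sub>R q)" and ?d = "pderivative i f x"
      have "((\<lambda>h. norm (?g (0 + h) - ?g 0 - h *\<^sub>R ?d) / norm h) \<longlongrightarrow> 0) (at 0)"
        using vd[of x 0] unfolding has_vector_derivative_def has_derivative_at by simp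
      moreover have "filterlim s (at 0) sequentially"
        using slim s0(1) by (auto simp: filterlim_at less_imp_neq[symmetric])
      ultimately have "(\<lambda>n. norm (?g (0 + s n) - ?g 0 - s n *\<^sub>R ?d) / norm (s n)) \<longlonglongrightarrow> 0"
        by (rule filterlim_compose)
      also have "(\<lambda>n. norm (?g (0 + s n) - ?g 0 - s n *\<^sub>R ?d) / norm (s n)) = (\<lambda>n. norm (D n x - ?d))"
      proof
        fix n
        have "D n x - ?d = (?g (0 + s n) - ?g 0 - s n *\<^sub>R ?d) /\<^sub>R s n"
          using s0(1)[of n] by (simp add: D_def scaleR_diff_right)
        then show "norm (?g (0 + s n) - ?g 0 - s n *\<^sub>R ?d) / norm (s n) = norm (D n x - ?d)"
          by (simp add: divide_inverse mult.commute)
      qed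
      finally show "(\<lambda>n. D n x) \<longlonglongrightarrow> ?d"
        by (simp add: tendsto_norm_zero_iff LIM_zero_iff)
    qed
  qed
  then have "(\<lambda>n. norm (LINT x|lebesgue_on \<Omega>. D n x)) \<longlonglongrightarrow> norm (LINT x|lebesgue_on \<Omega>. pderivative i f x)"
    by (rule tendsto_norm)
  moreover have "eventually (\<lambda>n. norm (LINT x|lebesgue_on \<Omega>. D n x) \<le> I + \<omega>) sequentially"
  proof -
    have "eventually (\<lambda>n. s n < \<delta>) sequentially" using slim \<delta> by (rule order_tendstoD(2))
    then show ?thesis
    proof eventually_elim
      case (elim n)
      have "norm (LINT x|lebesgue_on \<Omega>. D n x) = norm (LINT x|lebesgue_on \<Omega>. f (x + s n *\<^sub>R q) - f x) / s n"
        using s0(1)[of n] unfolding D_def by (simp add: divide_inverse mult.commute)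
      also have "\<dots> \<le> I + \<omega>" using quot[of "s n"] elim s0(1)[of n] by (simp add: pos_divide_le_eq mult.commute)
      finally show ?case .
    qed
  qed
  ultimately have "norm (LINT x|lebesgue_on \<Omega>. pderivative i f x) \<le> I + \<omega>"
    by (rule tendsto_upperbound) simp
  then show "norm (LINT x|lebesgue_on \<Omega>. pderivative i f x)
           \<le> tube_const TYPE('d) * (LINT x|surface_measure (frontier \<Omega>). norm (f x)) + \<omega>"
    by (simp add: I_def)
qed

section \<open>Smooth functions\<close>

lemma pderivative_eqI: "(f has_derivative f') (at x) \<Longrightarrow> pderivative i f x = f' (axis i 1)"
  unfolding pderivative_def by (simp flip: frechet_derivative_at)

lemma has_derivative_pderivative:
  assumes "f differentiable_on UNIV"
  shows "(f has_derivative frechet_derivative f (at x)) (at x)"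
  using assms by (simp add: differentiable_on_def flip: frechet_derivative_works)

lemma pderivative_lincomb:
  assumes "f differentiable_on UNIV" "g differentiable_on UNIV"
  shows "pderivative i (\<lambda>x. a * f x + b * g x) = (\<lambda>x. a * pderivative i f x + b * pderivative i g x)"
proof
  fix x
  show "pderivative i (\<lambda>x. a * f x + b * g x) x = a * pderivative i f x + b * pderivative i g x"
    unfolding pderivative_def[of i f] pderivative_def[of i g]
    by (rule pderivative_eqI) (intro derivative_intros has_derivative_pderivative assms)
qed

lemma pderivative_mult:
  assumes "f differentiable_on UNIV" "g differentiable_on UNIV"
  shows "pderivative i (\<lambda>x. f x * g x) = (\<lambda>x. f x * pderivative i g x + pderivative i f x * g x)"
proof
  fix x
  show "pderivative i (\<lambda>x. f x * g x) x = f x * pderivative i g x + pderivative i f x * g x"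
    unfolding pderivative_def[of i f] pderivative_def[of i g]
    by (rule pderivative_eqI) (intro derivative_intros has_derivative_pderivative assms)
qed

lemma pderivative_const [simp]: "pderivative i (\<lambda>x. c) = (\<lambda>x. 0)"
  by (rule ext, rule pderivative_eqI[THEN trans]) (rule has_derivative_const, simp)

lemma Ck_Suc_imp_Ck: "Ck (Suc m) f \<Longrightarrow> Ck m f"
  by (induction m arbitrary: f) (auto simp: differentiable_imp_continuous_on)

lemma Ck_const: "Ck m (\<lambda>x. c)"
  by (induction m arbitrary: c) (auto simp: differentiable_on_def)

lemma Ck_lincomb: "Ck m f \<Longrightarrow> Ck m g \<Longrightarrow> Ck m (\<lambda>x. a * f x + b * g x)"
proof (induction m arbitrary: f g)
  case 0
  then show ?case by (auto intro!: continuous_intros)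
next
  case (Suc m)
  have "(\<lambda>x. a * f x + b * g x) differentiable_on UNIV"
    using Suc.prems by (auto intro!: differentiable_on_add differentiable_on_mult differentiable_on_const)
  then show ?case using Suc by (simp add: pderivative_lincomb)
qed

lemma Ck_mult: "Ck m f \<Longrightarrow> Ck m g \<Longrightarrow> Ck m (\<lambda>x. f x * g x)"
proof (induction m arbitrary: f g)
  case 0
  then show ?case by (auto intro!: continuous_intros)
next
  case (Suc m)
  have d: "f differentiable_on UNIV" "g differentiable_on UNIV" using Suc.prems by auto
  then have "(\<lambda>x. f x * g x) differentiable_on UNIV"
    by (rule differentiable_on_mult)
  moreover have "Ck m (\<lambda>x. f x * pderivative i g x + pderivative i f x * g x)" for i
  proof -
    have "Ck m f" "Ck m g" using Suc.prems Ck_Suc_imp_Ck by blast+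
    moreover have "Ck m (pderivative i f)" "Ck m (pderivative i g)" using Suc.prems by auto
    ultimately have "Ck m (\<lambda>x. f x * pderivative i g x)" "Ck m (\<lambda>x. pderivative i f x * g x)"
      using Suc.IH by blast+
    from Ck_lincomb[OF this, of 1 1] show ?thesis by simp
  qed
  ultimately show ?case using d by (simp add: pderivative_mult)
qed

lemma smooth_const: "smooth (\<lambda>x. c)"
  by (simp add: smooth_def Ck_const)

lemma smooth_lincomb: "smooth f \<Longrightarrow> smooth g \<Longrightarrow> smooth (\<lambda>x. a * f x + b * g x)"
  by (simp add: smooth_def Ck_lincomb)

lemma smooth_mult: "smooth f \<Longrightarrow> smooth g \<Longrightarrow> smooth (\<lambda>x. f x * g x)"
  by (simp add: smooth_def Ck_mult)

lemma smooth_prod: "(\<And>i. i \<in> I \<Longrightarrow> smooth (f i)) \<Longrightarrow> smooth (\<lambda>x. \<Prod>i\<in>I. f i x)"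
  by (induction I rule: infinite_finite_induct) (auto intro: smooth_const smooth_mult)

lemma smooth_sum: "(\<And>i. i \<in> I \<Longrightarrow> smooth (f i)) \<Longrightarrow> smooth (\<lambda>x. \<Sum>i\<in>I. f i x)"
  using smooth_lincomb[where a = 1 and b = 1]
  by (induction I rule: infinite_finite_induct) (auto intro: smooth_const)

lemma smooth_differentiable: "smooth f \<Longrightarrow> f differentiable_on UNIV"
  unfolding smooth_def by (metis Ck.simps(2))

lemma smooth_pderivative: "smooth f \<Longrightarrow> smooth (pderivative i f)"
  unfolding smooth_def by (metis Ck.simps(2))

lemma smooth_continuous: "smooth f \<Longrightarrow> continuous_on UNIV f"
  by (rule differentiable_imp_continuous_on) (rule smooth_differentiable)

section \<open>Bump functions\<close>

text \<open>
  The family of functions \<open>t\<^sup>-\<^sup>k e\<^sup>-\<^sup>1\<^sup>/\<^sup>t\<close>, extended by \<open>0\<close>, whose span is closed under differentiation;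
  so the smoothness of the member \<open>k = 0\<close> follows by an induction over all members at once.
\<close>

definition flat :: "nat \<Rightarrow> real \<Rightarrow> real" where
  "flat k t = (if t \<le> 0 then 0 else (1 / t) ^ k * exp (- (1 / t)))"

lemma flat_div: "flat k t / t = flat (Suc k) t"
  by (simp add: flat_def)

lemma tendsto_flat_0: "(flat k \<longlongrightarrow> 0) (at 0)"
proof (rule filterlim_split_at)
  have "((\<lambda>t. 0) \<longlongrightarrow> (0::real)) (at_left 0)" by simp
  then show "(flat k \<longlongrightarrow> 0) (at_left 0)"
    by (rule Lim_transform_eventually) (auto simp: flat_def eventually_at_filter)
  have "((\<lambda>u::real. u ^ k / exp u) \<longlongrightarrow> 0) at_top" by (rule tendsto_power_div_exp_0)
  then have "((\<lambda>t::real. inverse t ^ k / exp (inverse t)) \<longlongrightarrow> 0) (at_right 0)"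
    by (rule filterlim_compose) (rule filterlim_inverse_at_top_right)
  then show "(flat k \<longlongrightarrow> 0) (at_right 0)"
    by (rule Lim_transform_eventually)
       (auto simp: flat_def eventually_at_filter exp_minus divide_inverse)
qed

lemma flat_has_derivative:
  "(flat k has_real_derivative flat (k + 2) t - real k * flat (k + 1) t) (at t)"
proof -
  consider "t < 0" | "t = 0" | "0 < t" by linarith
  then show ?thesis
  proof cases
    case 1
    have "eventually (\<lambda>s. s \<in> {..<0}) (nhds t)"
      by (rule eventually_nhds_in_open) (use 1 in auto)
    then have "eventually (\<lambda>s. 0 = flat k s) (nhds t)"
      by eventually_elim (simp add: flat_def)
    from DERIV_cong_ev[OF refl this refl, THEN iffD1, OF DERIV_const]
    have "(flat k has_real_derivative 0) (at t)" .
    then show ?thesis using 1 by (simp add: flat_def)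
  next
    case 2
    have f0: "flat k 0 = 0" by (simp add: flat_def)
    have "((\<lambda>h. (flat k (0 + h) - flat k 0) / h) \<longlongrightarrow> 0) (at 0)"
      using tendsto_flat_0[of "Suc k"] by (simp add: flat_div f0)
    then show ?thesis using 2 by (simp add: DERIV_def flat_def)
  next
    case 3
    have "((\<lambda>t. (1 / t) ^ k * exp (- (1 / t))) has_real_derivative
        flat (k + 2) t - real k * flat (k + 1) t) (at t)"
    proof -
      have d: "((\<lambda>t. 1 / t) has_real_derivative - ((1 / t)\<^sup>2)) (at t)"
        using 3 by (auto intro!: derivative_eq_intros simp: power2_eq_square)
      show ?thesis
        by (rule DERIV_cong[OF DERIV_mult[OF DERIV_power[OF d, of k] DERIV_fun_exp[OF DERIV_minus[OF d]]]])
           (use 3 in \<open>cases k; simp add: flat_def power2_eq_square algebra_simps\<close>)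
    qed
    moreover have "eventually (\<lambda>s. s \<in> {0<..}) (nhds t)"
      by (rule eventually_nhds_in_open) (use 3 in auto)
    then have ev: "eventually (\<lambda>s. (1 / s) ^ k * exp (- (1 / s)) = flat k s) (nhds t)"
      by eventually_elim (simp add: flat_def)
    ultimately show ?thesis by (simp add: DERIV_cong_ev[OF refl ev refl])
  qed
qed

lemma Ck_flat: "Ck m (\<lambda>x. complex_of_real (flat k (a * x $ i + b)))"
proof (induction m arbitrary: k)
  case 0
  have "continuous_on UNIV (flat k)"
    by (rule DERIV_continuous_on) (rule has_field_derivative_at_within, rule flat_has_derivative)
  then show ?case
    by (auto intro!: continuous_intros continuous_on_compose2[of UNIV "flat k"])
next
  case (Suc m)
  define F where "F = (\<lambda>k x. complex_of_real (flat k (a * x $ i + b)))"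
  have der: "(F k has_derivative (\<lambda>h. complex_of_real ((a * h $ i) * (flat (k + 2) (a * x $ i + b) - real k * flat (k + 1) (a * x $ i + b))))) (at x)" for x
    unfolding F_def
    by (intro has_derivative_of_real has_derivative_compose[OF _ flat_has_derivative[unfolded has_field_derivative_def], THEN has_derivative_eq_rhs])
       (auto intro!: derivative_eq_intros bounded_linear_imp_has_derivative[OF bounded_linear_vec_nth] simp: mult.commute)
  have pd: "pderivative j (F k) = (\<lambda>x. complex_of_real (a * axis j 1 $ i) * F (k + 2) x
      + complex_of_real (- (a * axis j 1 $ i * real k)) * F (k + 1) x)" for j
    by (rule ext, rule pderivative_eqI[THEN trans], rule der) (simp add: F_def algebra_simps)
  have "F k differentiable_on UNIV"
    unfolding differentiable_on_def differentiable_def using der by auto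
  moreover have "Ck m (pderivative j (F k))" for j
    unfolding pd by (rule Ck_lincomb) (use Suc in \<open>auto simp: F_def\<close>)
  ultimately show ?case by (simp add: F_def)
qed

text \<open>
  The \<open>i\<close>-th factors vanish unless \<open>x\<^sub>i\<close> has distance at least \<open>1/n\<close> from both ends of its interval,
  so the support is a compact subset of the open box.
\<close>

definition box_bump :: "nat \<Rightarrow> real^'d \<Rightarrow> real^'d \<Rightarrow> real^'d \<Rightarrow> complex" where
  "box_bump n a b x = (\<Prod>i\<in>UNIV. complex_of_real (flat 0 (real n * x $ i + (- (real n * a $ i) - 1)))
      * complex_of_real (flat 0 (- real n * x $ i + (real n * b $ i - 1))))"

lemma smooth_box_bump:
  fixes a b :: "real^'d"
  shows "smooth (box_bump n a b)"
proof -
  have "smooth (\<lambda>x. complex_of_real (flat k (c * x $ i + d)))" for k c d and i :: 'd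
    by (simp add: smooth_def Ck_flat)
  then show ?thesis unfolding box_bump_def by (intro smooth_prod smooth_mult)
qed

lemma box_bump_nonzero:
  assumes "box_bump n a b x \<noteq> 0"
  shows "real n * (x $ i - a $ i) \<ge> 1" "real n * (b $ i - x $ i) \<ge> 1"
  using assms by (auto simp: box_bump_def flat_def algebra_simps dest!: spec[of _ i] split: if_splits)

lemma flat_0_bounds: "0 \<le> flat 0 t" "flat 0 t \<le> 1"
  by (auto simp: flat_def)

lemma norm_box_bump: "norm (box_bump n a b x) \<le> 1"
proof -
  have "norm (box_bump n a b x) = (\<Prod>i\<in>UNIV. flat 0 (real n * x $ i + (- (real n * a $ i) - 1))
      * flat 0 (- real n * x $ i + (real n * b $ i - 1)))"
    unfolding box_bump_def by (simp add: flat_0_bounds norm_mult flip: prod_norm)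
  also have "\<dots> \<le> 1"
    by (intro prod_le_1 conjI mult_nonneg_nonneg mult_le_one flat_0_bounds)
  finally show ?thesis .
qed

lemma box_bump_in_test_functions:
  fixes a b :: "real^'d"
  assumes "box a b \<subseteq> \<Omega>" "1 \<le> n"
  shows "box_bump n a b \<in> test_functions \<Omega>"
proof -
  let ?e = "\<chi> i. 1 / real n"
  have sub: "{x. box_bump n a b x \<noteq> 0} \<subseteq> cbox (a + ?e) (b - ?e)"
  proof
    fix x assume "x \<in> {x. box_bump n a b x \<noteq> 0}"
    then have "real n * (x $ i - a $ i) \<ge> 1" "real n * (b $ i - x $ i) \<ge> 1" for i
      using box_bump_nonzero[of n a b x i] by auto
    then have "1 / real n \<le> x $ i - a $ i" "1 / real n \<le> b $ i - x $ i" for i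
      using assms(2) by (simp_all add: divide_le_eq mult.commute)
    then show "x \<in> cbox (a + ?e) (b - ?e)"
      by (auto simp: mem_box_cart algebra_simps)
  qed
  have cl: "closure {x. box_bump n a b x \<noteq> 0} \<subseteq> cbox (a + ?e) (b - ?e)"
    by (rule closure_minimal[OF sub closed_cbox])
  have "bounded {x. box_bump n a b x \<noteq> 0}" using sub by (meson bounded_cbox bounded_subset)
  then have "compact (closure {x. box_bump n a b x \<noteq> 0})" by (simp add: compact_closure)
  moreover have "cbox (a + ?e) (b - ?e) \<subseteq> box a b"
  proof
    fix x assume x: "x \<in> cbox (a + ?e) (b - ?e)"
    have "a $ i < x $ i \<and> x $ i < b $ i" for i
    proof -
      have "a $ i + 1 / real n \<le> x $ i" "x $ i \<le> b $ i - 1 / real n"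
        using x by (auto simp: mem_box_cart)
      moreover have "0 < 1 / real n" using assms(2) by simp
      ultimately show ?thesis by linarith
    qed
    then show "x \<in> box a b" by (simp add: mem_box_cart)
  qed
  ultimately show ?thesis
    using smooth_box_bump cl assms(1) unfolding test_functions_def by blast
qed

lemma box_bump_tendsto:
  fixes a b x :: "real^'d"
  shows "(\<lambda>n. box_bump n a b x) \<longlonglongrightarrow> indicator (box a b) x"
proof (cases "x \<in> box a b")
  case True
  have flat1: "(\<lambda>n. flat 0 (real n * c + (- 1))) \<longlonglongrightarrow> 1" if "0 < c" for c
  proof -
    have t: "filterlim (\<lambda>n. real n * c + (- 1)) at_top sequentially"
      using that by real_asymp
    have "((\<lambda>t::real. exp (- (1 / t))) \<longlongrightarrow> 1) at_top" by real_asymp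
    moreover have "eventually (\<lambda>t. exp (- (1 / t)) = flat 0 t) at_top"
      using eventually_gt_at_top[of 0] by eventually_elim (simp add: flat_def)
    ultimately have "(flat 0 \<longlongrightarrow> 1) at_top" by (rule Lim_transform_eventually)
    from filterlim_compose[OF this t] show ?thesis .
  qed
  have "(\<lambda>n. box_bump n a b x) \<longlonglongrightarrow> (\<Prod>i\<in>(UNIV::'d set). complex_of_real 1 * complex_of_real 1)"
    unfolding box_bump_def
  proof (intro tendsto_prod tendsto_mult tendsto_of_real)
    fix i
    have "0 < x $ i - a $ i" "0 < b $ i - x $ i" using True by (auto simp: mem_box_cart)
    from flat1[OF this(1)] flat1[OF this(2)]
    show "(\<lambda>n. flat 0 (real n * x $ i + (- (real n * a $ i) - 1))) \<longlonglongrightarrow> 1"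
      "(\<lambda>n. flat 0 (- real n * x $ i + (real n * b $ i - 1))) \<longlonglongrightarrow> 1"
      by (simp_all add: algebra_simps)
  qed
  then show ?thesis using True by simp
next
  case False
  then obtain i where i: "x $ i \<le> a $ i \<or> b $ i \<le> x $ i" by (auto simp: mem_box_cart not_less)
  have "box_bump n a b x = 0" for n
  proof (rule ccontr)
    assume "box_bump n a b x \<noteq> 0"
    then have *: "1 \<le> real n * (x $ i - a $ i)" "1 \<le> real n * (b $ i - x $ i)"
      using box_bump_nonzero[of n a b x i] by auto
    have "0 < x $ i - a $ i" using *(1) by (smt (verit) mult_nonneg_nonpos of_nat_0_le_iff)
    moreover have "0 < b $ i - x $ i" using *(2) by (smt (verit) mult_nonneg_nonpos of_nat_0_le_iff)
    ultimately show False using i by linarith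
  qed
  then show ?thesis using False by simp
qed

section \<open>The fundamental lemma of the calculus of variations\<close>

text \<open>
  Boxes are closed under intersections and generate the Borel sets, so the integrals over all Borel
  sets vanish by Dynkin's theorem; Lebesgue sets differ from Borel sets by null sets.
\<close>

lemma AE_zero_if_box_integrals_zero:
  fixes g :: "'a::euclidean_space \<Rightarrow> complex"
  assumes int: "integrable lebesgue g"
    and box: "\<And>a b. (LINT x|lebesgue. indicator (box a b) x *\<^sub>R g x) = 0" and UN: "(LINT x|lebesgue. g x) = 0"
  shows "AE x in lebesgue. g x = 0"
proof (rule sigma_finite_measure.density_zero[OF _ int])
  show "sigma_finite_measure (lebesgue :: 'a measure)"
    unfolding sigma_finite_measure_def
    by (intro exI[of _ "range (\<lambda>n. cball 0 (real n))"])
       (auto simp: emeasure_lborel_cball_finite[THEN less_imp_neq, simplified] intro: real_arch_simple)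
next
  have ig: "integrable lebesgue (\<lambda>x. indicator A x *\<^sub>R g x)" if "A \<in> sets lebesgue" for A
    using that int by (intro integrable_mult_indicator)
  have borel: "(LINT x|lebesgue. indicator A x *\<^sub>R g x) = 0" if A: "A \<in> sets borel" for A
  proof -
    have gen: "sets borel = sigma_sets UNIV (range (\<lambda>(a, b). box a b :: 'a set))"
      by (subst borel_eq_box) (simp add: sets_measure_of)
    show ?thesis
    proof (rule sigma_sets_induct_disjoint[of "range (\<lambda>(a, b). box a b :: 'a set)" UNIV A])
      show "Int_stable (range (\<lambda>(a, b). box a b :: 'a set))"
        by (auto simp: Int_stable_def box_Int_box)
      show "A \<in> sigma_sets UNIV (range (\<lambda>(a, b). box a b))" using A gen by simp
    next
      fix B assume "B \<in> range (\<lambda>(a, b). box a b :: 'a set)"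
      then show "(LINT x|lebesgue. indicator B x *\<^sub>R g x) = 0" using box by auto
    next
      fix B :: "'a set" assume B: "B \<in> sigma_sets UNIV (range (\<lambda>(a, b). box a b))" "(LINT x|lebesgue. indicator B x *\<^sub>R g x) = 0"
      then have "B \<in> sets lebesgue" using gen by auto
      have "(LINT x|lebesgue. indicator (UNIV - B) x *\<^sub>R g x) = (LINT x|lebesgue. g x - indicator B x *\<^sub>R g x)"
        by (rule Bochner_Integration.integral_cong) (auto simp: indicator_def)
      also have "\<dots> = 0"
        using B UN \<open>B \<in> sets lebesgue\<close> by (subst Bochner_Integration.integral_diff) (auto intro: int ig)
      finally show "(LINT x|lebesgue. indicator (UNIV - B) x *\<^sub>R g x) = 0" .
    next
      fix C :: "nat \<Rightarrow> 'a set"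
      assume C: "disjoint_family C" "range C \<subseteq> sigma_sets UNIV (range (\<lambda>(a, b). box a b))"
        "\<And>i. (LINT x|lebesgue. indicator (C i) x *\<^sub>R g x) = 0"
      have Cl: "C i \<in> sets lebesgue" for i
      proof -
        have "C i \<in> sets borel" using C(2) unfolding gen by blast
        then show ?thesis by simp
      qed
      have "(LINT x:(\<Union>i. C i)|lebesgue. g x) = (\<Sum>i. (LINT x:(C i)|lebesgue. g x))"
        by (rule lebesgue_integral_countable_add)
           (use Cl C(1) ig in \<open>auto simp: disjoint_family_on_def set_integrable_def\<close>)
      then show "(LINT x|lebesgue. indicator (\<Union>i. C i) x *\<^sub>R g x) = 0"
        using C(3) by (simp add: set_lebesgue_integral_def)
    qed (auto)
  qed
  fix A :: "'a set" assume "A \<in> sets lebesgue"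
  then obtain S N N' where A: "A = S \<union> N" "N \<subseteq> N'" "N' \<in> null_sets lborel" "S \<in> sets lborel"
    by (rule sets_completionE)
  have "N' \<in> null_sets lebesgue" using A(3) by (simp add: null_sets_completionI)
  then have "AE x in lebesgue. x \<notin> N'" by (rule AE_not_in)
  then have "(LINT x|lebesgue. indicator A x *\<^sub>R g x) = (LINT x|lebesgue. indicator S x *\<^sub>R g x)"
    using \<open>A \<in> sets lebesgue\<close> A(4) ig[of A] ig[of S]
    by (intro integral_cong_AE) (auto simp: A(1) indicator_def dest: borel_measurable_integrable elim!: eventually_mono intro: subsetD[OF A(2)])
  then show "(LINT x:A|lebesgue. g x) = 0"
    using borel[of S] A(4) by (simp add: set_lebesgue_integral_def)
qed

text \<open>
  On a box contained in \<open>\<Omega>\<close> the bump functions converge to the indicator function, so the integral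
  over the box vanishes. Boxes inside a fixed box \<open>B \<subseteq> \<Omega>\<close> are exactly the intersections of \<open>B\<close> with
  arbitrary boxes; hence the function vanishes almost everywhere on \<open>B\<close>, and countably many such
  boxes exhaust \<open>\<Omega>\<close>.
\<close>

lemma AE_zero_if_orthogonal_to_test_functions:
  fixes g :: "real^'d \<Rightarrow> complex"
  assumes \<Omega>: "open \<Omega>" and int: "integrable (lebesgue_on \<Omega>) g"
    and orth: "\<And>\<phi>. \<phi> \<in> test_functions \<Omega> \<Longrightarrow> (LINT x|lebesgue_on \<Omega>. g x * \<phi> x) = 0"
  shows "AE x in lebesgue_on \<Omega>. g x = 0"
proof -
  have \<Omega>l: "\<Omega> \<in> sets lebesgue" using \<Omega> by simp
  have int': "integrable lebesgue (\<lambda>x. indicator \<Omega> x *\<^sub>R g x)"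
    using int \<Omega>l by (simp add: integrable_restrict_space)
  have box0: "(LINT x|lebesgue_on \<Omega>. indicator (box a b) x *\<^sub>R g x) = 0" if "box a b \<subseteq> \<Omega>" for a b
  proof -
    have "(\<lambda>n. LINT x|lebesgue_on \<Omega>. g x * box_bump (Suc n) a b x) \<longlonglongrightarrow> (LINT x|lebesgue_on \<Omega>. g x * indicator (box a b) x)"
    proof (rule integral_dominated_convergence)
      show "integrable (lebesgue_on \<Omega>) (\<lambda>x. norm (g x))" using int by simp
      show "(\<lambda>x. g x * indicator (box a b) x) \<in> borel_measurable (lebesgue_on \<Omega>)"
        using borel_measurable_integrable[OF int] \<Omega>l that
        by (intro borel_measurable_times borel_measurable_indicator) (auto simp: sets_restrict_space_iff)
      show "(\<lambda>x. g x * box_bump (Suc n) a b x) \<in> borel_measurable (lebesgue_on \<Omega>)" for n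
        by (rule borel_measurable_times[OF borel_measurable_integrable[OF int]
              continuous_borel_measurable_lebesgue_on[OF \<Omega> smooth_continuous[OF smooth_box_bump]]])
      show "AE x in lebesgue_on \<Omega>. norm (g x * box_bump (Suc n) a b x) \<le> norm (g x)" for n
        by (intro AE_I2) (simp add: norm_mult norm_box_bump mult_left_le)
      show "AE x in lebesgue_on \<Omega>. (\<lambda>n. g x * box_bump (Suc n) a b x) \<longlonglongrightarrow> g x * indicator (box a b) x"
        by (intro AE_I2 tendsto_mult tendsto_const LIMSEQ_Suc box_bump_tendsto)
    qed
    moreover have "(LINT x|lebesgue_on \<Omega>. g x * box_bump (Suc n) a b x) = 0" for n
      using orth box_bump_in_test_functions[OF that] by simp
    ultimately have "(LINT x|lebesgue_on \<Omega>. g x * indicator (box a b) x) = 0"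
      by (simp add: LIMSEQ_const_iff)
    moreover have "(\<lambda>x. g x * indicator (box a b) x) = (\<lambda>x. indicator (box a b) x *\<^sub>R g x)"
      by (auto simp: indicator_def fun_eq_iff)
    ultimately show ?thesis by simp
  qed
  have on_box: "AE x in lebesgue. x \<in> box a b \<longrightarrow> g x = 0" if ab: "box a b \<subseteq> \<Omega>" for a b
  proof -
    have eq: "(LINT x|lebesgue. indicator (box c d) x *\<^sub>R indicator (box a b) x *\<^sub>R g x) = 0" for c d
    proof -
      obtain c' d' where cd: "box c d \<inter> box a b = box c' d'" by (rule that[OF box_Int_box])
      have "(LINT x|lebesgue. indicator (box c d) x *\<^sub>R indicator (box a b) x *\<^sub>R g x)
          = (LINT x|lebesgue. indicator \<Omega> x *\<^sub>R indicator (box c' d') x *\<^sub>R g x)"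
        by (rule Bochner_Integration.integral_cong) (use ab in \<open>auto simp: indicator_def cd[symmetric]\<close>)
      also have "\<dots> = (LINT x|lebesgue_on \<Omega>. indicator (box c' d') x *\<^sub>R g x)"
        using \<Omega>l by (intro integral_restrict_space[symmetric]) simp
      also have "\<dots> = 0" using ab cd by (intro box0) auto
      finally show ?thesis .
    qed
    have "AE x in lebesgue. indicator (box a b) x *\<^sub>R g x = 0"
    proof (rule AE_zero_if_box_integrals_zero)
      have "integrable lebesgue (\<lambda>x. indicator (box a b) x *\<^sub>R indicator \<Omega> x *\<^sub>R g x)"
        by (rule integrable_mult_indicator[OF _ int']) simp
      also have "(\<lambda>x. indicator (box a b) x *\<^sub>R indicator \<Omega> x *\<^sub>R g x) = (\<lambda>x. indicator (box a b) x *\<^sub>R g x)"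
        using ab by (auto simp: indicator_def fun_eq_iff)
      finally show "integrable lebesgue (\<lambda>x. indicator (box a b) x *\<^sub>R g x)" .
      show "(LINT x|lebesgue. indicator (box a b) x *\<^sub>R g x) = 0"
      proof -
        have "(\<lambda>x. indicator (box a b) x *\<^sub>R indicator (box a b) x *\<^sub>R g x) = (\<lambda>x. indicator (box a b) x *\<^sub>R g x)"
          by (auto simp: indicator_def fun_eq_iff)
        then show ?thesis using eq[of a b] by simp
      qed
    qed (rule eq)
    then show ?thesis by (auto elim!: eventually_mono simp: indicator_def)
  qed
  obtain \<D> where D: "countable \<D>" "\<D> \<subseteq> Pow \<Omega>" "\<And>X. X \<in> \<D> \<Longrightarrow> \<exists>a b. X = box a b" "\<Union>\<D> = \<Omega>"
    using open_countable_Union_open_box[OF \<Omega>] by metis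
  have "AE x in lebesgue. \<forall>X\<in>\<D>. x \<in> X \<longrightarrow> g x = 0"
    unfolding AE_ball_countable[OF D(1)] using on_box D(2,3) by (metis PowD subsetD)
  then have "AE x in lebesgue. x \<in> \<Omega> \<longrightarrow> g x = 0"
    using D(4) by (auto elim!: eventually_mono)
  then show ?thesis using \<Omega>l by (simp add: AE_restrict_space_iff)
qed

section \<open>Square-integrable and Sobolev functions\<close>

lemma L2_norm_nonneg: "0 \<le> L2_norm M u"
  by (simp add: L2_norm_def)

lemma L2_norm_sq: "(L2_norm M u)\<^sup>2 = (LINT x|M. (norm (u x))\<^sup>2)"
  by (simp add: L2_norm_def)

text \<open>
  Norm estimates are kept in squared form throughout. Factors of two in place of the exact triangle
  inequality do no harm, because the estimates are used for convergence to zero and for boundedness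
  only.
\<close>

lemma L2_dominated:
  assumes "u \<in> L2_space M" "v \<in> L2_space M" "w \<in> borel_measurable M"
    and le: "\<And>x. x \<in> space M \<Longrightarrow> (norm (w x))\<^sup>2 \<le> \<alpha> * (norm (u x))\<^sup>2 + \<beta> * (norm (v x))\<^sup>2"
  shows "w \<in> L2_space M" "(L2_norm M w)\<^sup>2 \<le> \<alpha> * (L2_norm M u)\<^sup>2 + \<beta> * (L2_norm M v)\<^sup>2"
proof -
  have i: "integrable M (\<lambda>x. \<alpha> * (norm (u x))\<^sup>2 + \<beta> * (norm (v x))\<^sup>2)"
    using assms(1,2) by (auto simp: L2_space_def)
  have "norm ((norm (w x))\<^sup>2) \<le> norm (\<alpha> * (norm (u x))\<^sup>2 + \<beta> * (norm (v x))\<^sup>2)" if "x \<in> space M" for x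
    using le[OF that] by (simp add: abs_le_iff)
  then have iw: "integrable M (\<lambda>x. (norm (w x))\<^sup>2)"
    using assms(3) by (intro Bochner_Integration.integrable_bound[OF i] AE_I2) auto
  then show "w \<in> L2_space M" using assms(3) by (simp add: L2_space_def)
  have "(LINT x|M. (norm (w x))\<^sup>2) \<le> (LINT x|M. \<alpha> * (norm (u x))\<^sup>2 + \<beta> * (norm (v x))\<^sup>2)"
    by (rule integral_mono[OF iw i le])
  also have "\<dots> = \<alpha> * (L2_norm M u)\<^sup>2 + \<beta> * (L2_norm M v)\<^sup>2"
    using assms(1,2) by (simp add: L2_space_def L2_norm_sq)
  finally show "(L2_norm M w)\<^sup>2 \<le> \<alpha> * (L2_norm M u)\<^sup>2 + \<beta> * (L2_norm M v)\<^sup>2"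
    by (simp add: L2_norm_sq)
qed

lemma norm_lincomb_sq_le:
  fixes a b z w :: complex
  shows "(norm (a * z + b * w))\<^sup>2 \<le> 2 * (norm a)\<^sup>2 * (norm z)\<^sup>2 + 2 * (norm b)\<^sup>2 * (norm w)\<^sup>2"
proof -
  have "norm (a * z + b * w) \<le> norm a * norm z + norm b * norm w"
    using norm_triangle_ineq[of "a * z" "b * w"] by (simp add: norm_mult)
  then have "(norm (a * z + b * w))\<^sup>2 \<le> (norm a * norm z + norm b * norm w)\<^sup>2"
    by (intro power_mono) auto
  also have "\<dots> \<le> 2 * (norm a * norm z)\<^sup>2 + 2 * (norm b * norm w)\<^sup>2"
    using zero_le_power2[of "norm a * norm z - norm b * norm w"]
    by (simp add: power2_eq_square algebra_simps)
  finally show ?thesis by (simp add: power_mult_distrib)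
qed

lemma L2_lincomb:
  fixes u v :: "'a \<Rightarrow> complex"
  assumes "u \<in> L2_space M" "v \<in> L2_space M"
  shows "(\<lambda>x. a * u x + b * v x) \<in> L2_space M"
    "(L2_norm M (\<lambda>x. a * u x + b * v x))\<^sup>2 \<le> 2 * (norm a)\<^sup>2 * (L2_norm M u)\<^sup>2 + 2 * (norm b)\<^sup>2 * (L2_norm M v)\<^sup>2"
proof -
  have m: "(\<lambda>x. a * u x + b * v x) \<in> borel_measurable M"
    using assms by (auto simp: L2_space_def)
  show "(\<lambda>x. a * u x + b * v x) \<in> L2_space M"
    "(L2_norm M (\<lambda>x. a * u x + b * v x))\<^sup>2 \<le> 2 * (norm a)\<^sup>2 * (L2_norm M u)\<^sup>2 + 2 * (norm b)\<^sup>2 * (L2_norm M v)\<^sup>2"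
    by (rule L2_dominated[OF assms m norm_lincomb_sq_le])+
qed

lemma norm_vec_sq: "(norm (z :: complex^'d))\<^sup>2 = (\<Sum>i\<in>UNIV. (norm (z $ i))\<^sup>2)"
  by (simp add: norm_vec_def L2_set_def sum_nonneg)

lemma borel_measurable_vec_componentwise:
  fixes G :: "'a \<Rightarrow> complex^'d"
  assumes "\<And>i. (\<lambda>x. G x $ i) \<in> borel_measurable M"
  shows "G \<in> borel_measurable M"
proof (rule borel_measurable_euclidean_space[THEN iffD2], rule ballI)
  fix b :: "complex^'d" assume "b \<in> Basis"
  then obtain i c where b: "b = axis i c" by (auto simp: Basis_vec_def)
  show "(\<lambda>x. G x \<bullet> b) \<in> borel_measurable M"
    unfolding b inner_axis using assms[of i] by measurable
qed

lemma borel_measurable_component: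
  fixes G :: "'a \<Rightarrow> complex^'d"
  assumes "G \<in> borel_measurable M"
  shows "(\<lambda>x. G x $ i) \<in> borel_measurable M"
  by (rule borel_measurable_continuous_on[OF _ assms]) (intro continuous_intros)

definition vec_lincomb :: "complex \<Rightarrow> complex^'d \<Rightarrow> complex \<Rightarrow> complex^'d \<Rightarrow> complex^'d" where
  "vec_lincomb a z b w = (\<chi> i. a * z $ i + b * w $ i)"

lemma L2_vec_lincomb:
  fixes G H :: "'a \<Rightarrow> complex^'d"
  assumes "G \<in> L2_space M" "H \<in> L2_space M"
  shows "(\<lambda>x. vec_lincomb a (G x) b (H x)) \<in> L2_space M"
    "(L2_norm M (\<lambda>x. vec_lincomb a (G x) b (H x)))\<^sup>2
       \<le> 2 * (norm a)\<^sup>2 * (L2_norm M G)\<^sup>2 + 2 * (norm b)\<^sup>2 * (L2_norm M H)\<^sup>2"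
proof -
  have m: "(\<lambda>x. vec_lincomb a (G x) b (H x)) \<in> borel_measurable M"
    using assms by (intro borel_measurable_vec_componentwise)
      (auto simp: vec_lincomb_def L2_space_def intro!: borel_measurable_add borel_measurable_times borel_measurable_component)
  have le: "(norm (vec_lincomb a z b w))\<^sup>2 \<le> 2 * (norm a)\<^sup>2 * (norm z)\<^sup>2 + 2 * (norm b)\<^sup>2 * (norm w)\<^sup>2" for z w :: "complex^'d"
    unfolding norm_vec_sq vec_lincomb_def sum_distrib_left sum.distrib[symmetric]
    by (intro sum_mono) (simp add: norm_lincomb_sq_le)
  show "(\<lambda>x. vec_lincomb a (G x) b (H x)) \<in> L2_space M"
    "(L2_norm M (\<lambda>x. vec_lincomb a (G x) b (H x)))\<^sup>2
       \<le> 2 * (norm a)\<^sup>2 * (L2_norm M G)\<^sup>2 + 2 * (norm b)\<^sup>2 * (L2_norm M H)\<^sup>2"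
    by (rule L2_dominated[OF assms m le])+
qed

lemma (in finite_measure) L2_bounded:
  assumes u: "u \<in> borel_measurable M" and B: "\<And>x. x \<in> space M \<Longrightarrow> (norm (u x))\<^sup>2 \<le> B"
  shows "u \<in> L2_space M" "(L2_norm M u)\<^sup>2 \<le> B * measure M (space M)"
proof -
  have i: "integrable M (\<lambda>x. (norm (u x))\<^sup>2)"
    using u B by (intro integrable_const_bound[where B = B] AE_I2) auto
  then show "u \<in> L2_space M" using u by (simp add: L2_space_def)
  have "(LINT x|M. (norm (u x))\<^sup>2) \<le> (LINT x|M. B)"
    by (rule integral_mono[OF i]) (use B in auto)
  then show "(L2_norm M u)\<^sup>2 \<le> B * measure M (space M)" by (simp add: L2_norm_sq mult.commute)
qed

lemma (in finite_measure) L2_integrable: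
  fixes u :: "'a \<Rightarrow> 'b::{banach, second_countable_topology}"
  assumes "u \<in> L2_space M"
  shows "integrable M u"
proof -
  have i: "integrable M (\<lambda>x. 1 + (norm (u x))\<^sup>2)"
    using assms by (simp add: L2_space_def)
  have "norm (u x) \<le> norm (1 + (norm (u x))\<^sup>2)" for x
    using zero_le_power2[of "norm (u x) - 1"] by (simp add: power2_eq_square algebra_simps)
      (smt (verit) norm_ge_zero zero_le_mult_iff)
  then show ?thesis
    using assms by (intro Bochner_Integration.integrable_bound[OF i]) (auto simp: L2_space_def)
qed

text \<open>
  With \<open>m\<close> the total mass and \<open>I\<close> the integral of \<open>|u|\<close>, the Cauchy-Schwarz inequality
  \<open>I\<^sup>2 \<le> m \<parallel>u\<parallel>\<^sup>2\<close> follows from integrating \<open>(m |u| - I)\<^sup>2 \<ge> 0\<close>.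
\<close>

lemma (in finite_measure) integral_norm_le_L2:
  fixes u :: "'a \<Rightarrow> 'b::{banach, second_countable_topology}"
  assumes u: "u \<in> L2_space M"
  shows "(LINT x|M. norm (u x)) \<le> sqrt (measure M (space M)) * L2_norm M u"
proof -
  define m where "m = measure M (space M)"
  define I where "I = (LINT x|M. norm (u x))"
  have i1: "integrable M (\<lambda>x. norm (u x))" using L2_integrable[OF u] by simp
  have i2: "integrable M (\<lambda>x. (norm (u x))\<^sup>2)" using u by (simp add: L2_space_def)
  have I0: "0 \<le> I" by (simp add: I_def)
  have m0: "0 \<le> m" by (simp add: m_def)
  have "I\<^sup>2 \<le> m * (L2_norm M u)\<^sup>2"
  proof (cases "m = 0")
    case True
    then have "emeasure M (space M) = 0" by (simp add: m_def emeasure_eq_measure)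
    then have "AE x in M. norm (u x) = 0" by (intro AE_I[of _ _ "space M"]) auto
    then have "I = 0" unfolding I_def by (simp add: integral_eq_zero_AE)
    then show ?thesis using m0 by simp
  next
    case False
    have "0 \<le> (LINT x|M. (m * norm (u x) - I)\<^sup>2)" by simp
    also have "\<dots> = (LINT x|M. m\<^sup>2 * (norm (u x))\<^sup>2 - 2 * m * I * norm (u x) + I\<^sup>2)"
      by (simp add: power2_eq_square algebra_simps)
    also have "\<dots> = m\<^sup>2 * (L2_norm M u)\<^sup>2 - 2 * m * I * I + I\<^sup>2 * m"
      using i1 i2 by (simp add: L2_norm_sq I_def m_def)
    also have "\<dots> = m * (m * (L2_norm M u)\<^sup>2 - I\<^sup>2)" by (simp add: power2_eq_square algebra_simps)
    finally have "0 \<le> m * (L2_norm M u)\<^sup>2 - I\<^sup>2"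
      using False m0 by (simp add: zero_le_mult_iff)
    then show ?thesis by simp
  qed
  then have "sqrt (I\<^sup>2) \<le> sqrt (m * (L2_norm M u)\<^sup>2)" by (rule real_sqrt_le_mono)
  then show ?thesis using I0 by (simp add: I_def m_def real_sqrt_mult L2_norm_nonneg)
qed

lemma test_functions_smooth: "\<phi> \<in> test_functions \<Omega> \<Longrightarrow> smooth \<phi>"
  by (simp add: test_functions_def)

locale bounded_domain =
  fixes \<Omega> :: "(real^'d) set"
  assumes bounded_domain: "bounded \<Omega>" and open_domain: "open \<Omega>"
begin

abbreviation \<mu> :: "(real^'d) measure" where
  "\<mu> \<equiv> lebesgue_on \<Omega>"

abbreviation \<sigma> :: "(real^'d) measure" where
  "\<sigma> \<equiv> surface_measure (frontier \<Omega>)"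

lemma finite_measure_domain: "finite_measure \<mu>"
  by (rule finite_measure_lebesgue_on_bounded[OF bounded_domain open_domain])

lemma integrable_mult_continuous:
  fixes g \<phi> :: "real^'d \<Rightarrow> complex"
  assumes g: "integrable \<mu> g" and \<phi>: "continuous_on UNIV \<phi>"
  shows "integrable \<mu> (\<lambda>x. g x * \<phi> x)"
proof -
  obtain B where B: "0 < B" "\<forall>x\<in>\<Omega>. norm (\<phi> x) \<le> B" using continuous_bounded_on[OF bounded_domain \<phi>] by metis
  have "integrable \<mu> (\<lambda>x. B * norm (g x))" using g by simp
  then show ?thesis
  proof (rule Bochner_Integration.integrable_bound)
    show "(\<lambda>x. g x * \<phi> x) \<in> borel_measurable \<mu>"
      by (rule borel_measurable_times[OF borel_measurable_integrable[OF g]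
            continuous_borel_measurable_lebesgue_on[OF open_domain \<phi>]])
    show "AE x in \<mu>. norm (g x * \<phi> x) \<le> norm (B * norm (g x))"
      using B by (intro AE_I2) (simp add: norm_mult mult.commute mult_right_mono)
  qed
qed

lemma AE_eq_if_test_integrals_eq:
  fixes g h :: "real^'d \<Rightarrow> complex"
  assumes g: "integrable \<mu> g" and h: "integrable \<mu> h"
    and eq: "\<And>\<phi>. \<phi> \<in> test_functions \<Omega> \<Longrightarrow>
      (LINT x|\<mu>. g x * \<phi> x) = (LINT x|\<mu>. h x * \<phi> x)"
  shows "AE x in \<mu>. g x = h x"
proof -
  have "AE x in \<mu>. g x - h x = 0"
  proof (rule AE_zero_if_orthogonal_to_test_functions[OF open_domain])
    show "integrable \<mu> (\<lambda>x. g x - h x)" using g h by simp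
    fix \<phi> assume \<phi>: "\<phi> \<in> test_functions \<Omega>"
    then have "continuous_on UNIV \<phi>" by (intro smooth_continuous test_functions_smooth)
    then have "integrable \<mu> (\<lambda>x. g x * \<phi> x)" "integrable \<mu> (\<lambda>x. h x * \<phi> x)"
      using g h by (auto intro: integrable_mult_continuous)
    then show "(LINT x|\<mu>. (g x - h x) * \<phi> x) = 0"
      using eq[OF \<phi>] by (simp add: left_diff_distrib)
  qed
  then show ?thesis by simp
qed

lemma L2_component:
  assumes "G \<in> L2_space \<mu>"
  shows "(\<lambda>x. (G x :: complex^'d) $ i) \<in> L2_space \<mu>"
  using assms
proof (rule L2_dominated(1)[where \<alpha> = 1 and \<beta> = 0])
  show "(\<lambda>x. G x $ i) \<in> borel_measurable \<mu>"
    using assms by (intro borel_measurable_component) (simp add: L2_space_def)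
  show "(norm (G x $ i))\<^sup>2 \<le> 1 * (norm (G x))\<^sup>2 + 0 * (norm (G x))\<^sup>2" for x
    using Finite_Cartesian_Product.norm_nth_le[of "G x" i] by (simp add: power_mono)
qed (rule assms)

lemma integrable_component:
  assumes "G \<in> L2_space \<mu>"
  shows "integrable \<mu> (\<lambda>x. (G x :: complex^'d) $ i)"
  by (rule finite_measure.L2_integrable[OF finite_measure_domain L2_component[OF assms]])

lemma has_weak_gradient_unique:
  assumes G: "G \<in> L2_space \<mu>" "has_weak_gradient \<Omega> u G"
    and H: "H \<in> L2_space \<mu>" "has_weak_gradient \<Omega> u H"
  shows "AE x in \<mu>. G x = H x"
proof -
  have "AE x in \<mu>. G x $ i = H x $ i" for i
  proof (rule AE_eq_if_test_integrals_eq)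
    fix \<phi> assume \<phi>: "\<phi> \<in> test_functions \<Omega>"
    show "(LINT x|\<mu>. G x $ i * \<phi> x) = (LINT x|\<mu>. H x $ i * \<phi> x)"
      using G(2)[unfolded has_weak_gradient_def, THEN bspec, OF \<phi>, THEN spec, of i]
        H(2)[unfolded has_weak_gradient_def, THEN bspec, OF \<phi>, THEN spec, of i] by simp
  qed (rule integrable_component, fact)+
  then have "AE x in \<mu>. \<forall>i\<in>UNIV. G x $ i = H x $ i"
    by (subst AE_ball_countable) auto
  then show ?thesis by (auto simp: vec_eq_iff)
qed

lemma has_weak_laplacian_unique:
  assumes g: "g \<in> L2_space \<mu>" "has_weak_laplacian \<Omega> u g"
    and h: "h \<in> L2_space \<mu>" "has_weak_laplacian \<Omega> u h"
  shows "AE x in \<mu>. g x = h x"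
proof (rule AE_eq_if_test_integrals_eq)
  fix \<phi> assume \<phi>: "\<phi> \<in> test_functions \<Omega>"
  show "(LINT x|\<mu>. g x * \<phi> x) = (LINT x|\<mu>. h x * \<phi> x)"
    using g(2)[unfolded has_weak_laplacian_def, THEN bspec, OF \<phi>]
      h(2)[unfolded has_weak_laplacian_def, THEN bspec, OF \<phi>] by simp
qed (rule finite_measure.L2_integrable[OF finite_measure_domain], fact)+

lemma weak_gradient:
  assumes "u \<in> H1 \<Omega>"
  shows "weak_gradient \<Omega> u \<in> L2_space \<mu>" "has_weak_gradient \<Omega> u (weak_gradient \<Omega> u)"
proof -
  have "\<exists>G. G \<in> L2_space \<mu> \<and> has_weak_gradient \<Omega> u G"
    using assms by (auto simp: H1_def)
  from someI_ex[OF this] show "weak_gradient \<Omega> u \<in> L2_space \<mu>" "has_weak_gradient \<Omega> u (weak_gradient \<Omega> u)"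
    by (simp_all add: weak_gradient_def)
qed

lemma H1_L2: "u \<in> H1 \<Omega> \<Longrightarrow> u \<in> L2_space \<mu>"
  by (simp add: H1_def)

lemma H1_integrable: "u \<in> H1 \<Omega> \<Longrightarrow> integrable \<mu> u"
  by (rule finite_measure.L2_integrable[OF finite_measure_domain H1_L2])

lemma has_weak_gradient_lincomb:
  assumes u: "u \<in> L2_space \<mu>" "G \<in> L2_space \<mu>" "has_weak_gradient \<Omega> u G"
    and v: "v \<in> L2_space \<mu>" "H \<in> L2_space \<mu>" "has_weak_gradient \<Omega> v H"
  shows "has_weak_gradient \<Omega> (\<lambda>x. a * u x + b * v x) (\<lambda>x. vec_lincomb a (G x) b (H x))"
  unfolding has_weak_gradient_def
proof (intro ballI allI)
  fix \<phi> i assume \<phi>: "\<phi> \<in> test_functions \<Omega>"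
  then have c: "continuous_on UNIV \<phi>" "continuous_on UNIV (pderivative i \<phi>)"
    by (auto intro: smooth_continuous smooth_pderivative test_functions_smooth)
  have split: "(LINT x|\<mu>. (a * f x + b * g x) * \<theta> x)
      = a * (LINT x|\<mu>. f x * \<theta> x) + b * (LINT x|\<mu>. g x * \<theta> x)"
    if "integrable \<mu> f" "integrable \<mu> g" "continuous_on UNIV \<theta>"
    for f g \<theta> :: "real^'d \<Rightarrow> complex"
  proof -
    have "(LINT x|\<mu>. (a * f x + b * g x) * \<theta> x)
        = (LINT x|\<mu>. a * (f x * \<theta> x) + b * (g x * \<theta> x))"
      by (simp add: algebra_simps)
    also have "\<dots> = a * (LINT x|\<mu>. f x * \<theta> x) + b * (LINT x|\<mu>. g x * \<theta> x)"
      using that by (simp add: integrable_mult_continuous)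
    finally show ?thesis .
  qed
  have "(LINT x|\<mu>. u x * pderivative i \<phi> x) = - (LINT x|\<mu>. G x $ i * \<phi> x)"
    "(LINT x|\<mu>. v x * pderivative i \<phi> x) = - (LINT x|\<mu>. H x $ i * \<phi> x)"
    using u(3) v(3) \<phi> by (auto simp: has_weak_gradient_def)
  then show "(LINT x|\<mu>. (a * u x + b * v x) * pderivative i \<phi> x)
      = - (LINT x|\<mu>. vec_lincomb a (G x) b (H x) $ i * \<phi> x)"
    unfolding vec_lincomb_def vec_lambda_beta
    using u v c by (simp add: split integrable_component finite_measure.L2_integrable[OF finite_measure_domain])
qed

lemma H1_lincomb:
  assumes u: "u \<in> H1 \<Omega>" and v: "v \<in> H1 \<Omega>"
  shows "(\<lambda>x. a * u x + b * v x) \<in> H1 \<Omega>"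
    "AE x in \<mu>. weak_gradient \<Omega> (\<lambda>x. a * u x + b * v x) x
        = vec_lincomb a (weak_gradient \<Omega> u x) b (weak_gradient \<Omega> v x)"
proof -
  let ?w = "\<lambda>x. a * u x + b * v x" and ?G = "\<lambda>x. vec_lincomb a (weak_gradient \<Omega> u x) b (weak_gradient \<Omega> v x)"
  have G: "?G \<in> L2_space \<mu>" "has_weak_gradient \<Omega> ?w ?G"
    using u v by (auto intro!: L2_vec_lincomb has_weak_gradient_lincomb weak_gradient H1_L2)
  then show w: "?w \<in> H1 \<Omega>"
    using L2_lincomb(1)[OF H1_L2[OF u] H1_L2[OF v]] unfolding H1_def by blast
  show "AE x in \<mu>. weak_gradient \<Omega> ?w x = ?G x"
    by (rule has_weak_gradient_unique[OF weak_gradient[OF w] G])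
qed

lemma L2_norm_cong_AE:
  assumes "AE x in M. u x = v x" "u \<in> borel_measurable M" "v \<in> borel_measurable M"
  shows "L2_norm M u = L2_norm M v"
  unfolding L2_norm_def using assms
  by (intro arg_cong[where f = sqrt] integral_cong_AE) auto

lemma H1_norm_sq: "(H1_norm \<Omega> u)\<^sup>2 = (L2_norm \<mu> u)\<^sup>2 + (L2_norm \<mu> (weak_gradient \<Omega> u))\<^sup>2"
  by (simp add: H1_norm_def)

lemma H1_norm_nonneg: "0 \<le> H1_norm \<Omega> u"
  by (simp add: H1_norm_def)

lemma L2_norm_le_H1_norm:
  "L2_norm \<mu> u \<le> H1_norm \<Omega> u"
  "L2_norm \<mu> (weak_gradient \<Omega> u) \<le> H1_norm \<Omega> u"
  unfolding H1_norm_def by (auto intro!: real_le_rsqrt)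

lemma H1_norm_lincomb_sq:
  assumes u: "u \<in> H1 \<Omega>" and v: "v \<in> H1 \<Omega>"
  shows "(H1_norm \<Omega> (\<lambda>x. a * u x + b * v x))\<^sup>2 \<le> 2 * (norm a)\<^sup>2 * (H1_norm \<Omega> u)\<^sup>2 + 2 * (norm b)\<^sup>2 * (H1_norm \<Omega> v)\<^sup>2"
proof -
  let ?w = "\<lambda>x. a * u x + b * v x" and ?G = "\<lambda>x. vec_lincomb a (weak_gradient \<Omega> u x) b (weak_gradient \<Omega> v x)"
  have "L2_norm \<mu> (weak_gradient \<Omega> ?w) = L2_norm \<mu> ?G"
    using H1_lincomb[OF u v] weak_gradient(1)[OF H1_lincomb(1)[OF u v]]
      L2_vec_lincomb(1)[OF weak_gradient(1)[OF u] weak_gradient(1)[OF v]]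
    by (intro L2_norm_cong_AE) (auto simp: L2_space_def)
  then show ?thesis
    using L2_lincomb(2)[OF H1_L2[OF u] H1_L2[OF v], of a b]
      L2_vec_lincomb(2)[OF weak_gradient(1)[OF u] weak_gradient(1)[OF v], of a b]
    unfolding H1_norm_sq by (simp add: algebra_simps)
qed

end

section \<open>Smooth functions on a domain with finite boundary measure\<close>

lemma space_surface_measure [simp]: "space (surface_measure S) = S"
  by (simp add: surface_measure_def space_restrict_space)

lemma continuous_borel_measurable_surface:
  fixes S :: "(real^'d) set"
  assumes "continuous_on S f"
  shows "f \<in> borel_measurable (surface_measure S)"
proof -
  have "f \<in> borel_measurable (restrict_space borel S)"
    using assms by (rule borel_measurable_continuous_on_restrict)
  moreover have "sets (restrict_space (hausdorff_measure (CARD('d) - 1) :: (real^'d) measure) S) = sets (restrict_space borel S)"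
    by (rule sets_restrict_space_cong) simp
  ultimately show ?thesis unfolding surface_measure_def using measurable_cong_sets by blast
qed

lemma finite_measure_surface:
  fixes S :: "(real^'d) set"
  assumes "closed S" "emeasure (hausdorff_measure (CARD('d) - 1)) S < \<infinity>"
  shows "finite_measure (surface_measure S)"
proof (rule finite_measureI)
  have "emeasure (surface_measure S) S = emeasure (hausdorff_measure (CARD('d) - 1)) S"
    unfolding surface_measure_def using assms(1) by (intro emeasure_restrict_space) auto
  then show "emeasure (surface_measure S) (space (surface_measure S)) \<noteq> \<infinity>"
    using assms(2) by simp
qed

definition laplacian :: "(real^'d \<Rightarrow> complex) \<Rightarrow> real^'d \<Rightarrow> complex" where
  "laplacian v x = (\<Sum>i\<in>UNIV. pderivative i (pderivative i v) x)"

lemma smooth_laplacian: "smooth v \<Longrightarrow> smooth (laplacian v)"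
  unfolding laplacian_def by (intro smooth_sum smooth_pderivative)

lemma laplacian_lincomb:
  assumes "smooth u" "smooth v"
  shows "laplacian (\<lambda>x. a * u x + b * v x) = (\<lambda>x. a * laplacian u x + b * laplacian v x)"
proof
  fix x
  have "pderivative i (pderivative i (\<lambda>x. a * u x + b * v x)) = (\<lambda>x. a * pderivative i (pderivative i u) x + b * pderivative i (pderivative i v) x)" for i
    using assms by (simp add: pderivative_lincomb smooth_differentiable smooth_pderivative)
  then show "laplacian (\<lambda>x. a * u x + b * v x) x = a * laplacian u x + b * laplacian v x"
    by (simp add: laplacian_def sum.distrib sum_distrib_left)
qed

text \<open>
  Second derivatives enter Green's formula through the Laplacian only.
\<close>

definition C2_bound :: "(real^'d) set \<Rightarrow> (real^'d \<Rightarrow> complex) \<Rightarrow> real \<Rightarrow> bool" where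
  "C2_bound S v M \<longleftrightarrow> (\<forall>x\<in>S. norm (v x) \<le> M \<and> (\<forall>i. norm (pderivative i v x) \<le> M) \<and> norm (laplacian v x) \<le> M)"

lemma smooth_C2_bound:
  fixes v :: "real^'d \<Rightarrow> complex"
  assumes "bounded S" "smooth v"
  shows "\<exists>M>0. C2_bound S v M"
proof -
  define T where "T = (\<lambda>x. norm (v x) + (\<Sum>i\<in>UNIV. norm (pderivative i v x)) + norm (laplacian v x))"
  have "continuous_on UNIV T"
    unfolding T_def using assms(2)
    by (intro continuous_intros smooth_continuous smooth_pderivative smooth_laplacian)
  then obtain M where M: "0 < M" "\<forall>x\<in>S. norm (T x) \<le> M" using continuous_bounded_on[OF assms(1)] by metis
  have "norm (v x) \<le> T x" "norm (pderivative i v x) \<le> T x" "norm (laplacian v x) \<le> T x" for x i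
  proof -
    have "norm (pderivative i v x) \<le> (\<Sum>i\<in>UNIV. norm (pderivative i v x))"
      by (rule member_le_sum) auto
    moreover have "0 \<le> norm (v x)" "0 \<le> norm (laplacian v x)" by auto
    moreover have "0 \<le> (\<Sum>i\<in>UNIV. norm (pderivative i v x))" by (simp add: sum_nonneg)
    ultimately show "norm (v x) \<le> T x" "norm (pderivative i v x) \<le> T x" "norm (laplacian v x) \<le> T x"
      unfolding T_def by linarith+
  qed
  moreover have "T x \<le> M" if "x \<in> S" for x using M(2) that by (auto simp: abs_le_iff)
  ultimately show ?thesis using M(1) unfolding C2_bound_def by (meson order_trans)
qed

text \<open>
  The first assumption excludes the case in which the surface measure is the null measure by
  convention.
\<close>

locale finite_boundary_domain = bounded_domain \<Omega> for \<Omega> :: "(real^'a) set" +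
  assumes hausdorff: "measure_space UNIV (sets borel) (hausdorff_outer (CARD('a) - 1) :: (real^'a) set \<Rightarrow> ennreal)"
    and finite_boundary: "emeasure (hausdorff_measure (CARD('a) - 1)) (frontier \<Omega>) < \<infinity>"
begin

lemma finite_measure_boundary: "finite_measure \<sigma>"
  by (rule finite_measure_surface[OF _ finite_boundary]) simp

lemma norm_integral_pderivative:
  "smooth f \<Longrightarrow> norm (LINT x|\<mu>. pderivative i f x)
     \<le> tube_const TYPE('a) * (LINT x|\<sigma>. norm (f x))"
  by (intro norm_integral_pderivative_le hausdorff bounded_domain open_domain finite_boundary
      smooth_differentiable smooth_continuous smooth_pderivative)

lemma smooth_integrable: "smooth f \<Longrightarrow> integrable \<mu> f"
  by (rule continuous_integrable_lebesgue_on[OF bounded_domain open_domain smooth_continuous])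

text \<open>
  The product vanishes on the boundary, so the bound for \<open>\<integral>\<^sub>\<Omega> \<partial>\<^sub>i(f\<phi>)\<close> in terms of boundary values is
  zero.
\<close>

lemma integral_by_parts:
  assumes f: "smooth f" and \<phi>: "\<phi> \<in> test_functions \<Omega>"
  shows "(LINT x|\<mu>. f x * pderivative i \<phi> x) = - (LINT x|\<mu>. pderivative i f x * \<phi> x)"
proof -
  have s\<phi>: "smooth \<phi>" using \<phi> by (rule test_functions_smooth)
  have "\<phi> x = 0" if "x \<in> frontier \<Omega>" for x
  proof (rule ccontr)
    assume "\<phi> x \<noteq> 0"
    then have "x \<in> closure {x. \<phi> x \<noteq> 0}" using closure_subset[of "{x. \<phi> x \<noteq> 0}"] by auto
    then have "x \<in> \<Omega>" using \<phi> by (auto simp: test_functions_def)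
    then show False using that open_domain by (simp add: frontier_def interior_open)
  qed
  then have "(LINT x|\<sigma>. norm (f x * \<phi> x)) = (LINT x|\<sigma>. 0)"
    by (intro Bochner_Integration.integral_cong) auto
  then have "norm (LINT x|\<mu>. pderivative i (\<lambda>x. f x * \<phi> x) x) \<le> 0"
    using norm_integral_pderivative[OF smooth_mult[OF f s\<phi>], of i] by simp
  then have "(LINT x|\<mu>. f x * pderivative i \<phi> x + pderivative i f x * \<phi> x) = 0"
    using f s\<phi> by (simp add: pderivative_mult smooth_differentiable)
  moreover have "integrable \<mu> (\<lambda>x. f x * pderivative i \<phi> x)" "integrable \<mu> (\<lambda>x. pderivative i f x * \<phi> x)"
    using f s\<phi> by (auto intro!: smooth_integrable smooth_mult smooth_pderivative)
  ultimately show ?thesis by (simp add: eq_neg_iff_add_eq_0)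
qed

lemma smooth_L2: "smooth f \<Longrightarrow> f \<in> L2_space \<mu>"
proof -
  assume f: "smooth f"
  obtain M where "\<forall>x\<in>\<Omega>. norm (f x) \<le> M" using continuous_bounded_on[OF bounded_domain smooth_continuous[OF f]] by metis
  then show ?thesis
    by (intro finite_measure.L2_bounded(1)[OF finite_measure_domain, where B = "M\<^sup>2"]
        continuous_borel_measurable_lebesgue_on[OF open_domain smooth_continuous[OF f]] power_mono) auto
qed

lemma classical_gradient:
  assumes f: "smooth f"
  shows "(\<lambda>x. \<chi> i. pderivative i f x) \<in> L2_space \<mu>"
    "has_weak_gradient \<Omega> f (\<lambda>x. \<chi> i. pderivative i f x)"
proof -
  obtain M where M: "C2_bound \<Omega> f M" using smooth_C2_bound[OF bounded_domain f] by blast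
  show "(\<lambda>x. \<chi> i. pderivative i f x) \<in> L2_space \<mu>"
  proof (rule finite_measure.L2_bounded(1)[OF finite_measure_domain])
    show "(\<lambda>x. \<chi> i. pderivative i f x) \<in> borel_measurable \<mu>"
      using f by (intro borel_measurable_vec_componentwise)
        (simp add: continuous_borel_measurable_lebesgue_on[OF open_domain] smooth_continuous smooth_pderivative)
    fix x assume "x \<in> space \<mu>"
    then show "(norm (\<chi> i. pderivative i f x))\<^sup>2 \<le> (\<Sum>i\<in>(UNIV::'a set). M\<^sup>2)"
      unfolding norm_vec_sq using M by (intro sum_mono power_mono) (auto simp: C2_bound_def)
  qed
  show "has_weak_gradient \<Omega> f (\<lambda>x. \<chi> i. pderivative i f x)"
    unfolding has_weak_gradient_def using integral_by_parts[OF f] by simp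
qed

lemma smooth_H1: "smooth f \<Longrightarrow> f \<in> H1 \<Omega>"
  unfolding H1_def using smooth_L2 classical_gradient by blast

lemma smooth_weak_gradient:
  "smooth f \<Longrightarrow> AE x in \<mu>. weak_gradient \<Omega> f x = (\<chi> i. pderivative i f x)"
  by (rule has_weak_gradient_unique[OF weak_gradient[OF smooth_H1] classical_gradient])

lemma smooth_weak_laplacian:
  assumes f: "smooth f"
  shows "has_weak_laplacian \<Omega> f (laplacian f)"
  unfolding has_weak_laplacian_def
proof
  fix \<phi> assume \<phi>: "\<phi> \<in> test_functions \<Omega>"
  then have s\<phi>: "smooth \<phi>" by (rule test_functions_smooth)
  have t: "pderivative i \<phi> \<in> test_functions \<Omega>" for i
  proof -
    have "{x. pderivative i \<phi> x \<noteq> 0} \<subseteq> closure {x. \<phi> x \<noteq> 0}"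
    proof (rule ccontr)
      assume "\<not> ?thesis"
      then obtain x where x: "pderivative i \<phi> x \<noteq> 0" "x \<in> - closure {x. \<phi> x \<noteq> 0}" by blast
      have "(\<phi> has_derivative (\<lambda>h. 0)) (at x)"
      proof (rule has_derivative_transform_within_open[OF has_derivative_const _ x(2)])
        show "open (- closure {x. \<phi> x \<noteq> 0})" by auto
        fix y assume "y \<in> - closure {x. \<phi> x \<noteq> 0}"
        then have "y \<notin> {x. \<phi> x \<noteq> 0}" using closure_subset[of "{x. \<phi> x \<noteq> 0}"] by auto
        then show "0 = \<phi> y" by simp
      qed
      then show False using x(1) pderivative_eqI by metis
    qed
    then have sub: "closure {x. pderivative i \<phi> x \<noteq> 0} \<subseteq> closure {x. \<phi> x \<noteq> 0}"
      by (simp add: closure_minimal)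
    have c: "compact (closure {x. \<phi> x \<noteq> 0})" "closure {x. \<phi> x \<noteq> 0} \<subseteq> \<Omega>"
      using \<phi> by (simp_all add: test_functions_def)
    have "compact (closure {x. pderivative i \<phi> x \<noteq> 0})"
      using compact_Int_closed[OF c(1) closed_closure, of "{x. pderivative i \<phi> x \<noteq> 0}"] sub
      by (simp add: Int_absorb1)
    then show ?thesis
      using smooth_pderivative[OF s\<phi>] order_trans[OF sub c(2)] by (simp add: test_functions_def)
  qed
  have ii: "integrable \<mu> (\<lambda>x. f x * pderivative i (pderivative i \<phi>) x)"
    "integrable \<mu> (\<lambda>x. pderivative i (pderivative i f) x * \<phi> x)" for i
    using f s\<phi> by (auto intro!: smooth_integrable smooth_mult smooth_pderivative)
  have "(LINT x|\<mu>. f x * (\<Sum>i\<in>UNIV. pderivative i (pderivative i \<phi>) x))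
      = (\<Sum>i\<in>UNIV. LINT x|\<mu>. f x * pderivative i (pderivative i \<phi>) x)"
    unfolding sum_distrib_left by (rule Bochner_Integration.integral_sum) (rule ii)
  also have "\<dots> = (\<Sum>i\<in>UNIV. LINT x|\<mu>. pderivative i (pderivative i f) x * \<phi> x)"
    using integral_by_parts[OF f t] integral_by_parts[OF smooth_pderivative[OF f] \<phi>] by simp
  also have "\<dots> = (LINT x|\<mu>. laplacian f x * \<phi> x)"
    unfolding laplacian_def sum_distrib_right by (rule Bochner_Integration.integral_sum[symmetric]) (rule ii)
  finally show "(LINT x|\<mu>. f x * (\<Sum>i\<in>UNIV. pderivative i (pderivative i \<phi>) x))
      = (LINT x|\<mu>. laplacian f x * \<phi> x)" .
qed

definition vol_root :: real where
  "vol_root = sqrt (measure \<mu> \<Omega>)"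

lemma vol_root_nonneg: "0 \<le> vol_root"
  by (simp add: vol_root_def)

text \<open>
  One constant for all continuity estimates in terms of \<^const>\<open>C2_bound\<close>; the summand \<open>1\<close> makes it
  positive.
\<close>

definition H1_const :: real where
  "H1_const = real (CARD('a) + 1) * vol_root + 1"

lemma H1_const_pos: "0 < H1_const"
  using mult_nonneg_nonneg[OF _ vol_root_nonneg, of "real (CARD('a) + 1)"] by (simp add: H1_const_def)

lemma H1_norm_smooth_le:
  assumes f: "smooth f" and M: "C2_bound \<Omega> f M" "0 \<le> M"
  shows "H1_norm \<Omega> f \<le> H1_const * M"
proof -
  define m where "m = measure \<mu> \<Omega>"
  have m: "0 \<le> m" "vol_root\<^sup>2 = m" by (simp_all add: m_def vol_root_def)
  have 1: "(L2_norm \<mu> f)\<^sup>2 \<le> M\<^sup>2 * m"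
    using finite_measure.L2_bounded(2)[OF finite_measure_domain, of f "M\<^sup>2"]
      continuous_borel_measurable_lebesgue_on[OF open_domain smooth_continuous[OF f]] M
    by (auto simp: C2_bound_def m_def intro: power_mono)
  have "L2_norm \<mu> (weak_gradient \<Omega> f) = L2_norm \<mu> (\<lambda>x. \<chi> i. pderivative i f x)"
    using smooth_weak_gradient[OF f] weak_gradient(1)[OF smooth_H1[OF f]] classical_gradient(1)[OF f]
    by (intro L2_norm_cong_AE) (auto simp: L2_space_def)
  moreover have "(L2_norm \<mu> (\<lambda>x. \<chi> i. pderivative i f x))\<^sup>2 \<le> (real CARD('a) * M\<^sup>2) * m"
  proof -
    have "(norm (\<chi> i. pderivative i f x))\<^sup>2 \<le> real CARD('a) * M\<^sup>2" if "x \<in> \<Omega>" for x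
    proof -
      have "(norm (\<chi> i. pderivative i f x))\<^sup>2 \<le> (\<Sum>i\<in>(UNIV::'a set). M\<^sup>2)"
        unfolding norm_vec_sq using M that by (intro sum_mono power_mono) (auto simp: C2_bound_def)
      then show ?thesis by simp
    qed
    then show ?thesis
      using finite_measure.L2_bounded(2)[OF finite_measure_domain, of "\<lambda>x. \<chi> i. pderivative i f x" "real CARD('a) * M\<^sup>2"]
        classical_gradient(1)[OF f] by (auto simp: L2_space_def m_def)
  qed
  ultimately have "(H1_norm \<Omega> f)\<^sup>2 \<le> M\<^sup>2 * m + (real CARD('a) * M\<^sup>2) * m"
    unfolding H1_norm_sq using 1 by simp
  also have "\<dots> = real (CARD('a) + 1) * (vol_root * M)\<^sup>2"
    by (simp add: power_mult_distrib m(2) algebra_simps)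
  also have "\<dots> \<le> (real (CARD('a) + 1))\<^sup>2 * (vol_root * M)\<^sup>2"
    by (intro mult_right_mono) (auto simp: power2_eq_square)
  also have "\<dots> = (real (CARD('a) + 1) * vol_root * M)\<^sup>2" by (simp add: power_mult_distrib)
  finally have "H1_norm \<Omega> f \<le> real (CARD('a) + 1) * vol_root * M"
    by (rule power2_le_imp_le) (use M(2) vol_root_nonneg in auto)
  then show ?thesis using M(2) by (simp add: H1_const_def algebra_simps)
qed

lemma H1_norm_zero: "H1_norm \<Omega> (\<lambda>x. 0) = 0"
proof -
  have "C2_bound \<Omega> (\<lambda>x. 0) 0" by (simp add: C2_bound_def laplacian_def)
  then have "H1_norm \<Omega> (\<lambda>x. 0) \<le> 0" using H1_norm_smooth_le[OF smooth_const, of 0 0] by simp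
  then show ?thesis using H1_norm_nonneg[of "\<lambda>x. 0"] by linarith
qed

text \<open>
  The integrand of Green's formula \<open>\<integral>\<^sub>\<partial>\<^sub>\<Omega> w \<partial>\<^sub>\<nu>v ds = \<integral>\<^sub>\<Omega> \<nabla>v \<cdot> \<nabla>w + w \<Delta>v dx\<close> for smooth \<open>v\<close>, with the
  classical derivatives of \<open>v\<close> and the weak gradient of \<open>w\<close>.
\<close>

definition green_density :: "(real^'a \<Rightarrow> complex) \<Rightarrow> (real^'a \<Rightarrow> complex) \<Rightarrow> real^'a \<Rightarrow> complex" where
  "green_density v w x = (\<Sum>i\<in>UNIV. pderivative i v x * weak_gradient \<Omega> w x $ i) + laplacian v x * w x"

definition green_pairing :: "(real^'a \<Rightarrow> complex) \<Rightarrow> (real^'a \<Rightarrow> complex) \<Rightarrow> complex" where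
  "green_pairing v w = (LINT x|\<mu>. green_density v w x)"

lemma green_density_integrable:
  assumes v: "smooth v" and w: "w \<in> H1 \<Omega>"
  shows "integrable \<mu> (green_density v w)"
proof -
  have "integrable \<mu> (\<lambda>x. weak_gradient \<Omega> w x $ i * pderivative i v x)" for i
    using v by (intro integrable_mult_continuous integrable_component weak_gradient(1)[OF w] smooth_continuous smooth_pderivative)
  moreover have "integrable \<mu> (\<lambda>x. w x * laplacian v x)"
    using v by (intro integrable_mult_continuous H1_integrable[OF w] smooth_continuous smooth_laplacian)
  ultimately show ?thesis unfolding green_density_def by (simp add: mult.commute)
qed

lemma green_pairing_lincomb_right:
  assumes v: "smooth v" and u: "u \<in> H1 \<Omega>" and w: "w \<in> H1 \<Omega>"
  shows "green_pairing v (\<lambda>x. a * u x + b * w x) = a * green_pairing v u + b * green_pairing v w"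
proof -
  let ?z = "\<lambda>x. a * u x + b * w x"
  have "AE x in \<mu>. green_density v ?z x = a * green_density v u x + b * green_density v w x"
    using H1_lincomb(2)[OF u w, of a b]
    by eventually_elim
       (simp add: green_density_def vec_lincomb_def sum_distrib_left sum.distrib[symmetric] algebra_simps)
  then have "green_pairing v ?z = (LINT x|\<mu>. a * green_density v u x + b * green_density v w x)"
    unfolding green_pairing_def
    using green_density_integrable[OF v] u w H1_lincomb(1)[OF u w]
    by (intro integral_cong_AE) auto
  also have "\<dots> = a * green_pairing v u + b * green_pairing v w"
    unfolding green_pairing_def using green_density_integrable[OF v] u w by simp
  finally show ?thesis .
qed

lemma green_pairing_lincomb_left:
  assumes u: "smooth u" and v: "smooth v" and w: "w \<in> H1 \<Omega>"
  shows "green_pairing (\<lambda>x. a * u x + b * v x) w = a * green_pairing u w + b * green_pairing v w"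
proof -
  have "green_density (\<lambda>x. a * u x + b * v x) w = (\<lambda>x. a * green_density u w x + b * green_density v w x)"
    using u v by (intro ext) (simp add: green_density_def laplacian_lincomb pderivative_lincomb smooth_differentiable
      sum_distrib_left sum.distrib[symmetric] algebra_simps)
  then show ?thesis
    unfolding green_pairing_def using green_density_integrable[OF u w] green_density_integrable[OF v w] by simp
qed

lemma norm_green_pairing_le:
  assumes v: "smooth v" and w: "w \<in> H1 \<Omega>" and M: "C2_bound \<Omega> v M" "0 \<le> M"
  shows "norm (green_pairing v w) \<le> H1_const * M * H1_norm \<Omega> w"
proof -
  let ?G = "weak_gradient \<Omega> w"
  have i1: "integrable \<mu> (\<lambda>x. norm (?G x))"
    using finite_measure.L2_integrable[OF finite_measure_domain weak_gradient(1)[OF w]] by simp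
  have i2: "integrable \<mu> (\<lambda>x. norm (w x))" using H1_integrable[OF w] by simp
  have "norm (green_pairing v w) \<le> (LINT x|\<mu>. norm (green_density v w x))"
    unfolding green_pairing_def by (rule integral_norm_bound)
  also have "\<dots> \<le> (LINT x|\<mu>. M * (real CARD('a) * norm (?G x) + norm (w x)))"
  proof (rule integral_mono)
    show "integrable \<mu> (\<lambda>x. norm (green_density v w x))"
      using green_density_integrable[OF v w] by simp
    show "integrable \<mu> (\<lambda>x. M * (real CARD('a) * norm (?G x) + norm (w x)))" using i1 i2 by simp
    fix x assume "x \<in> space \<mu>"
    then have x: "x \<in> \<Omega>" by simp
    have "norm (\<Sum>i\<in>UNIV. pderivative i v x * ?G x $ i) \<le> (\<Sum>i\<in>(UNIV::'a set). M * norm (?G x))"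
    proof (rule sum_norm_le)
      fix i
      show "norm (pderivative i v x * ?G x $ i) \<le> M * norm (?G x)"
        using M x Finite_Cartesian_Product.norm_nth_le[of "?G x" i]
        by (auto simp: norm_mult C2_bound_def intro!: mult_mono)
    qed
    moreover have "norm (laplacian v x * w x) \<le> M * norm (w x)"
      using M x by (auto simp: norm_mult C2_bound_def intro!: mult_right_mono)
    ultimately show "norm (green_density v w x) \<le> M * (real CARD('a) * norm (?G x) + norm (w x))"
      unfolding green_density_def
      using norm_triangle_ineq[of "\<Sum>i\<in>UNIV. pderivative i v x * ?G x $ i" "laplacian v x * w x"]
      by (simp add: algebra_simps)
  qed
  also have "\<dots> = M * (real CARD('a) * (LINT x|\<mu>. norm (?G x)) + (LINT x|\<mu>. norm (w x)))"
    using i1 i2 by simp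
  also have "\<dots> \<le> M * (real CARD('a) * (vol_root * H1_norm \<Omega> w) + vol_root * H1_norm \<Omega> w)"
  proof (intro mult_left_mono add_mono)
    have le: "(LINT x|\<mu>. norm (g x)) \<le> vol_root * H1_norm \<Omega> w"
      if "g \<in> L2_space \<mu>" "L2_norm \<mu> g \<le> H1_norm \<Omega> w" for g :: "real^'a \<Rightarrow> 'c::euclidean_space"
      using finite_measure.integral_norm_le_L2[OF finite_measure_domain that(1)]
        mult_left_mono[OF that(2) vol_root_nonneg] by (simp add: vol_root_def)
    show "(LINT x|\<mu>. norm (?G x)) \<le> vol_root * H1_norm \<Omega> w"
      by (intro le weak_gradient(1)[OF w] L2_norm_le_H1_norm)
    show "(LINT x|\<mu>. norm (w x)) \<le> vol_root * H1_norm \<Omega> w"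
      by (intro le H1_L2[OF w] L2_norm_le_H1_norm)
  qed (use M in auto)
  also have "\<dots> \<le> H1_const * M * H1_norm \<Omega> w"
    using M(2) H1_norm_nonneg[of w] by (simp add: H1_const_def algebra_simps)
  finally show ?thesis .
qed

section \<open>Traces and normal derivatives\<close>

lemma smooth_trace:
  assumes f: "smooth f"
  shows "has_boundary_trace \<Omega> f f"
proof -
  obtain B where "\<forall>x\<in>frontier \<Omega>. norm (f x) \<le> B"
    using continuous_bounded_on[OF compact_imp_bounded[OF compact_frontier_bounded[OF bounded_domain]] smooth_continuous[OF f]] by metis
  then have "f \<in> L2_space \<sigma>"
    using continuous_borel_measurable_surface[OF continuous_on_subset[OF smooth_continuous[OF f]], of "frontier \<Omega>"]
    by (intro finite_measure.L2_bounded(1)[OF finite_measure_boundary, where B = "B\<^sup>2"] power_mono) auto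
  then show ?thesis
    unfolding has_boundary_trace_def using f smooth_H1[OF f]
    by (intro conjI exI[of _ "\<lambda>n. f"]) (auto simp: H1_norm_zero L2_norm_def)
qed

lemma trace_lincomb:
  assumes u: "has_boundary_trace \<Omega> u g" and v: "has_boundary_trace \<Omega> v h"
  shows "has_boundary_trace \<Omega> (\<lambda>x. a * u x + b * v x) (\<lambda>x. a * g x + b * h x)"
proof -
  obtain \<phi> where \<phi>: "\<And>n. smooth (\<phi> n)" "(\<lambda>n. H1_norm \<Omega> (\<lambda>x. \<phi> n x - u x)) \<longlonglongrightarrow> 0"
    "(\<lambda>n. L2_norm \<sigma> (\<lambda>x. \<phi> n x - g x)) \<longlonglongrightarrow> 0"
    using u unfolding has_boundary_trace_def by blast
  obtain \<theta> where \<theta>: "\<And>n. smooth (\<theta> n)" "(\<lambda>n. H1_norm \<Omega> (\<lambda>x. \<theta> n x - v x)) \<longlonglongrightarrow> 0"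
    "(\<lambda>n. L2_norm \<sigma> (\<lambda>x. \<theta> n x - h x)) \<longlonglongrightarrow> 0"
    using v unfolding has_boundary_trace_def by blast
  have uH: "u \<in> H1 \<Omega>" "v \<in> H1 \<Omega>" and gL: "g \<in> L2_space \<sigma>" "h \<in> L2_space \<sigma>"
    using u v by (auto simp: has_boundary_trace_def)
  have eq: "(\<lambda>x. a * p x + b * q x - (a * r x + b * s x)) = (\<lambda>x. a * (p x - r x) + b * (q x - s x))"
    for p q r s :: "real^'a \<Rightarrow> complex" by (simp add: algebra_simps)
  have lim: "S \<longlonglongrightarrow> 0" if "\<And>n. 0 \<le> S n" "\<And>n. (S n)\<^sup>2 \<le> 2 * (norm a)\<^sup>2 * (P n)\<^sup>2 + 2 * (norm b)\<^sup>2 * (Q n)\<^sup>2"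
    "P \<longlonglongrightarrow> 0" "Q \<longlonglongrightarrow> 0" for S P Q :: "nat \<Rightarrow> real"
  proof -
    have "(\<lambda>n. 2 * (norm a)\<^sup>2 * (P n)\<^sup>2 + 2 * (norm b)\<^sup>2 * (Q n)\<^sup>2) \<longlonglongrightarrow> 2 * (norm a)\<^sup>2 * 0\<^sup>2 + 2 * (norm b)\<^sup>2 * 0\<^sup>2"
      using that(3,4) by (intro tendsto_intros)
    then have u: "(\<lambda>n. 2 * (norm a)\<^sup>2 * (P n)\<^sup>2 + 2 * (norm b)\<^sup>2 * (Q n)\<^sup>2) \<longlonglongrightarrow> 0" by simp
    have "(\<lambda>n. (S n)\<^sup>2) \<longlonglongrightarrow> 0"
      by (rule tendsto_sandwich[OF _ _ tendsto_const u]) (simp_all add: that(2))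
    then have "(\<lambda>n. sqrt ((S n)\<^sup>2)) \<longlonglongrightarrow> sqrt 0" by (rule tendsto_real_sqrt)
    then show ?thesis using that(1) by simp
  qed
  have 1: "(\<lambda>n. H1_norm \<Omega> (\<lambda>x. a * \<phi> n x + b * \<theta> n x - (a * u x + b * v x))) \<longlonglongrightarrow> 0"
    unfolding eq
  proof (rule lim[OF _ _ \<phi>(2) \<theta>(2)])
    fix n
    have "(\<lambda>x. \<phi> n x - u x) \<in> H1 \<Omega>" "(\<lambda>x. \<theta> n x - v x) \<in> H1 \<Omega>"
      using H1_lincomb(1)[OF smooth_H1[OF \<phi>(1)[of n]] uH(1), of 1 "-1"]
        H1_lincomb(1)[OF smooth_H1[OF \<theta>(1)[of n]] uH(2), of 1 "-1"] by simp_all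
    then show "(H1_norm \<Omega> (\<lambda>x. a * (\<phi> n x - u x) + b * (\<theta> n x - v x)))\<^sup>2
        \<le> 2 * (norm a)\<^sup>2 * (H1_norm \<Omega> (\<lambda>x. \<phi> n x - u x))\<^sup>2 + 2 * (norm b)\<^sup>2 * (H1_norm \<Omega> (\<lambda>x. \<theta> n x - v x))\<^sup>2"
      by (rule H1_norm_lincomb_sq)
  qed (rule H1_norm_nonneg)
  have 2: "(\<lambda>n. L2_norm \<sigma> (\<lambda>x. a * \<phi> n x + b * \<theta> n x - (a * g x + b * h x))) \<longlonglongrightarrow> 0"
    unfolding eq
  proof (rule lim[OF _ _ \<phi>(3) \<theta>(3)])
    fix n
    have "\<phi> n \<in> L2_space \<sigma>" "\<theta> n \<in> L2_space \<sigma>"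
      using smooth_trace[OF \<phi>(1)] smooth_trace[OF \<theta>(1)] by (auto simp: has_boundary_trace_def)
    then have "(\<lambda>x. \<phi> n x - g x) \<in> L2_space \<sigma>" "(\<lambda>x. \<theta> n x - h x) \<in> L2_space \<sigma>"
      using L2_lincomb(1)[where u = "\<phi> n" and a = 1 and b = "-1", OF _ gL(1)]
        L2_lincomb(1)[where u = "\<theta> n" and a = 1 and b = "-1", OF _ gL(2)] by simp_all
    then show "(L2_norm \<sigma> (\<lambda>x. a * (\<phi> n x - g x) + b * (\<theta> n x - h x)))\<^sup>2
        \<le> 2 * (norm a)\<^sup>2 * (L2_norm \<sigma> (\<lambda>x. \<phi> n x - g x))\<^sup>2
          + 2 * (norm b)\<^sup>2 * (L2_norm \<sigma> (\<lambda>x. \<theta> n x - h x))\<^sup>2"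
      by (rule L2_lincomb(2))
  qed (rule L2_norm_nonneg)
  show ?thesis
    unfolding has_boundary_trace_def
    using H1_lincomb(1)[OF uH] L2_lincomb(1)[OF gL] \<phi>(1) \<theta>(1) 1 2
    by (intro conjI exI[of _ "\<lambda>n x. a * \<phi> n x + b * \<theta> n x"]) (auto intro: smooth_lincomb)
qed

lemma trace_diff:
  assumes "has_boundary_trace \<Omega> u g" "has_boundary_trace \<Omega> v h"
  shows "has_boundary_trace \<Omega> (\<lambda>x. u x - v x) (\<lambda>x. g x - h x)"
  using trace_lincomb[OF assms, of 1 "-1"] by simp

text \<open>
  For smooth \<open>\<phi>\<close> the integrand is the divergence of \<open>\<phi> \<nabla>v\<close>, so each of its \<open>d\<close> summands is
  controlled by the boundary values of \<open>\<phi>\<close>.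
\<close>

lemma green_pairing_smooth_le:
  assumes v: "smooth v" and \<phi>: "smooth \<phi>" and M: "C2_bound (frontier \<Omega>) v M" "0 \<le> M"
  shows "norm (green_pairing v \<phi>) \<le> real CARD('a) * (tube_const TYPE('a) * M
     * (sqrt (measure \<sigma> (frontier \<Omega>)) * L2_norm \<sigma> \<phi>))"
proof -
  let ?S = "\<sigma>"
  define D where "D = (\<lambda>i x. pderivative i v x * \<phi> x)"
  have sD: "smooth (D i)" for i unfolding D_def using v \<phi> by (intro smooth_mult smooth_pderivative)
  have pD: "pderivative i (D i) x = pderivative i v x * pderivative i \<phi> x + pderivative i (pderivative i v) x * \<phi> x" for i x
    unfolding D_def using v \<phi> by (simp add: pderivative_mult smooth_differentiable smooth_pderivative)
  have "AE x in \<mu>. green_density v \<phi> x = (\<Sum>i\<in>UNIV. pderivative i (D i) x)"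
    using smooth_weak_gradient[OF \<phi>]
    by eventually_elim (simp add: green_density_def pD laplacian_def sum.distrib sum_distrib_right)
  then have "green_pairing v \<phi> = (LINT x|\<mu>. (\<Sum>i\<in>UNIV. pderivative i (D i) x))"
    unfolding green_pairing_def
    using green_density_integrable[OF v smooth_H1[OF \<phi>]] smooth_integrable[OF smooth_pderivative[OF sD]]
    by (intro integral_cong_AE) auto
  also have "\<dots> = (\<Sum>i\<in>UNIV. LINT x|\<mu>. pderivative i (D i) x)"
    by (intro Bochner_Integration.integral_sum smooth_integrable smooth_pderivative sD)
  also have "norm \<dots> \<le> (\<Sum>i\<in>(UNIV::'a set). tube_const TYPE('a) * M * (sqrt (measure ?S (frontier \<Omega>)) * L2_norm ?S \<phi>))"
  proof (rule sum_norm_le)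
    fix i
    have L2: "\<phi> \<in> L2_space ?S" "D i \<in> L2_space ?S"
      using smooth_trace[OF \<phi>] smooth_trace[OF sD] by (auto simp: has_boundary_trace_def)
    have "(LINT x|?S. norm (D i x)) \<le> (LINT x|?S. M * norm (\<phi> x))"
    proof (rule integral_mono)
      show "integrable ?S (\<lambda>x. norm (D i x))" "integrable ?S (\<lambda>x. M * norm (\<phi> x))"
        using finite_measure.L2_integrable[OF finite_measure_boundary] L2 by auto
      show "norm (D i x) \<le> M * norm (\<phi> x)" if "x \<in> space ?S" for x
        using M that by (auto simp: D_def norm_mult C2_bound_def intro!: mult_right_mono)
    qed
    also have "\<dots> = M * (LINT x|?S. norm (\<phi> x))" by simp
    also have "\<dots> \<le> M * (sqrt (measure ?S (frontier \<Omega>)) * L2_norm ?S \<phi>)"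
      using finite_measure.integral_norm_le_L2[OF finite_measure_boundary L2(1)] M(2)
      by (intro mult_left_mono) auto
    finally have "(LINT x|?S. norm (D i x)) \<le> M * (sqrt (measure ?S (frontier \<Omega>)) * L2_norm ?S \<phi>)" .
    then have "tube_const TYPE('a) * (LINT x|?S. norm (D i x))
        \<le> tube_const TYPE('a) * (M * (sqrt (measure ?S (frontier \<Omega>)) * L2_norm ?S \<phi>))"
      by (intro mult_left_mono tube_const_nonneg)
    then show "norm (LINT x|\<mu>. pderivative i (D i) x)
        \<le> tube_const TYPE('a) * M * (sqrt (measure ?S (frontier \<Omega>)) * L2_norm ?S \<phi>)"
      using norm_integral_pderivative[OF sD, of i i] by (simp add: mult.assoc)
  qed
  finally show ?thesis by simp
qed

text \<open>
  Approximate \<open>w\<close> by smooth functions \<open>\<phi>\<^sub>n\<close> as in the definition of the trace: the pairing with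
  \<open>\<phi>\<^sub>n - w\<close> is small in the \<open>H\<^sup>1\<close> norm, the pairing with \<open>\<phi>\<^sub>n\<close> is small since \<open>\<phi>\<^sub>n\<close> tends to zero on the
  boundary.
\<close>

lemma green_pairing_zero_trace:
  assumes v: "smooth v" and w: "has_boundary_trace \<Omega> w (\<lambda>_. 0)"
  shows "green_pairing v w = 0"
proof -
  let ?S = "\<sigma>"
  obtain \<phi> where \<phi>: "\<And>n. smooth (\<phi> n)" "(\<lambda>n. H1_norm \<Omega> (\<lambda>x. \<phi> n x - w x)) \<longlonglongrightarrow> 0"
    "(\<lambda>n. L2_norm ?S (\<phi> n)) \<longlonglongrightarrow> 0"
    using w unfolding has_boundary_trace_def by auto
  have wH: "w \<in> H1 \<Omega>" using w by (simp add: has_boundary_trace_def)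
  obtain M where M: "0 < M" "C2_bound \<Omega> v M" using smooth_C2_bound[OF bounded_domain v] by blast
  obtain M' where M': "0 < M'" "C2_bound (frontier \<Omega>) v M'"
    using smooth_C2_bound[OF compact_imp_bounded[OF compact_frontier_bounded[OF bounded_domain]] v] by blast
  define E where "E = (\<lambda>n. real CARD('a) * (tube_const TYPE('a) * M'
     * (sqrt (measure ?S (frontier \<Omega>)) * L2_norm ?S (\<phi> n))) + H1_const * M * H1_norm \<Omega> (\<lambda>x. \<phi> n x - w x))"
  have "norm (green_pairing v w) \<le> E n" for n
  proof -
    have d: "(\<lambda>x. \<phi> n x - w x) \<in> H1 \<Omega>"
      using H1_lincomb(1)[OF smooth_H1[OF \<phi>(1)[of n]] wH, of 1 "-1"] by simp
    have "green_pairing v (\<lambda>x. \<phi> n x - w x) = green_pairing v (\<phi> n) - green_pairing v w"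
      using green_pairing_lincomb_right[OF v smooth_H1[OF \<phi>(1)[of n]] wH, of 1 "-1"] by simp
    then have "green_pairing v w = green_pairing v (\<phi> n) - green_pairing v (\<lambda>x. \<phi> n x - w x)" by simp
    then have "norm (green_pairing v w) \<le> norm (green_pairing v (\<phi> n)) + norm (green_pairing v (\<lambda>x. \<phi> n x - w x))"
      using norm_triangle_ineq4 by metis
    then show ?thesis
      unfolding E_def using green_pairing_smooth_le[OF v \<phi>(1) M'(2)] norm_green_pairing_le[OF v d M(2)] M(1) M'(1)
      by (smt (verit))
  qed
  moreover have "E \<longlonglongrightarrow> real CARD('a) * (tube_const TYPE('a) * M' * (sqrt (measure ?S (frontier \<Omega>)) * 0)) + H1_const * M * 0"
    unfolding E_def using \<phi>(2,3) by (intro tendsto_intros)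
  ultimately have "norm (green_pairing v w) \<le> 0"
    by (intro LIMSEQ_le_const[of E]) auto
  then show ?thesis by simp
qed

lemma green_pairing_trace_unique:
  assumes v: "smooth v" and w: "has_boundary_trace \<Omega> w g" "has_boundary_trace \<Omega> w' g"
  shows "green_pairing v w = green_pairing v w'"
proof -
  have "has_boundary_trace \<Omega> (\<lambda>x. w x - w' x) (\<lambda>_. 0)" using trace_diff[OF w] by simp
  then have "green_pairing v (\<lambda>x. w x - w' x) = 0" by (rule green_pairing_zero_trace[OF v])
  moreover have "w \<in> H1 \<Omega>" "w' \<in> H1 \<Omega>" using w by (auto simp: has_boundary_trace_def)
  ultimately show ?thesis using green_pairing_lincomb_right[OF v, of w w' 1 "-1"] by simp
qed

lemma Hhalf_norm_le: "has_boundary_trace \<Omega> u g \<Longrightarrow> Hhalf_norm \<Omega> g \<le> H1_norm \<Omega> u"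
  unfolding Hhalf_norm_def by (rule cInf_lower) (auto intro!: bdd_belowI[of _ 0] H1_norm_nonneg)

lemma Hhalf_norm_nonneg: "g \<in> Hhalf \<Omega> \<Longrightarrow> 0 \<le> Hhalf_norm \<Omega> g"
  unfolding Hhalf_norm_def Hhalf_def by (rule cInf_greatest) (auto intro: H1_norm_nonneg)

lemma le_Hhalf_norm:
  assumes g: "g \<in> Hhalf \<Omega>" and K: "0 \<le> K" and le: "\<And>u. has_boundary_trace \<Omega> u g \<Longrightarrow> c \<le> K * H1_norm \<Omega> u"
  shows "c \<le> K * Hhalf_norm \<Omega> g"
proof (cases "K = 0")
  case True
  then show ?thesis using le g by (auto simp: Hhalf_def)
next
  case False
  then have K: "0 < K" using K by simp
  have "c / K \<le> Hhalf_norm \<Omega> g"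
    unfolding Hhalf_norm_def using g le K
    by (intro cInf_greatest) (auto simp: Hhalf_def pos_divide_le_eq mult.commute)
  then show ?thesis using K by (simp add: pos_divide_le_eq mult.commute)
qed

text \<open>
  The normal derivative of a smooth function; by \<open>green_pairing_trace_unique\<close> the choice of the extension
  \<open>w\<close> of \<open>g\<close> is immaterial.
\<close>

definition green_functional :: "(real^'a \<Rightarrow> complex) \<Rightarrow> 'a boundary_functional" where
  "green_functional v g = green_pairing v (SOME w. has_boundary_trace \<Omega> w g)"

lemma green_functional:
  assumes v: "smooth v" and w: "has_boundary_trace \<Omega> w g"
  shows "green_functional v g = green_pairing v w"
  unfolding green_functional_def
  using someI[of "\<lambda>w. has_boundary_trace \<Omega> w g", OF w] w by (rule green_pairing_trace_unique[OF v])

lemma norm_green_functional_le: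
  assumes v: "smooth v" and M: "C2_bound \<Omega> v M" "0 \<le> M" and g: "g \<in> Hhalf \<Omega>"
  shows "norm (green_functional v g) \<le> H1_const * M * Hhalf_norm \<Omega> g"
proof (rule le_Hhalf_norm[OF g])
  show "0 \<le> H1_const * M" using H1_const_pos M(2) by simp
  fix u assume u: "has_boundary_trace \<Omega> u g"
  then have "u \<in> H1 \<Omega>" by (simp add: has_boundary_trace_def)
  then show "norm (green_functional v g) \<le> H1_const * M * H1_norm \<Omega> u"
    unfolding green_functional[OF v u] by (rule norm_green_pairing_le[OF v _ M])
qed

lemma green_functional_Hmhalf:
  assumes v: "smooth v"
  shows "green_functional v \<in> Hmhalf \<Omega>"
proof -
  obtain M where M: "0 < M" "C2_bound \<Omega> v M" using smooth_C2_bound[OF bounded_domain v] by blast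
  have "green_functional v (\<lambda>x. a * g x + b * h x) = a * green_functional v g + b * green_functional v h"
    if gh: "g \<in> Hhalf \<Omega>" "h \<in> Hhalf \<Omega>" for g h a b
  proof -
    obtain u w where uw: "has_boundary_trace \<Omega> u g" "has_boundary_trace \<Omega> w h"
      using gh by (auto simp: Hhalf_def)
    then have "u \<in> H1 \<Omega>" "w \<in> H1 \<Omega>" by (auto simp: has_boundary_trace_def)
    then show ?thesis
      using uw by (simp add: green_functional[OF v] green_functional[OF v trace_lincomb] green_pairing_lincomb_right[OF v])
  qed
  moreover have "\<exists>K. \<forall>g\<in>Hhalf \<Omega>. norm (green_functional v g) \<le> K * Hhalf_norm \<Omega> g"
    using norm_green_functional_le[OF v M(2)] M(1) by (meson less_imp_le)
  ultimately show ?thesis unfolding Hmhalf_def by blast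
qed

lemma green_pairing_weak_form:
  assumes v: "smooth v" and w: "w \<in> H1 \<Omega>" and h: "h \<in> L2_space \<mu>" "has_weak_laplacian \<Omega> v h"
  shows "(LINT x|\<mu>. (\<Sum>i\<in>UNIV. weak_gradient \<Omega> v x $ i * weak_gradient \<Omega> w x $ i) + h x * w x)
    = green_pairing v w"
  unfolding green_pairing_def
proof (rule integral_cong_AE)
  have "AE x in \<mu>. h x = laplacian v x"
    by (rule has_weak_laplacian_unique[OF h smooth_L2[OF smooth_laplacian[OF v]] smooth_weak_laplacian[OF v]])
  with smooth_weak_gradient[OF v]
  show "AE x in \<mu>. (\<Sum>i\<in>UNIV. weak_gradient \<Omega> v x $ i * weak_gradient \<Omega> w x $ i) + h x * w x = green_density v w x"
    by eventually_elim (simp add: green_density_def)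
  have "weak_gradient \<Omega> u \<in> borel_measurable \<mu>" if "u \<in> H1 \<Omega>" for u
    using weak_gradient(1)[OF that] by (simp add: L2_space_def)
  then have [measurable]: "(\<lambda>x. weak_gradient \<Omega> v x $ i) \<in> borel_measurable \<mu>"
    "(\<lambda>x. weak_gradient \<Omega> w x $ i) \<in> borel_measurable \<mu>" for i
    using smooth_H1[OF v] w by (auto intro: borel_measurable_component)
  have [measurable]: "h \<in> borel_measurable \<mu>" "w \<in> borel_measurable \<mu>"
    using h(1) H1_L2[OF w] by (auto simp: L2_space_def)
  show "(\<lambda>x. (\<Sum>i\<in>UNIV. weak_gradient \<Omega> v x $ i * weak_gradient \<Omega> w x $ i) + h x * w x) \<in> borel_measurable \<mu>"
    by measurable
  show "green_density v w \<in> borel_measurable \<mu>"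
    using green_density_integrable[OF v w] by simp
qed

text \<open>
  The Green functional satisfies the defining property, so the choice operator picks some
  functional with that property. Uniqueness of the weak Laplacian and of the weak gradient forces the
  picked functional to agree with it on traces.
\<close>

lemma normal_derivative_smooth:
  assumes v: "smooth v" and g: "g \<in> Hhalf \<Omega>"
  shows "normal_derivative \<Omega> v g = green_functional v g"
proof -
  have "has_normal_derivative \<Omega> v (green_functional v)"
    unfolding has_normal_derivative_def
  proof (intro conjI bexI[of _ "laplacian v"] allI impI)
    fix w g assume w: "has_boundary_trace \<Omega> w g"
    then have "w \<in> H1 \<Omega>" by (simp add: has_boundary_trace_def)
    then show "green_functional v g = (LINT x|\<mu>. (\<Sum>i\<in>UNIV. weak_gradient \<Omega> v x $ i * weak_gradient \<Omega> w x $ i) + laplacian v x * w x)"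
      using green_pairing_weak_form[OF v _ smooth_L2[OF smooth_laplacian[OF v]] smooth_weak_laplacian[OF v]]
      by (simp add: green_functional[OF v w])
  qed (intro smooth_H1 green_functional_Hmhalf smooth_weak_laplacian smooth_L2 smooth_laplacian v)+
  then have "has_normal_derivative \<Omega> v (normal_derivative \<Omega> v)"
    unfolding normal_derivative_def by (rule someI[where P = "has_normal_derivative \<Omega> v"])
  then obtain h where h: "h \<in> L2_space \<mu>" "has_weak_laplacian \<Omega> v h"
    and eq: "\<And>w g. has_boundary_trace \<Omega> w g \<Longrightarrow> normal_derivative \<Omega> v g =
      (LINT x|\<mu>. (\<Sum>i\<in>UNIV. weak_gradient \<Omega> v x $ i * weak_gradient \<Omega> w x $ i) + h x * w x)"
    unfolding has_normal_derivative_def by blast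
  obtain w where w: "has_boundary_trace \<Omega> w g" using g by (auto simp: Hhalf_def)
  then have "w \<in> H1 \<Omega>" by (simp add: has_boundary_trace_def)
  then show ?thesis
    using eq[OF w] green_pairing_weak_form[OF v _ h] green_functional[OF v w] by simp
qed

end

section \<open>Plane waves\<close>

lemma norm_exp_i_diff_le: "norm (exp (\<i> * complex_of_real a) - exp (\<i> * complex_of_real b)) \<le> \<bar>a - b\<bar>"
proof -
  have "exp (\<i> * complex_of_real a) - exp (\<i> * complex_of_real b)
      = exp (\<i> * complex_of_real b) * (exp (\<i> * complex_of_real (a - b)) - 1)"
    by (simp add: right_diff_distrib exp_add[symmetric] algebra_simps)
  then have "norm (exp (\<i> * complex_of_real a) - exp (\<i> * complex_of_real b)) = 2 * \<bar>sin ((a - b) / 2)\<bar>"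
    by (simp add: norm_mult dist_exp_i_1 del: of_real_diff)
  then show ?thesis using abs_sin_x_le_abs_x[of "(a - b) / 2"] by simp
qed

lemma norm_plane_wave [simp]: "norm (plane_wave k y x) = 1"
  unfolding plane_wave_def by (rule norm_exp_i_times)

lemma plane_wave_has_derivative:
  "(plane_wave k y has_derivative (\<lambda>h. \<i> * complex_of_real (k * (h \<bullet> y)) * plane_wave k y x)) (at x)"
proof -
  have "((\<lambda>x. \<i> * complex_of_real (k * (x \<bullet> y))) has_derivative (\<lambda>h. \<i> * complex_of_real (k * (h \<bullet> y)))) (at x)"
    by (intro has_derivative_mult_right has_derivative_of_real has_derivative_inner_left has_derivative_ident)
  from has_derivative_compose[OF this DERIV_exp[unfolded has_field_derivative_def]]
  show ?thesis unfolding plane_wave_def by (simp add: mult.commute)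
qed

lemma pderivative_plane_wave:
  "pderivative i (plane_wave k y) = (\<lambda>x. \<i> * complex_of_real (k * y $ i) * plane_wave k y x)"
  by (rule ext, rule pderivative_eqI[OF plane_wave_has_derivative, THEN trans])
     (simp add: inner_commute inner_axis)

lemma smooth_plane_wave: "smooth (plane_wave k y)"
proof -
  have "Ck m (plane_wave k y)" for m
  proof (induction m)
    case 0
    show ?case by (simp add: plane_wave_def) (intro continuous_intros)
  next
    case (Suc m)
    have "plane_wave k y differentiable_on UNIV"
      unfolding differentiable_on_def differentiable_def using plane_wave_has_derivative by blast
    then show ?case
      using Ck_lincomb[OF Suc Suc, of _ 0] by (simp add: pderivative_plane_wave)
  qed
  then show ?thesis by (simp add: smooth_def)
qed

lemma laplacian_plane_wave:
  "laplacian (plane_wave k y) = (\<lambda>x. - complex_of_real (k\<^sup>2 * (\<Sum>i\<in>UNIV. (y $ i)\<^sup>2)) * plane_wave k y x)"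
proof
  fix x
  have "pderivative i (pderivative i (plane_wave k y)) x = - complex_of_real (k\<^sup>2 * (y $ i)\<^sup>2) * plane_wave k y x" for i
  proof -
    have "pderivative i (\<lambda>x. \<i> * complex_of_real (k * y $ i) * plane_wave k y x + 0 * plane_wave k y x) x
        = \<i> * complex_of_real (k * y $ i) * pderivative i (plane_wave k y) x + 0 * pderivative i (plane_wave k y) x"
      using pderivative_lincomb[OF smooth_differentiable smooth_differentiable, OF smooth_plane_wave smooth_plane_wave] by metis
    then show ?thesis by (simp add: pderivative_plane_wave power2_eq_square algebra_simps)
  qed
  then show "laplacian (plane_wave k y) x = - complex_of_real (k\<^sup>2 * (\<Sum>i\<in>UNIV. (y $ i)\<^sup>2)) * plane_wave k y x"
    by (simp add: laplacian_def sum_distrib_left sum_distrib_right sum_negf)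
qed

lemma norm_eq_1_sum_sq: "norm (y :: real^'d) = 1 \<Longrightarrow> (\<Sum>i\<in>UNIV. (y $ i)\<^sup>2) = 1"
  by (simp add: norm_vec_def L2_set_def)

definition plane_wave_C2 :: "real \<Rightarrow> real" where
  "plane_wave_C2 k = 1 + \<bar>k\<bar> + k\<^sup>2"

lemma plane_wave_C2_bound:
  fixes y :: "real^'d"
  assumes y: "norm y = 1"
  shows "C2_bound S (plane_wave k y) (plane_wave_C2 k)"
proof -
  have "\<bar>k * y $ i\<bar> \<le> \<bar>k\<bar>" for i
    using component_le_norm_cart[of y i] y by (simp add: abs_mult mult_left_le)
  then have "norm (pderivative i (plane_wave k y) x) \<le> \<bar>k\<bar>" for i x
    by (simp add: pderivative_plane_wave norm_mult abs_mult)
  moreover have "norm (laplacian (plane_wave k y) x) = k\<^sup>2" for x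
    using norm_eq_1_sum_sq[OF y] by (simp add: laplacian_plane_wave norm_mult norm_power)
  ultimately show ?thesis
    unfolding C2_bound_def plane_wave_C2_def by (auto intro: order_trans) (smt (verit) abs_ge_zero zero_le_power2)+
qed

text \<open>
  Plane waves are Lipschitz in their direction, in the \<open>C\<^sup>2\<close> sense on bounded sets. On unit
  directions the Laplacian is multiplication by \<open>-k\<^sup>2\<close>, so that its difference needs no new estimate.
\<close>

lemma plane_wave_difference_C2_bound:
  fixes y y' :: "real^'d"
  assumes y: "norm y = 1" "norm y' = 1" and R: "0 \<le> R" "\<And>x. x \<in> S \<Longrightarrow> norm x \<le> R"
  shows "C2_bound S (\<lambda>x. plane_wave k y x - plane_wave k y' x)
           ((1 + \<bar>k\<bar> + k\<^sup>2) * (1 + \<bar>k\<bar> * R) * norm (y - y'))"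
proof -
  define A where "A = \<bar>k\<bar> * R"
  define n where "n = norm (y - y')"
  have A: "0 \<le> A" and n: "0 \<le> n" using R by (simp_all add: A_def n_def)
  have d0: "norm (plane_wave k y x - plane_wave k y' x) \<le> A * n" if x: "x \<in> S" for x
  proof -
    have "norm (plane_wave k y x - plane_wave k y' x) \<le> \<bar>k * (x \<bullet> y) - k * (x \<bullet> y')\<bar>"
      unfolding plane_wave_def by (rule norm_exp_i_diff_le)
    also have "\<dots> = \<bar>k\<bar> * \<bar>x \<bullet> (y - y')\<bar>" by (simp add: inner_diff_right abs_mult flip: right_diff_distrib)
    also have "\<dots> \<le> \<bar>k\<bar> * (R * n)"
    proof (rule mult_left_mono)
      have "\<bar>x \<bullet> (y - y')\<bar> \<le> norm x * n" unfolding n_def by (rule Cauchy_Schwarz_ineq2)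
      also have "\<dots> \<le> R * n" using R(2)[OF x] n by (rule mult_right_mono)
      finally show "\<bar>x \<bullet> (y - y')\<bar> \<le> R * n" .
    qed simp
    finally show ?thesis by (simp add: A_def)
  qed
  have s: "smooth (plane_wave k y)" "smooth (plane_wave k y')" by (rule smooth_plane_wave)+
  have big: "c * (1 + A) * n \<le> (1 + \<bar>k\<bar> + k\<^sup>2) * (1 + A) * n" if "c \<le> 1 + \<bar>k\<bar> + k\<^sup>2" for c
    using that A n by (intro mult_right_mono) auto
  have An: "A * n \<le> (1 + A) * n" using n by (simp add: algebra_simps)
  show ?thesis
    unfolding C2_bound_def A_def[symmetric] n_def[symmetric]
  proof (intro ballI conjI allI)
    fix x assume x: "x \<in> S"
    show "norm (plane_wave k y x - plane_wave k y' x) \<le> (1 + \<bar>k\<bar> + k\<^sup>2) * (1 + A) * n"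
      using d0[OF x] An big[of 1] by simp
    fix i
    have "pderivative i (\<lambda>x. plane_wave k y x - plane_wave k y' x) x
        = pderivative i (plane_wave k y) x - pderivative i (plane_wave k y') x"
      using fun_cong[OF pderivative_lincomb[OF smooth_differentiable smooth_differentiable, OF s, of i 1 "-1"], of x] by simp
    also have "\<dots> = \<i> * complex_of_real k * (complex_of_real (y $ i - y' $ i) * plane_wave k y x
        + complex_of_real (y' $ i) * (plane_wave k y x - plane_wave k y' x))"
      by (simp add: pderivative_plane_wave algebra_simps)
    finally have "norm (pderivative i (\<lambda>x. plane_wave k y x - plane_wave k y' x) x)
        = \<bar>k\<bar> * norm (complex_of_real (y $ i - y' $ i) * plane_wave k y x
          + complex_of_real (y' $ i) * (plane_wave k y x - plane_wave k y' x))"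
      by (simp add: norm_mult del: of_real_diff)
    also have "\<dots> \<le> \<bar>k\<bar> * (n + A * n)"
    proof (rule mult_left_mono, rule norm_triangle_le, rule add_mono)
      show "norm (complex_of_real (y $ i - y' $ i) * plane_wave k y x) \<le> n"
        using component_le_norm_cart[of "y - y'" i] by (simp add: norm_mult n_def del: of_real_diff)
      have "\<bar>y' $ i\<bar> * norm (plane_wave k y x - plane_wave k y' x) \<le> 1 * (A * n)"
        using component_le_norm_cart[of y' i] y(2) d0[OF x] by (intro mult_mono) auto
      then show "norm (complex_of_real (y' $ i) * (plane_wave k y x - plane_wave k y' x)) \<le> A * n"
        by (simp add: norm_mult)
    qed simp
    also have "\<dots> = \<bar>k\<bar> * (1 + A) * n" by (simp add: algebra_simps)
    also have "\<dots> \<le> (1 + \<bar>k\<bar> + k\<^sup>2) * (1 + A) * n" by (rule big) simp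
    finally show "norm (pderivative i (\<lambda>x. plane_wave k y x - plane_wave k y' x) x)
        \<le> (1 + \<bar>k\<bar> + k\<^sup>2) * (1 + A) * n" .
    have "laplacian (\<lambda>x. plane_wave k y x - plane_wave k y' x) x = laplacian (plane_wave k y) x - laplacian (plane_wave k y') x"
      using fun_cong[OF laplacian_lincomb[OF s, of 1 "-1"], of x] by simp
    also have "\<dots> = - complex_of_real (k\<^sup>2) * (plane_wave k y x - plane_wave k y' x)"
      using norm_eq_1_sum_sq[OF y(1)] norm_eq_1_sum_sq[OF y(2)] by (simp add: laplacian_plane_wave algebra_simps)
    finally have "norm (laplacian (\<lambda>x. plane_wave k y x - plane_wave k y' x) x) = k\<^sup>2 * norm (plane_wave k y x - plane_wave k y' x)"
      by (simp add: norm_mult norm_power)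
    also have "\<dots> \<le> k\<^sup>2 * ((1 + A) * n)"
      using d0[OF x] An by (intro mult_left_mono) auto
    also have "\<dots> = k\<^sup>2 * (1 + A) * n" by simp
    also have "\<dots> \<le> (1 + \<bar>k\<bar> + k\<^sup>2) * (1 + A) * n" by (rule big) simp
    finally show "norm (laplacian (\<lambda>x. plane_wave k y x - plane_wave k y' x) x) \<le> (1 + \<bar>k\<bar> + k\<^sup>2) * (1 + A) * n" .
  qed
qed

section \<open>Stability of the imaging functional\<close>

lemma Hmhalf_diff:
  assumes "\<psi> \<in> Hmhalf \<Omega>" "\<xi> \<in> Hmhalf \<Omega>"
  shows "(\<lambda>g. \<psi> g - \<xi> g) \<in> Hmhalf \<Omega>"
proof -
  obtain K where K: "\<forall>g\<in>Hhalf \<Omega>. norm (\<psi> g) \<le> K * Hhalf_norm \<Omega> g" using assms(1) by (auto simp: Hmhalf_def)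
  obtain L where L: "\<forall>g\<in>Hhalf \<Omega>. norm (\<xi> g) \<le> L * Hhalf_norm \<Omega> g" using assms(2) by (auto simp: Hmhalf_def)
  have "norm (\<psi> g - \<xi> g) \<le> (K + L) * Hhalf_norm \<Omega> g" if "g \<in> Hhalf \<Omega>" for g
  proof -
    have "norm (\<psi> g - \<xi> g) \<le> norm (\<psi> g) + norm (\<xi> g)" by (rule norm_triangle_ineq4)
    also have "\<dots> \<le> K * Hhalf_norm \<Omega> g + L * Hhalf_norm \<Omega> g" using K L that by (intro add_mono) auto
    finally show ?thesis by (simp add: distrib_right)
  qed
  then have "\<exists>K. \<forall>g\<in>Hhalf \<Omega>. norm (\<psi> g - \<xi> g) \<le> K * Hhalf_norm \<Omega> g" by blast
  moreover have "\<psi> (\<lambda>x. a * g x + b * h x) - \<xi> (\<lambda>x. a * g x + b * h x) = a * (\<psi> g - \<xi> g) + b * (\<psi> h - \<xi> h)"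
    if "g \<in> Hhalf \<Omega>" "h \<in> Hhalf \<Omega>" for g h a b
    using assms that by (simp add: Hmhalf_def algebra_simps)
  ultimately show ?thesis by (simp add: Hmhalf_def)
qed

lemma Hmhalf_linear_diff:
  assumes "\<psi> \<in> Hmhalf \<Omega>" "g \<in> Hhalf \<Omega>" "h \<in> Hhalf \<Omega>"
  shows "\<psi> (\<lambda>x. g x - h x) = \<psi> g - \<psi> h"
proof -
  have "\<psi> (\<lambda>x. 1 * g x + (-1) * h x) = 1 * \<psi> g + (-1) * \<psi> h"
    using assms unfolding Hmhalf_def by blast
  then show ?thesis by simp
qed

context finite_boundary_domain
begin

text \<open>
  Rescale \<open>g\<close> into the unit ball. The factor \<open>2\<close> compensates for the constant in
  \<open>H1_norm_lincomb_sq\<close>.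
\<close>

lemma Hmhalf_norm_bound:
  assumes \<psi>: "\<psi> \<in> Hmhalf \<Omega>" and u: "has_boundary_trace \<Omega> u g" and M: "H1_norm \<Omega> u \<le> M" "0 < M"
  shows "norm (\<psi> g) \<le> 2 * M * Hmhalf_norm \<Omega> \<psi>"
proof -
  define a where "a = complex_of_real (1 / (2 * M))"
  have "norm a = \<bar>1 / (2 * M)\<bar>" unfolding a_def by (rule norm_of_real)
  then have a: "norm a = 1 / (2 * M)" using M(2) by simp
  have uH: "u \<in> H1 \<Omega>" and g: "g \<in> Hhalf \<Omega>" using u by (auto simp: has_boundary_trace_def Hhalf_def)
  have tr: "has_boundary_trace \<Omega> (\<lambda>x. a * u x + 0 * u x) (\<lambda>x. a * g x + 0 * g x)"
    by (rule trace_lincomb[OF u u])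
  have "(H1_norm \<Omega> (\<lambda>x. a * u x + 0 * u x))\<^sup>2 \<le> 2 * (norm a)\<^sup>2 * (H1_norm \<Omega> u)\<^sup>2"
    using H1_norm_lincomb_sq[OF uH uH, of a 0] by simp
  also have "\<dots> \<le> 2 * (norm a)\<^sup>2 * M\<^sup>2"
    using M H1_norm_nonneg[of u] by (intro mult_left_mono power_mono) auto
  also have "\<dots> \<le> 1\<^sup>2" using M(2) unfolding a by (simp add: power_divide power_mult_distrib)
  finally have "H1_norm \<Omega> (\<lambda>x. a * u x + 0 * u x) \<le> 1" by (rule power2_le_imp_le) simp
  then have ag: "Hhalf_norm \<Omega> (\<lambda>x. a * g x + 0 * g x) \<le> 1" using Hhalf_norm_le[OF tr] by linarith
  have agH: "(\<lambda>x. a * g x + 0 * g x) \<in> Hhalf \<Omega>" using tr by (auto simp: Hhalf_def)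
  obtain K where K: "\<forall>h\<in>Hhalf \<Omega>. norm (\<psi> h) \<le> K * Hhalf_norm \<Omega> h" using \<psi> by (auto simp: Hmhalf_def)
  have bdd: "bdd_above {norm (\<psi> h) | h. h \<in> Hhalf \<Omega> \<and> Hhalf_norm \<Omega> h \<le> 1}"
  proof (rule bdd_aboveI)
    fix z assume "z \<in> {norm (\<psi> h) | h. h \<in> Hhalf \<Omega> \<and> Hhalf_norm \<Omega> h \<le> 1}"
    then obtain h where h: "z = norm (\<psi> h)" "h \<in> Hhalf \<Omega>" "Hhalf_norm \<Omega> h \<le> 1" by blast
    have "K * Hhalf_norm \<Omega> h \<le> \<bar>K\<bar> * 1"
      using h(3) Hhalf_norm_nonneg[OF h(2)] by (intro mult_mono) auto
    then show "z \<le> \<bar>K\<bar>" using K h(1,2) by fastforce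
  qed
  have "norm (\<psi> (\<lambda>x. a * g x + 0 * g x)) \<le> Hmhalf_norm \<Omega> \<psi>"
    unfolding Hmhalf_norm_def by (rule cSup_upper[OF _ bdd]) (use ag agH in blast)
  moreover have "\<psi> (\<lambda>x. a * g x + 0 * g x) = a * \<psi> g + 0 * \<psi> g"
    using \<psi> g unfolding Hmhalf_def by blast
  ultimately have "norm (\<psi> g) / (2 * M) \<le> Hmhalf_norm \<Omega> \<psi>" by (simp add: norm_mult a)
  then show ?thesis using M(2) by (simp add: pos_divide_le_eq mult.commute)
qed

lemma plane_wave_trace: "has_boundary_trace \<Omega> (plane_wave k y) (boundary_trace \<Omega> (plane_wave k y))"
  unfolding boundary_trace_def
  by (rule someI[where P = "has_boundary_trace \<Omega> (plane_wave k y)", OF smooth_trace[OF smooth_plane_wave]])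

lemma R_functional_plane_wave:
  assumes "has_boundary_trace \<Omega> w f"
  shows "R_functional \<Omega> f \<psi> (plane_wave k y) = \<psi> (boundary_trace \<Omega> (plane_wave k y)) - green_pairing (plane_wave k y) w"
proof -
  have "f \<in> Hhalf \<Omega>" using assms by (auto simp: Hhalf_def)
  then show ?thesis
    by (simp add: R_functional_def normal_derivative_smooth[OF smooth_plane_wave] green_functional[OF smooth_plane_wave assms])
qed

text \<open>
  Both terms of \<open>R\<close> are continuous functionals of the plane wave, and plane waves depend Lipschitz
  continuously on their direction. Continuity on the sphere is what makes the integral in the
  imaging functional a genuine one.
\<close>

lemma R_functional_plane_wave_continuous:
  assumes f: "f \<in> Hhalf \<Omega>" and \<psi>: "\<psi> \<in> Hmhalf \<Omega>"
  shows "continuous_on (sphere 0 1) (\<lambda>y. R_functional \<Omega> f \<psi> (plane_wave k y))"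
proof -
  obtain w where w: "has_boundary_trace \<Omega> w f" using f by (auto simp: Hhalf_def)
  then have wH: "w \<in> H1 \<Omega>" by (simp add: has_boundary_trace_def)
  obtain K where K: "\<forall>h\<in>Hhalf \<Omega>. norm (\<psi> h) \<le> K * Hhalf_norm \<Omega> h" using \<psi> by (auto simp: Hmhalf_def)
  obtain R where R: "0 < R" "\<And>x. x \<in> \<Omega> \<Longrightarrow> norm x \<le> R" using bounded_domain bounded_pos by metis
  define L where "L = (1 + \<bar>k\<bar> + k\<^sup>2) * (1 + \<bar>k\<bar> * R)"
  have L: "0 \<le> L" using R(1) by (simp add: L_def)
  define C where "C = \<bar>K\<bar> * (H1_const * L) + H1_const * L * H1_norm \<Omega> w"
  have "lipschitz_on C (sphere 0 1) (\<lambda>y. R_functional \<Omega> f \<psi> (plane_wave k y))"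
  proof (rule lipschitz_onI)
    show "0 \<le> C" unfolding C_def using L H1_const_pos H1_norm_nonneg[of w] by (intro add_nonneg_nonneg mult_nonneg_nonneg) auto
    fix y y' :: "real^'a" assume "y \<in> sphere 0 1" "y' \<in> sphere 0 1"
    then have y: "norm y = 1" "norm y' = 1" by simp_all
    define d where "d = (\<lambda>x. plane_wave k y x - plane_wave k y' x)"
    define t where "t = (\<lambda>y. boundary_trace \<Omega> (plane_wave k y))"
    have sd: "smooth d" unfolding d_def using smooth_lincomb[OF smooth_plane_wave smooth_plane_wave, of 1 k y "-1" k y'] by simp
    have M: "C2_bound \<Omega> d (L * norm (y - y'))" "0 \<le> L * norm (y - y')"
      using plane_wave_difference_C2_bound[OF y, of R \<Omega> k] R L by (simp_all add: d_def L_def)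
    have tr: "has_boundary_trace \<Omega> (plane_wave k y) (t y)" for y unfolding t_def by (rule plane_wave_trace)
    then have tH: "t y \<in> Hhalf \<Omega>" for y by (auto simp: Hhalf_def)
    have trd: "has_boundary_trace \<Omega> d (\<lambda>x. t y x - t y' x)" unfolding d_def by (rule trace_diff[OF tr tr])
    have dH: "(\<lambda>x. t y x - t y' x) \<in> Hhalf \<Omega>" using trd by (auto simp: Hhalf_def)
    have "norm (\<psi> (t y) - \<psi> (t y')) = norm (\<psi> (\<lambda>x. t y x - t y' x))"
      using Hmhalf_linear_diff[OF \<psi> tH tH] by simp
    also have "\<dots> \<le> K * Hhalf_norm \<Omega> (\<lambda>x. t y x - t y' x)" using K dH by blast
    also have "\<dots> \<le> \<bar>K\<bar> * (H1_const * (L * norm (y - y')))"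
      using Hhalf_norm_nonneg[OF dH] Hhalf_norm_le[OF trd] H1_norm_smooth_le[OF sd M] by (intro mult_mono) auto
    finally have 1: "norm (\<psi> (t y) - \<psi> (t y')) \<le> \<bar>K\<bar> * (H1_const * (L * norm (y - y')))" .
    have "green_pairing d w = green_pairing (plane_wave k y) w - green_pairing (plane_wave k y') w"
      unfolding d_def using green_pairing_lincomb_left[OF smooth_plane_wave smooth_plane_wave wH, of 1 k y "-1" k y'] by simp
    then have 2: "norm (green_pairing (plane_wave k y) w - green_pairing (plane_wave k y') w) \<le> H1_const * (L * norm (y - y')) * H1_norm \<Omega> w"
      using norm_green_pairing_le[OF sd wH M] by simp
    have "dist (R_functional \<Omega> f \<psi> (plane_wave k y)) (R_functional \<Omega> f \<psi> (plane_wave k y'))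
        = norm ((\<psi> (t y) - \<psi> (t y')) - (green_pairing (plane_wave k y) w - green_pairing (plane_wave k y') w))"
      unfolding R_functional_plane_wave[OF w] dist_norm t_def by (simp add: algebra_simps)
    also have "\<dots> \<le> norm (\<psi> (t y) - \<psi> (t y')) + norm (green_pairing (plane_wave k y) w - green_pairing (plane_wave k y') w)"
      by (rule norm_triangle_ineq4)
    also have "\<dots> \<le> C * dist y y'" using 1 2 by (simp add: C_def dist_norm algebra_simps)
    finally show "dist (R_functional \<Omega> f \<psi> (plane_wave k y)) (R_functional \<Omega> f \<psi> (plane_wave k y')) \<le> C * dist y y'" .
  qed
  then show ?thesis by (rule lipschitz_on_continuous_on)
qed

lemma R_functional_difference_le:
  assumes f: "f \<in> Hhalf \<Omega>" "f' \<in> Hhalf \<Omega>" and \<psi>: "(\<lambda>g. \<psi>' g - \<psi> g) \<in> Hmhalf \<Omega>" and y: "norm y = 1"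
  shows "norm (R_functional \<Omega> f \<psi> (plane_wave k y) - R_functional \<Omega> f' \<psi>' (plane_wave k y))
    \<le> H1_const * plane_wave_C2 k * (2 * Hmhalf_norm \<Omega> (\<lambda>g. \<psi>' g - \<psi> g) + Hhalf_norm \<Omega> (\<lambda>x. f' x - f x))"
proof -
  let ?v = "plane_wave k y"
  have M: "C2_bound \<Omega> ?v (plane_wave_C2 k)" "0 < plane_wave_C2 k"
    using plane_wave_C2_bound[OF y] by (simp_all add: plane_wave_C2_def add_pos_nonneg)
  have "H1_norm \<Omega> ?v \<le> H1_const * plane_wave_C2 k" using M by (intro H1_norm_smooth_le smooth_plane_wave) auto
  then have 1: "norm (\<psi>' (boundary_trace \<Omega> ?v) - \<psi> (boundary_trace \<Omega> ?v)) \<le> 2 * (H1_const * plane_wave_C2 k) * Hmhalf_norm \<Omega> (\<lambda>g. \<psi>' g - \<psi> g)"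
    using M(2) H1_const_pos by (intro Hmhalf_norm_bound[OF \<psi> plane_wave_trace]) auto
  have d: "(\<lambda>x. f' x - f x) \<in> Hhalf \<Omega>" using f trace_diff by (fastforce simp: Hhalf_def)
  have "normal_derivative \<Omega> ?v f' - normal_derivative \<Omega> ?v f = green_functional ?v (\<lambda>x. f' x - f x)"
    using f by (simp add: normal_derivative_smooth smooth_plane_wave Hmhalf_linear_diff[OF green_functional_Hmhalf])
  then have 2: "norm (normal_derivative \<Omega> ?v f' - normal_derivative \<Omega> ?v f) \<le> H1_const * plane_wave_C2 k * Hhalf_norm \<Omega> (\<lambda>x. f' x - f x)"
    using norm_green_functional_le[OF smooth_plane_wave M(1) _ d] M(2) by simp
  have "R_functional \<Omega> f \<psi> ?v - R_functional \<Omega> f' \<psi>' ?v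
      = (normal_derivative \<Omega> ?v f' - normal_derivative \<Omega> ?v f) - (\<psi>' (boundary_trace \<Omega> ?v) - \<psi> (boundary_trace \<Omega> ?v))"
    by (simp add: R_functional_def)
  then have "norm (R_functional \<Omega> f \<psi> ?v - R_functional \<Omega> f' \<psi>' ?v)
      \<le> norm (normal_derivative \<Omega> ?v f' - normal_derivative \<Omega> ?v f) + norm (\<psi>' (boundary_trace \<Omega> ?v) - \<psi> (boundary_trace \<Omega> ?v))"
    using norm_triangle_ineq4 by metis
  then show ?thesis using 1 2 by (simp add: algebra_simps)
qed

end

text \<open>
  In this case the surface measure is the null measure by convention.
\<close>

lemma imaging_zero:
  fixes z :: "real^'d"
  assumes "\<not> measure_space UNIV (sets borel) (hausdorff_outer (CARD('d) - 1) :: (real^'d) set \<Rightarrow> ennreal)"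
  shows "imaging \<Omega> k f \<psi> z = 0"
proof -
  let ?S = "surface_measure (sphere (0::real^'d) 1)"
  have "emeasure ?S (space ?S) = 0"
    using assms unfolding surface_measure_def
    by (subst emeasure_restrict_space) (auto simp: emeasure_hausdorff_measure space_restrict_space)
  then have "space ?S \<in> null_sets ?S" by (intro null_setsI sets.top)
  then have "AE x in ?S. x \<notin> space ?S" by (rule AE_not_in)
  then have "AE x in ?S. False" using AE_space by eventually_elim simp
  then have "AE y in ?S. R_functional \<Omega> f \<psi> (plane_wave k y) * cnj (plane_wave k y z) = 0"
    by (rule eventually_mono) simp
  then show ?thesis unfolding imaging_def by (simp add: integral_eq_zero_AE)
qed

theorem theorem3p3:
  fixes \<Omega> D :: "(real^'d) set" and k c0 K \<epsilon> C1 C2 :: real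
    and J :: nat and c :: "nat \<Rightarrow> real^'d" and B :: "nat \<Rightarrow> (real^'d) set"
    and \<rho> f us :: "real^'d \<Rightarrow> complex"
    and us\<delta> :: "real \<Rightarrow> real^'d \<Rightarrow> complex"
    and dus\<delta> :: "real \<Rightarrow> 'd boundary_functional"
  assumes "CARD('d) = 2 \<or> CARD('d) = 3"
    and "bounded \<Omega>" and "open \<Omega>" and "simply_connected \<Omega>" and "lipschitz_boundary \<Omega>"
    and "0 < k" and "\<not> dirichlet_eigenvalue \<Omega> (k\<^sup>2)"
    and "admissible_sources \<Omega> c0 K \<epsilon> J c B" and "D = source_region \<epsilon> J c B"
    and "\<rho> \<in> Linf_space (lebesgue_on D)" and "f \<in> Hhalf \<Omega>"
    and "us \<in> H1 \<Omega>" and "solves_helmholtz \<Omega> k (\<lambda>x. indicator D x * \<rho> x) us"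
    and "has_boundary_trace \<Omega> us f"
    and "0 < C1" and "0 < C2"
    and "\<And>\<delta>. 0 < \<delta> \<Longrightarrow> \<delta> < 1 \<Longrightarrow> us\<delta> \<delta> \<in> Hhalf \<Omega> \<and> dus\<delta> \<delta> \<in> Hmhalf \<Omega>"
    and "\<And>\<delta>. 0 < \<delta> \<Longrightarrow> \<delta> < 1 \<Longrightarrow>
           (\<lambda>g. dus\<delta> \<delta> g - normal_derivative \<Omega> us g) \<in> Hmhalf \<Omega> \<and>
           Hmhalf_norm \<Omega> (\<lambda>g. dus\<delta> \<delta> g - normal_derivative \<Omega> us g) \<le> C1 * \<delta>"
    and "\<And>\<delta>. 0 < \<delta> \<Longrightarrow> \<delta> < 1 \<Longrightarrow> Hhalf_norm \<Omega> (\<lambda>x. us\<delta> \<delta> x - f x) \<le> C2 * \<delta>"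
  shows "\<forall>z. (\<lambda>\<delta>. \<bar>imaging \<Omega> k f (normal_derivative \<Omega> us) z
                   - imaging \<Omega> k (us\<delta> \<delta>) (dus\<delta> \<delta>) z\<bar>) \<in> O[at_right 0](\<lambda>\<delta>. \<delta>)"
proof
  fix z
  have dim: "2 \<le> CARD('d)" using assms(1) by auto
  show "(\<lambda>\<delta>. \<bar>imaging \<Omega> k f (normal_derivative \<Omega> us) z - imaging \<Omega> k (us\<delta> \<delta>) (dus\<delta> \<delta>) z\<bar>) \<in> O[at_right 0](\<lambda>\<delta>. \<delta>)"
  proof (cases "measure_space UNIV (sets borel) (hausdorff_outer (CARD('d) - 1) :: (real^'d) set \<Rightarrow> ennreal)")
    case False
    then show ?thesis by (simp add: imaging_zero)
  next
    case True
    interpret finite_boundary_domain \<Omega>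
      by unfold_locales (use assms(2,3,5) dim True emeasure_lipschitz_boundary_finite in auto)
    define \<psi> where "\<psi> = normal_derivative \<Omega> us"
    let ?S = "surface_measure (sphere (0::real^'d) 1)"
    interpret S: finite_measure ?S
      by (rule finite_measure_surface[OF closed_sphere emeasure_sphere_finite[OF dim]])
    \<comment> \<open>the exact normal derivative is the difference of two bounded functionals, say at noise level 1/2\<close>
    have \<psi>: "\<psi> \<in> Hmhalf \<Omega>"
      using Hmhalf_diff[of "dus\<delta> (1/2)" \<Omega> "\<lambda>g. dus\<delta> (1/2) g - normal_derivative \<Omega> us g"] assms(17,18)[of "1/2"]
      by (simp add: \<psi>_def)
    define F where "F = (\<lambda>h \<xi> y. R_functional \<Omega> h \<xi> (plane_wave k y) * cnj (plane_wave k y z))"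
    have F_int: "integrable ?S (F h \<xi>)" if "h \<in> Hhalf \<Omega>" "\<xi> \<in> Hmhalf \<Omega>" for h \<xi>
    proof -
      have c: "continuous_on (sphere 0 1) (F h \<xi>)"
        unfolding F_def
        by (intro continuous_intros R_functional_plane_wave_continuous that)
           (auto simp: plane_wave_def intro!: continuous_intros)
      then have "bounded (F h \<xi> ` sphere 0 1)"
        by (intro compact_imp_bounded compact_continuous_image) auto
      then obtain B where "\<forall>y\<in>sphere 0 1. norm (F h \<xi> y) \<le> B" by (auto simp: bounded_iff)
      then show ?thesis
        by (intro S.integrable_const_bound[where B = B] AE_I2 continuous_borel_measurable_surface[OF c]) auto
    qed
    define A where "A = measure ?S (sphere 0 1)"
    define C where "C = H1_const * plane_wave_C2 k * (2 * C1 + C2) * A"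
    have bound: "\<bar>imaging \<Omega> k f \<psi> z - imaging \<Omega> k (us\<delta> \<delta>) (dus\<delta> \<delta>) z\<bar> \<le> C * \<delta>" if \<delta>: "0 < \<delta>" "\<delta> < 1" for \<delta>
    proof -
      have h: "us\<delta> \<delta> \<in> Hhalf \<Omega>" "dus\<delta> \<delta> \<in> Hmhalf \<Omega>" "(\<lambda>g. dus\<delta> \<delta> g - \<psi> g) \<in> Hmhalf \<Omega>"
        "Hmhalf_norm \<Omega> (\<lambda>g. dus\<delta> \<delta> g - \<psi> g) \<le> C1 * \<delta>" "Hhalf_norm \<Omega> (\<lambda>x. us\<delta> \<delta> x - f x) \<le> C2 * \<delta>"
        using assms(17-19)[OF \<delta>] by (simp_all add: \<psi>_def)
      have p: "0 \<le> H1_const * plane_wave_C2 k"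
        using H1_const_pos by (simp add: plane_wave_C2_def)
      have i: "integrable ?S (F f \<psi>)" "integrable ?S (F (us\<delta> \<delta>) (dus\<delta> \<delta>))"
        using F_int h assms(11) \<psi> by auto
      have "\<bar>imaging \<Omega> k f \<psi> z - imaging \<Omega> k (us\<delta> \<delta>) (dus\<delta> \<delta>) z\<bar> \<le> norm ((LINT y|?S. F f \<psi> y) - (LINT y|?S. F (us\<delta> \<delta>) (dus\<delta> \<delta>) y))"
        unfolding imaging_def F_def by (rule norm_triangle_ineq3)
      also have "\<dots> = norm (LINT y|?S. F f \<psi> y - F (us\<delta> \<delta>) (dus\<delta> \<delta>) y)"
        using i by simp
      also have "\<dots> \<le> (LINT y|?S. norm (F f \<psi> y - F (us\<delta> \<delta>) (dus\<delta> \<delta>) y))" by (rule integral_norm_bound)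
      also have "\<dots> \<le> (LINT y|?S. H1_const * plane_wave_C2 k * (2 * C1 + C2) * \<delta>)"
      proof (rule integral_mono)
        show "integrable ?S (\<lambda>y. norm (F f \<psi> y - F (us\<delta> \<delta>) (dus\<delta> \<delta>) y))" using i by simp
        fix y assume "y \<in> space ?S"
        then have y: "norm y = 1" by simp
        have "norm (F f \<psi> y - F (us\<delta> \<delta>) (dus\<delta> \<delta>) y)
            = norm (R_functional \<Omega> f \<psi> (plane_wave k y) - R_functional \<Omega> (us\<delta> \<delta>) (dus\<delta> \<delta>) (plane_wave k y))"
          unfolding F_def left_diff_distrib[symmetric] by (simp add: norm_mult)
        also have "\<dots> \<le> H1_const * plane_wave_C2 k * (2 * Hmhalf_norm \<Omega> (\<lambda>g. dus\<delta> \<delta> g - \<psi> g) + Hhalf_norm \<Omega> (\<lambda>x. us\<delta> \<delta> x - f x))"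
          by (rule R_functional_difference_le[OF assms(11) h(1,3) y])
        also have "\<dots> \<le> H1_const * plane_wave_C2 k * (2 * (C1 * \<delta>) + C2 * \<delta>)"
          using h(4,5) by (intro mult_left_mono[OF _ p] add_mono) auto
        also have "\<dots> = H1_const * plane_wave_C2 k * (2 * C1 + C2) * \<delta>" by (simp add: algebra_simps)
        finally show "norm (F f \<psi> y - F (us\<delta> \<delta>) (dus\<delta> \<delta>) y) \<le> H1_const * plane_wave_C2 k * (2 * C1 + C2) * \<delta>" .
      qed simp
      also have "\<dots> = C * \<delta>" by (simp add: C_def A_def)
      finally show ?thesis .
    qed
    show ?thesis
    proof (rule bigoI[where c = C])
      have "eventually (\<lambda>\<delta>::real. \<delta> \<in> {0<..<1}) (at_right 0)" by (rule eventually_at_right_real) simp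
      then show "eventually (\<lambda>\<delta>. norm \<bar>imaging \<Omega> k f (normal_derivative \<Omega> us) z - imaging \<Omega> k (us\<delta> \<delta>) (dus\<delta> \<delta>) z\<bar> \<le> C * norm \<delta>) (at_right 0)"
        by eventually_elim (use bound in \<open>auto simp: \<psi>_def\<close>)
    qed
  qed
qed

end
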